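(* Amalgamated products of sofic groups over amenable groups are sofic: if $G_1$ and $G_2$ are countable sofic groups with a common amenable subgroup $H$, then $G_1*_HG_2$ is sofic.
   Context: Fix a free ultrafilter $\omega$ on $\mathbb{N}$. For positive integers $(n_k)_k$, let $P_{n}\subset M_{n}(\mathbb{C})$ be the group of permutation matrices and let $\Pi_{k\to\omega}P_{n_k}$ be the group of elements of the tracial matrix ultraproduct $\Pi_{k\to\omega}M_{n_k}(\mathbb{C})$ represented by sequences of permutation matrices, i.e. sequences $(p_k)$ with $p_k\in P_{n_k}$ modulo $(p_k)\sim(q_k)$ iff $\lim_{k\to\omega}\|p_k-q_k\|_2=0$, where $\|x\|_2=Tr(x^*x)^{1/2}$ and $Tr$ is the normalized trace. A countable group $G$ is sofic if for some sequence $(n_k)$ there is a homomorphism $\Theta:G\to\Pi_{k\to\omega}P_{n_k}$ with $Tr(\Theta(g))=0$ for all $g\neq e$, where $Tr$ of the class of $(p_k)$ is $\lim_{k\to\omega}Tr(p_k)$. *)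

theory Defs
  imports
    Complex_Main
    "HOL-Library.Countable_Set"
    "HOL-Algebra.Coset"
    "HOL-Combinatorics.Permutations"
    "Jordan_Normal_Form.Schur_Decomposition"
begin

definition free_ultrafilter :: "nat filter \<Rightarrow> bool" where
  "free_ultrafilter \<omega> \<longleftrightarrow>
     \<omega> \<noteq> bot \<and>
     (\<forall>P. eventually P \<omega> \<or> eventually (\<lambda>k. \<not> P k) \<omega>) \<and>
     (\<forall>m. eventually (\<lambda>k. k \<noteq> m) \<omega>)"


text \<open>The normalized trace and the associated 2-norm on square complex matrices.\<close>

definition ntrace :: "complex mat \<Rightarrow> complex" where
  "ntrace A = (\<Sum>i<dim_row A. A $$ (i, i)) / of_nat (dim_row A)"

(* the trace of x* x is a non-negative real number, so taking the real part loses nothing *)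
definition norm2 :: "complex mat \<Rightarrow> real" where
  "norm2 A = sqrt (Re (ntrace (mat_adjoint A * A)))"

definition perm_matrix :: "nat \<Rightarrow> (nat \<Rightarrow> nat) \<Rightarrow> complex mat" where
  "perm_matrix n \<sigma> = mat n n (\<lambda>(i, j). if i = \<sigma> j then 1 else 0)"

definition perm_matrices :: "nat \<Rightarrow> complex mat set" where
  "perm_matrices n = perm_matrix n ` {\<sigma>. \<sigma> permutes {..<n}}"


text \<open>The ultraproduct group of permutation matrices: sequences of permutation matrices of
  sizes \<open>n 0, n 1, \<dots>\<close>, modulo convergence to 0 of the 2-distance along \<open>\<omega>\<close>, with the
  multiplication induced by matrix multiplication of representatives.\<close>

definition perm_seqs :: "(nat \<Rightarrow> nat) \<Rightarrow> (nat \<Rightarrow> complex mat) set" where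
  "perm_seqs n = {p. \<forall>k. p k \<in> perm_matrices (n k)}"

definition ultra_rel ::
    "nat filter \<Rightarrow> (nat \<Rightarrow> nat) \<Rightarrow> ((nat \<Rightarrow> complex mat) \<times> (nat \<Rightarrow> complex mat)) set" where
  "ultra_rel \<omega> n = {(p, q). p \<in> perm_seqs n \<and> q \<in> perm_seqs n \<and>
                       ((\<lambda>k. norm2 (p k - q k)) \<longlongrightarrow> 0) \<omega>}"

definition perm_ultraproduct ::
    "nat filter \<Rightarrow> (nat \<Rightarrow> nat) \<Rightarrow> (nat \<Rightarrow> complex mat) set monoid" where
  "perm_ultraproduct \<omega> n =
     \<lparr>carrier = perm_seqs n // ultra_rel \<omega> n,
      monoid.mult = (\<lambda>A B. \<Union>p\<in>A. \<Union>q\<in>B. ultra_rel \<omega> n `` {\<lambda>k. p k * q k}),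
      monoid.one = ultra_rel \<omega> n `` {\<lambda>k. 1\<^sub>m (n k)}\<rparr>"

(* the limit does not depend on the representative; see ultra_trace_eq below *)
definition ultra_trace :: "nat filter \<Rightarrow> (nat \<Rightarrow> complex mat) set \<Rightarrow> complex" where
  "ultra_trace \<omega> X = (THE z. \<forall>p\<in>X. ((\<lambda>k. ntrace (p k)) \<longlongrightarrow> z) \<omega>)"

definition sofic_group :: "nat filter \<Rightarrow> ('a, 'm) monoid_scheme \<Rightarrow> bool" where
  "sofic_group \<omega> G \<longleftrightarrow>
     group G \<and> countable (carrier G) \<and>
     (\<exists>n. (\<forall>k. 0 < n k) \<and>
       (\<exists>\<Theta> \<in> hom G (perm_ultraproduct \<omega> n).
          \<forall>g \<in> carrier G. g \<noteq> \<one>\<^bsub>G\<^esub> \<longrightarrow> ultra_trace \<omega> (\<Theta> g) = 0))"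


text \<open>Amenability of a discrete group: existence of a left-invariant finitely additive
  probability measure defined on all subsets.\<close>

definition amenable_group :: "('a, 'm) monoid_scheme \<Rightarrow> bool" where
  "amenable_group G \<longleftrightarrow>
     group G \<and>
     (\<exists>\<mu> :: 'a set \<Rightarrow> real.
        (\<forall>A. A \<subseteq> carrier G \<longrightarrow> 0 \<le> \<mu> A) \<and>
        \<mu> (carrier G) = 1 \<and>
        (\<forall>A B. A \<subseteq> carrier G \<longrightarrow> B \<subseteq> carrier G \<longrightarrow> A \<inter> B = {} \<longrightarrow> \<mu> (A \<union> B) = \<mu> A + \<mu> B) \<and>
        (\<forall>g A. g \<in> carrier G \<longrightarrow> A \<subseteq> carrier G \<longrightarrow> \<mu> (g <#\<^bsub>G\<^esub> A) = \<mu> A))"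


text \<open>The amalgamated product of \<open>G1\<close> and \<open>G2\<close> over \<open>H\<close>, where \<open>H\<close> is a common subgroup via
  \<open>f1\<close> and \<open>f2\<close>: words in the elements of the two groups, modulo the congruence generated by
  the multiplications of both groups and by \<open>f1 h = f2 h\<close> for \<open>h\<close> in \<open>H\<close>.\<close>

definition amalg_words ::
    "('a, 'm) monoid_scheme \<Rightarrow> ('b, 'n) monoid_scheme \<Rightarrow> ('a + 'b) list set" where
  "amalg_words G1 G2 = lists (carrier G1 <+> carrier G2)"

inductive amalg_eq ::
    "('a, 'm) monoid_scheme \<Rightarrow> ('b, 'n) monoid_scheme \<Rightarrow> ('c, 'l) monoid_scheme \<Rightarrow>
     ('c \<Rightarrow> 'a) \<Rightarrow> ('c \<Rightarrow> 'b) \<Rightarrow> ('a + 'b) list \<Rightarrow> ('a + 'b) list \<Rightarrow> bool"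
  for G1 G2 H f1 f2 where
  refl: "w \<in> amalg_words G1 G2 \<Longrightarrow> amalg_eq G1 G2 H f1 f2 w w"
| sym: "amalg_eq G1 G2 H f1 f2 v w \<Longrightarrow> amalg_eq G1 G2 H f1 f2 w v"
| trans: "amalg_eq G1 G2 H f1 f2 u v \<Longrightarrow> amalg_eq G1 G2 H f1 f2 v w \<Longrightarrow> amalg_eq G1 G2 H f1 f2 u w"
| cong: "amalg_eq G1 G2 H f1 f2 u u' \<Longrightarrow> amalg_eq G1 G2 H f1 f2 v v' \<Longrightarrow>
    amalg_eq G1 G2 H f1 f2 (u @ v) (u' @ v')"
| one1: "amalg_eq G1 G2 H f1 f2 [Inl \<one>\<^bsub>G1\<^esub>] []"
| one2: "amalg_eq G1 G2 H f1 f2 [Inr \<one>\<^bsub>G2\<^esub>] []"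
| mult1: "x \<in> carrier G1 \<Longrightarrow> y \<in> carrier G1 \<Longrightarrow>
    amalg_eq G1 G2 H f1 f2 [Inl x, Inl y] [Inl (x \<otimes>\<^bsub>G1\<^esub> y)]"
| mult2: "x \<in> carrier G2 \<Longrightarrow> y \<in> carrier G2 \<Longrightarrow>
    amalg_eq G1 G2 H f1 f2 [Inr x, Inr y] [Inr (x \<otimes>\<^bsub>G2\<^esub> y)]"
| amalg: "h \<in> carrier H \<Longrightarrow> amalg_eq G1 G2 H f1 f2 [Inl (f1 h)] [Inr (f2 h)]"

definition amalg_rel ::
    "('a, 'm) monoid_scheme \<Rightarrow> ('b, 'n) monoid_scheme \<Rightarrow> ('c, 'l) monoid_scheme \<Rightarrow>
     ('c \<Rightarrow> 'a) \<Rightarrow> ('c \<Rightarrow> 'b) \<Rightarrow> (('a + 'b) list \<times> ('a + 'b) list) set" where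
  "amalg_rel G1 G2 H f1 f2 = {(v, w). amalg_eq G1 G2 H f1 f2 v w}"

definition amalgamated_product ::
    "('a, 'm) monoid_scheme \<Rightarrow> ('b, 'n) monoid_scheme \<Rightarrow> ('c, 'l) monoid_scheme \<Rightarrow>
     ('c \<Rightarrow> 'a) \<Rightarrow> ('c \<Rightarrow> 'b) \<Rightarrow> ('a + 'b) list set monoid" where
  "amalgamated_product G1 G2 H f1 f2 =
     \<lparr>carrier = amalg_words G1 G2 // amalg_rel G1 G2 H f1 f2,
      monoid.mult = (\<lambda>A B. \<Union>u\<in>A. \<Union>v\<in>B. amalg_rel G1 G2 H f1 f2 `` {u @ v}),
      monoid.one = amalg_rel G1 G2 H f1 f2 `` {[]}\<rparr>"


text \<open>The definitions above are well defined: the ultraproduct is a group on which the trace is a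
  limit along any representative, and the amalgamated product is a group with the universal
  property of the pushout.\<close>

lemma quotient_mult:
  assumes "equiv S R" and "\<And>a a' b b'. (a, a') \<in> R \<Longrightarrow> (b, b') \<in> R \<Longrightarrow> (f a b, f a' b') \<in> R"
    and "a \<in> S" "b \<in> S"
  shows "(\<Union>x\<in>R `` {a}. \<Union>y\<in>R `` {b}. R `` {f x y}) = R `` {f a b}"
proof -
  have "congruent2 R R (\<lambda>x y. R `` {f x y})"
    using assms(1,2) by (auto intro!: congruent2I' equiv_class_eq)
  from UN_equiv_class2[OF assms(1) assms(1) this assms(3,4)] show ?thesis .
qed

lemma quotient_group:
  assumes eq: "equiv S R"
    and cong: "\<And>a a' b b'. (a, a') \<in> R \<Longrightarrow> (b, b') \<in> R \<Longrightarrow> (f a b, f a' b') \<in> R"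
    and cl: "\<And>a b. a \<in> S \<Longrightarrow> b \<in> S \<Longrightarrow> f a b \<in> S"
    and assoc: "\<And>a b c. a \<in> S \<Longrightarrow> b \<in> S \<Longrightarrow> c \<in> S \<Longrightarrow> f (f a b) c = f a (f b c)"
    and one: "e \<in> S" "\<And>a. a \<in> S \<Longrightarrow> f e a = a"
    and inv: "\<And>a. a \<in> S \<Longrightarrow> \<exists>b\<in>S. (f b a, e) \<in> R"
  shows "group \<lparr>carrier = S // R, monoid.mult = (\<lambda>A B. \<Union>x\<in>A. \<Union>y\<in>B. R `` {f x y}),
                monoid.one = R `` {e}\<rparr>" (is "group ?G")
proof -
  note qm = quotient_mult[where f = f, OF eq cong]
  show ?thesis
  proof (rule groupI)
    fix x y assume "x \<in> carrier ?G" "y \<in> carrier ?G"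
    then show "x \<otimes>\<^bsub>?G\<^esub> y \<in> carrier ?G"
      by (auto elim!: quotientE simp: qm cl intro!: quotientI)
  next
    show "\<one>\<^bsub>?G\<^esub> \<in> carrier ?G" using one by (auto intro: quotientI)
  next
    fix x y z assume "x \<in> carrier ?G" "y \<in> carrier ?G" "z \<in> carrier ?G"
    then obtain a b c where "a \<in> S" "b \<in> S" "c \<in> S" "x = R `` {a}" "y = R `` {b}" "z = R `` {c}"
      by (auto elim!: quotientE)
    then show "x \<otimes>\<^bsub>?G\<^esub> y \<otimes>\<^bsub>?G\<^esub> z = x \<otimes>\<^bsub>?G\<^esub> (y \<otimes>\<^bsub>?G\<^esub> z)"
      by (simp add: qm cl assoc del: Image_singleton_iff UN_iff)
  next
    fix x assume "x \<in> carrier ?G"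
    then obtain a where "a \<in> S" "x = R `` {a}" by (auto elim!: quotientE)
    then show "\<one>\<^bsub>?G\<^esub> \<otimes>\<^bsub>?G\<^esub> x = x"
      by (simp add: qm one del: Image_singleton_iff UN_iff)
  next
    fix x assume "x \<in> carrier ?G"
    then obtain a where a: "a \<in> S" "x = R `` {a}" by (auto elim!: quotientE)
    from inv[OF a(1)] obtain b where b: "b \<in> S" "(f b a, e) \<in> R" by blast
    show "\<exists>y\<in>carrier ?G. y \<otimes>\<^bsub>?G\<^esub> x = \<one>\<^bsub>?G\<^esub>"
    proof (rule bexI[of _ "R `` {b}"])
      show "R `` {b} \<otimes>\<^bsub>?G\<^esub> x = \<one>\<^bsub>?G\<^esub>"
        using a b by (simp add: qm equiv_class_eq[OF eq])
      show "R `` {b} \<in> carrier ?G" using b by (auto intro: quotientI)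
    qed
  qed
qed


lemma norm2_eq:
  assumes A: "A \<in> carrier_mat n n"
  shows "norm2 A = sqrt ((\<Sum>j<n. \<Sum>i<n. (cmod (A $$ (i, j)))\<^sup>2) / n)"
proof -
  have "(mat_adjoint A * A) $$ (j, j) = of_real (\<Sum>i<n. (cmod (A $$ (i, j)))\<^sup>2)" if "j < n" for j
  proof -
    have "(mat_adjoint A * A) $$ (j, j) = row (mat_adjoint A) j \<bullet> col A j"
      using A that by (auto simp: mat_adjoint_def)
    also have "row (mat_adjoint A) j = conjugate (col A j)"
      using A that by (simp add: mat_adjoint_def)
    also have "conjugate (col A j) \<bullet> col A j = (\<Sum>i<n. cnj (A $$ (i, j)) * A $$ (i, j))"
      using A that by (auto simp: scalar_prod_def lessThan_atLeast0 intro!: sum.cong)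
    also have "\<dots> = of_real (\<Sum>i<n. (cmod (A $$ (i, j)))\<^sup>2)"
      by (simp add: complex_norm_square mult.commute del: of_real_power)
    finally show ?thesis .
  qed
  moreover have "dim_row (mat_adjoint A * A) = n" using A by (simp add: mat_adjoint_def)
  ultimately show ?thesis
    unfolding norm2_def ntrace_def
    by (simp del: of_real_sum index_mult_mat(1) add: of_real_sum[symmetric] Re_divide_of_nat)
qed

lemma perm_matrix_carrier [simp]: "perm_matrix n \<sigma> \<in> carrier_mat n n"
  by (simp add: perm_matrix_def)

lemma norm2_perm_matrix_diff:
  assumes "\<sigma> permutes {..<n}" "\<tau> permutes {..<n}"
  shows "norm2 (perm_matrix n \<sigma> - perm_matrix n \<tau>) = sqrt (2 * card {j. j < n \<and> \<sigma> j \<noteq> \<tau> j} / n)"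
proof -
  have "(\<Sum>i<n. (cmod ((perm_matrix n \<sigma> - perm_matrix n \<tau>) $$ (i, j)))\<^sup>2) =
        (if \<sigma> j \<noteq> \<tau> j then 2 else 0)" if "j < n" for j
  proof -
    have m: "\<sigma> j < n" "\<tau> j < n" using assms that by (metis lessThan_iff permutes_in_image)+
    have "(\<Sum>i<n. (cmod ((perm_matrix n \<sigma> - perm_matrix n \<tau>) $$ (i, j)))\<^sup>2) =
          (\<Sum>i<n. if \<sigma> j \<noteq> \<tau> j then (if i = \<sigma> j then 1 else 0) + (if i = \<tau> j then 1 else 0) else 0)"
      using that by (intro sum.cong) (auto simp: perm_matrix_def)
    also have "\<dots> = (if \<sigma> j \<noteq> \<tau> j then 2 else 0)"
      using m by (auto simp: sum.distrib)
    finally show ?thesis .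
  qed
  then have "(\<Sum>j<n. \<Sum>i<n. (cmod ((perm_matrix n \<sigma> - perm_matrix n \<tau>) $$ (i, j)))\<^sup>2) =
     (\<Sum>j<n. if \<sigma> j \<noteq> \<tau> j then 2 else 0)" by simp
  also have "\<dots> = 2 * card {j. j < n \<and> \<sigma> j \<noteq> \<tau> j}"
    by (subst sum.inter_filter[symmetric]) (auto intro!: arg_cong[where f = card])
  finally show ?thesis
    by (subst norm2_eq[where n = n]) (auto intro!: minus_carrier_mat)
qed

lemma ntrace_perm_matrix:
  assumes "\<sigma> permutes {..<n}"
  shows "ntrace (perm_matrix n \<sigma>) = of_real (card {j. j < n \<and> \<sigma> j = j} / n)"
proof -
  have "(\<Sum>i<n. perm_matrix n \<sigma> $$ (i, i)) = (\<Sum>i<n. if \<sigma> i = i then 1 else 0)"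
    by (intro sum.cong) (auto simp: perm_matrix_def)
  also have "\<dots> = of_nat (card {j. j < n \<and> \<sigma> j = j})"
    by (subst sum.inter_filter[symmetric]) (auto intro!: arg_cong[where f = card])
  finally show ?thesis by (simp add: ntrace_def perm_matrix_def)
qed

lemma perm_matrix_mult:
  assumes "\<tau> permutes {..<n}"
  shows "perm_matrix n \<sigma> * perm_matrix n \<tau> = perm_matrix n (\<sigma> \<circ> \<tau>)"
proof (rule eq_matI)
  fix i j assume ij: "i < dim_row (perm_matrix n (\<sigma> \<circ> \<tau>))" "j < dim_col (perm_matrix n (\<sigma> \<circ> \<tau>))"
  then have m: "\<tau> j < n" using assms by (metis carrier_matD(2) lessThan_iff perm_matrix_carrier permutes_in_image)
  have "(perm_matrix n \<sigma> * perm_matrix n \<tau>) $$ (i, j) =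
     (\<Sum>k<n. (if i = \<sigma> k then 1 else 0) * (if k = \<tau> j then 1 else 0))"
    using ij by (auto simp: perm_matrix_def scalar_prod_def lessThan_atLeast0 intro!: sum.cong)
  also have "\<dots> = (\<Sum>k<n. if k = \<tau> j then (if i = \<sigma> (\<tau> j) then 1 else 0) else 0)"
    by (intro sum.cong) auto
  also have "\<dots> = perm_matrix n (\<sigma> \<circ> \<tau>) $$ (i, j)"
    using ij m by (simp add: perm_matrix_def)
  finally show "(perm_matrix n \<sigma> * perm_matrix n \<tau>) $$ (i, j) = perm_matrix n (\<sigma> \<circ> \<tau>) $$ (i, j)" .
qed (simp_all add: perm_matrix_def)

lemma perm_matrix_id: "perm_matrix n id = 1\<^sub>m n"
  by (auto simp: perm_matrix_def)

lemma perm_seqs_iff: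
  "p \<in> perm_seqs n \<longleftrightarrow> (\<exists>\<sigma>. (\<forall>k. \<sigma> k permutes {..<n k}) \<and> p = (\<lambda>k. perm_matrix (n k) (\<sigma> k)))"
proof
  assume "p \<in> perm_seqs n"
  then have "\<forall>k. \<exists>\<sigma>. \<sigma> permutes {..<n k} \<and> p k = perm_matrix (n k) \<sigma>"
    by (auto simp: perm_seqs_def perm_matrices_def)
  then show "\<exists>\<sigma>. (\<forall>k. \<sigma> k permutes {..<n k}) \<and> p = (\<lambda>k. perm_matrix (n k) (\<sigma> k))"
    by (metis ext)
qed (auto simp: perm_seqs_def perm_matrices_def)

lemma ultra_rel_iff:
  assumes "\<And>k. \<sigma> k permutes {..<n k}" "\<And>k. \<tau> k permutes {..<n k}"
  shows "((\<lambda>k. perm_matrix (n k) (\<sigma> k)), (\<lambda>k. perm_matrix (n k) (\<tau> k))) \<in> ultra_rel \<omega> n \<longleftrightarrow>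
         ((\<lambda>k. card {j. j < n k \<and> \<sigma> k j \<noteq> \<tau> k j} / n k) \<longlongrightarrow> 0) \<omega>" (is "_ \<longleftrightarrow> (?h \<longlongrightarrow> 0) \<omega>")
proof -
  have "((\<lambda>k. perm_matrix (n k) (\<sigma> k)), (\<lambda>k. perm_matrix (n k) (\<tau> k))) \<in> ultra_rel \<omega> n \<longleftrightarrow>
        ((\<lambda>k. sqrt (2 * ?h k)) \<longlongrightarrow> 0) \<omega>"
    using assms by (auto simp: ultra_rel_def norm2_perm_matrix_diff perm_seqs_def perm_matrices_def)
  also have "\<dots> \<longleftrightarrow> (?h \<longlongrightarrow> 0) \<omega>"
  proof
    assume "((\<lambda>k. sqrt (2 * ?h k)) \<longlongrightarrow> 0) \<omega>"
    from tendsto_power[OF this, of 2] have "((\<lambda>k. 2 * ?h k) \<longlongrightarrow> 0) \<omega>" by simp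
    from tendsto_mult_left[OF this, of "1/2"] show "(?h \<longlongrightarrow> 0) \<omega>" by simp
  next
    assume "(?h \<longlongrightarrow> 0) \<omega>"
    from tendsto_real_sqrt[OF tendsto_mult_left[OF this, of 2]]
    show "((\<lambda>k. sqrt (2 * ?h k)) \<longlongrightarrow> 0) \<omega>" by simp
  qed
  finally show ?thesis .
qed

lemma of_nat_divide_le_add:
  fixes a b c m :: nat
  assumes "a \<le> b + c"
  shows "real a / m \<le> real b / m + real c / m"
proof -
  have "real a \<le> real b + real c" using assms by linarith
  from divide_right_mono[OF this, of "real m"] show ?thesis by (simp add: add_divide_distrib)
qed

lemma tendsto_0_le:
  fixes f g :: "nat \<Rightarrow> real"
  assumes "\<And>k. 0 \<le> f k" "\<And>k. f k \<le> g k" "(g \<longlongrightarrow> 0 + 0) F"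
  shows "(f \<longlongrightarrow> 0) F"
  by (rule tendsto_sandwich[of "\<lambda>_. 0" f F g]) (use assms in simp_all)

lemma equiv_ultra_rel: "equiv (perm_seqs n) (ultra_rel \<omega> n)"
proof (rule equivI)
  show "ultra_rel \<omega> n \<subseteq> perm_seqs n \<times> perm_seqs n" by (auto simp: ultra_rel_def)
  show "refl_on (perm_seqs n) (ultra_rel \<omega> n)"
    by (rule refl_onI) (auto simp: perm_seqs_iff ultra_rel_iff)
  show "sym (ultra_rel \<omega> n)"
  proof (rule symI)
    fix p q assume pq: "(p, q) \<in> ultra_rel \<omega> n"
    then have "p \<in> perm_seqs n" "q \<in> perm_seqs n" by (auto simp: ultra_rel_def)
    with pq show "(q, p) \<in> ultra_rel \<omega> n" by (auto simp: perm_seqs_iff ultra_rel_iff eq_commute)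
  qed
  show "trans (ultra_rel \<omega> n)"
  proof (rule transI)
    fix p q r assume pqr: "(p, q) \<in> ultra_rel \<omega> n" "(q, r) \<in> ultra_rel \<omega> n"
    then have "p \<in> perm_seqs n" "q \<in> perm_seqs n" "r \<in> perm_seqs n" by (auto simp: ultra_rel_def)
    then obtain \<sigma> \<tau> \<rho> where p: "\<And>k. \<sigma> k permutes {..<n k}" "p = (\<lambda>k. perm_matrix (n k) (\<sigma> k))"
      and q: "\<And>k. \<tau> k permutes {..<n k}" "q = (\<lambda>k. perm_matrix (n k) (\<tau> k))"
      and r: "\<And>k. \<rho> k permutes {..<n k}" "r = (\<lambda>k. perm_matrix (n k) (\<rho> k))"
      by (auto simp: perm_seqs_iff)
    have le: "card {j. j < n k \<and> \<sigma> k j \<noteq> \<rho> k j} / n k \<le>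
      card {j. j < n k \<and> \<sigma> k j \<noteq> \<tau> k j} / n k + card {j. j < n k \<and> \<tau> k j \<noteq> \<rho> k j} / n k" for k
    proof -
      have "card {j. j < n k \<and> \<sigma> k j \<noteq> \<rho> k j} \<le>
         card ({j. j < n k \<and> \<sigma> k j \<noteq> \<tau> k j} \<union> {j. j < n k \<and> \<tau> k j \<noteq> \<rho> k j})"
        by (rule card_mono) auto
      also have "\<dots> \<le> card {j. j < n k \<and> \<sigma> k j \<noteq> \<tau> k j} + card {j. j < n k \<and> \<tau> k j \<noteq> \<rho> k j}"
        by (rule card_Un_le)
      finally show ?thesis by (rule of_nat_divide_le_add)
    qed
    have "((\<lambda>k. card {j. j < n k \<and> \<sigma> k j \<noteq> \<tau> k j} / n k + card {j. j < n k \<and> \<tau> k j \<noteq> \<rho> k j} / n k) \<longlongrightarrow> 0 + 0) \<omega>"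
      using pqr p q r by (intro tendsto_add) (auto simp: ultra_rel_iff)
    from tendsto_0_le[OF _ le this]
    have "((\<lambda>k. card {j. j < n k \<and> \<sigma> k j \<noteq> \<rho> k j} / n k) \<longlongrightarrow> 0) \<omega>" by simp
    with p q r show "(p, r) \<in> ultra_rel \<omega> n" by (simp add: ultra_rel_iff)
  qed
qed

lemma ultra_rel_mult:
  assumes "(p, p') \<in> ultra_rel \<omega> n" "(q, q') \<in> ultra_rel \<omega> n"
  shows "((\<lambda>k. p k * q k), (\<lambda>k. p' k * q' k)) \<in> ultra_rel \<omega> n"
proof -
  from assms have "p \<in> perm_seqs n" "p' \<in> perm_seqs n" "q \<in> perm_seqs n" "q' \<in> perm_seqs n"
    by (auto simp: ultra_rel_def)
  then obtain \<sigma> \<sigma>' \<tau> \<tau>' where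
    p: "\<And>k. \<sigma> k permutes {..<n k}" "p = (\<lambda>k. perm_matrix (n k) (\<sigma> k))" and
    p': "\<And>k. \<sigma>' k permutes {..<n k}" "p' = (\<lambda>k. perm_matrix (n k) (\<sigma>' k))" and
    q: "\<And>k. \<tau> k permutes {..<n k}" "q = (\<lambda>k. perm_matrix (n k) (\<tau> k))" and
    q': "\<And>k. \<tau>' k permutes {..<n k}" "q' = (\<lambda>k. perm_matrix (n k) (\<tau>' k))"
    by (auto simp: perm_seqs_iff)
  let ?h = "\<lambda>k. card {j. j < n k \<and> \<sigma> k j \<noteq> \<sigma>' k j} / n k + card {j. j < n k \<and> \<tau> k j \<noteq> \<tau>' k j} / n k"
  have le: "card {j. j < n k \<and> (\<sigma> k \<circ> \<tau> k) j \<noteq> (\<sigma>' k \<circ> \<tau>' k) j} / n k \<le> ?h k" for k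
  proof -
    have lt: "\<tau> k j < n k \<longleftrightarrow> j < n k" for j using permutes_in_image[OF q(1)[of k], of j] by simp
    have "card {j. j < n k \<and> (\<sigma> k \<circ> \<tau> k) j \<noteq> (\<sigma>' k \<circ> \<tau>' k) j} \<le>
       card ({j. j < n k \<and> \<sigma> k (\<tau> k j) \<noteq> \<sigma>' k (\<tau> k j)} \<union> {j. j < n k \<and> \<tau> k j \<noteq> \<tau>' k j})"
      by (rule card_mono) auto
    also have "\<dots> \<le> card {j. j < n k \<and> \<sigma> k (\<tau> k j) \<noteq> \<sigma>' k (\<tau> k j)} + card {j. j < n k \<and> \<tau> k j \<noteq> \<tau>' k j}"
      by (rule card_Un_le)
    also have "card {j. j < n k \<and> \<sigma> k (\<tau> k j) \<noteq> \<sigma>' k (\<tau> k j)} + card {j. j < n k \<and> \<tau> k j \<noteq> \<tau>' k j} \<le>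
      card {j. j < n k \<and> \<sigma> k j \<noteq> \<sigma>' k j} + card {j. j < n k \<and> \<tau> k j \<noteq> \<tau>' k j}"
      unfolding add_le_cancel_right
      by (rule card_inj_on_le[where f = "\<tau> k"]) (auto simp: lt intro: inj_on_subset[OF permutes_inj[OF q(1)]])
    finally show ?thesis by (rule of_nat_divide_le_add)
  qed
  have "(?h \<longlongrightarrow> 0 + 0) \<omega>"
    using assms p p' q q' by (intro tendsto_add) (auto simp: ultra_rel_iff)
  from tendsto_0_le[OF _ le this]
  have "((\<lambda>k. card {j. j < n k \<and> (\<sigma> k \<circ> \<tau> k) j \<noteq> (\<sigma>' k \<circ> \<tau>' k) j} / n k) \<longlongrightarrow> 0) \<omega>" by simp
  moreover have "\<And>k. (\<sigma> k \<circ> \<tau> k) permutes {..<n k}" "\<And>k. (\<sigma>' k \<circ> \<tau>' k) permutes {..<n k}"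
    using p p' q q' by (auto intro: permutes_compose)
  ultimately show ?thesis
    using p p' q q' ultra_rel_iff[of "\<lambda>k. \<sigma> k \<circ> \<tau> k" n "\<lambda>k. \<sigma>' k \<circ> \<tau>' k" \<omega>]
    by (simp add: perm_matrix_mult)
qed

lemma perm_seqs_mult: "p \<in> perm_seqs n \<Longrightarrow> q \<in> perm_seqs n \<Longrightarrow> (\<lambda>k. p k * q k) \<in> perm_seqs n"
  by (auto simp: perm_seqs_def perm_matrices_def perm_matrix_mult image_iff)
     (smt (verit, best) perm_matrix_mult permutes_compose)

lemma group_perm_ultraproduct: "group (perm_ultraproduct \<omega> n)"
  unfolding perm_ultraproduct_def
proof (rule quotient_group[OF equiv_ultra_rel])
  have d: "p k \<in> carrier_mat (n k) (n k)" if "p \<in> perm_seqs n" for p k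
    using that by (auto simp: perm_seqs_iff)
  show "(\<lambda>k. 1\<^sub>m (n k)) \<in> perm_seqs n"
    unfolding perm_seqs_iff by (rule exI[of _ "\<lambda>k. id"]) (auto simp: perm_matrix_id permutes_id)
  show "(\<lambda>k. 1\<^sub>m (n k) * a k) = a" if "a \<in> perm_seqs n" for a
    using d[OF that] by (intro ext left_mult_one_mat)
  show "(\<lambda>k. a k * b k * c k) = (\<lambda>k. a k * (b k * c k))"
    if "a \<in> perm_seqs n" "b \<in> perm_seqs n" "c \<in> perm_seqs n" for a b c
    by (rule ext) (rule assoc_mult_mat[OF d[OF that(1)] d[OF that(2)] d[OF that(3)]])
  show "\<exists>b\<in>perm_seqs n. ((\<lambda>k. b k * a k), (\<lambda>k. 1\<^sub>m (n k))) \<in> ultra_rel \<omega> n" if a: "a \<in> perm_seqs n" for a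
  proof -
    obtain \<sigma> where s: "\<And>k. \<sigma> k permutes {..<n k}" "a = (\<lambda>k. perm_matrix (n k) (\<sigma> k))"
      using a by (auto simp: perm_seqs_iff)
    let ?b = "\<lambda>k. perm_matrix (n k) (inv_into UNIV (\<sigma> k))"
    have "?b \<in> perm_seqs n" using s by (auto simp: perm_seqs_def perm_matrices_def intro: permutes_inv)
    moreover have "(\<lambda>k. ?b k * a k) = (\<lambda>k. 1\<^sub>m (n k))"
      by (simp add: s perm_matrix_mult permutes_inv_o(2)[OF s(1)] flip: perm_matrix_id)
    moreover have "((\<lambda>k. 1\<^sub>m (n k)), (\<lambda>k. 1\<^sub>m (n k))) \<in> ultra_rel \<omega> n"
      using equiv_ultra_rel \<open>(\<lambda>k. 1\<^sub>m (n k)) \<in> perm_seqs n\<close> by (metis equiv_def refl_onD)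
    ultimately show ?thesis by (intro bexI[of _ ?b]) simp_all
  qed
qed (fact ultra_rel_mult perm_seqs_mult)+

lemma ultra_limit_exists:
  fixes f :: "nat \<Rightarrow> real"
  assumes "free_ultrafilter \<omega>" "\<And>k. 0 \<le> f k" "\<And>k. f k \<le> 1"
  shows "\<exists>l. (f \<longlongrightarrow> l) \<omega>"
proof -
  define S where "S = {x. eventually (\<lambda>k. x \<le> f k) \<omega>}"
  have S0: "0 \<in> S" using assms by (simp add: S_def)
  have S1: "x \<le> 1" if "x \<in> S" for x
  proof (rule ccontr)
    assume "\<not> x \<le> 1"
    then have "\<And>k. \<not> x \<le> f k" using assms(3) by (meson order_trans)
    with that assms(1) show False by (simp add: S_def free_ultrafilter_def)
  qed
  have bdd: "bdd_above S" by (rule bdd_aboveI) (rule S1)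
  have "(f \<longlongrightarrow> Sup S) \<omega>"
  proof (rule order_tendstoI)
    fix a assume "a < Sup S"
    then obtain x where "x \<in> S" "a < x" using less_cSup_iff[OF _ bdd] S0 by blast
    then show "eventually (\<lambda>k. a < f k) \<omega>" by (auto simp: S_def elim: eventually_mono)
  next
    fix a assume a: "Sup S < a"
    then have "a \<notin> S" using cSup_upper[OF _ bdd, of a] by auto
    then have "eventually (\<lambda>k. \<not> a \<le> f k) \<omega>" using assms(1) unfolding S_def free_ultrafilter_def by blast
    then show "eventually (\<lambda>k. f k < a) \<omega>" by (simp add: not_le)
  qed
  then show ?thesis by blast
qed

lemma ultra_trace_eq:
  assumes \<omega>: "free_ultrafilter \<omega>" and n: "\<And>k. 0 < n k"
    and X: "X \<in> carrier (perm_ultraproduct \<omega> n)" and p: "p \<in> X"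
  shows "((\<lambda>k. ntrace (p k)) \<longlongrightarrow> ultra_trace \<omega> X) \<omega>"
proof -
  have bot: "\<omega> \<noteq> bot" using \<omega> by (simp add: free_ultrafilter_def)
  from X have X': "X \<in> perm_seqs n // ultra_rel \<omega> n" by (simp add: perm_ultraproduct_def)
  have pS: "p \<in> perm_seqs n" using in_quotient_imp_subset[OF equiv_ultra_rel X'] p by blast
  then obtain \<sigma> where s: "\<And>k. \<sigma> k permutes {..<n k}" "p = (\<lambda>k. perm_matrix (n k) (\<sigma> k))"
    by (auto simp: perm_seqs_iff)
  have "card {j. j < n k \<and> \<sigma> k j = j} / n k \<le> 1" for k
  proof -
    have "card {j. j < n k \<and> \<sigma> k j = j} \<le> card {..<n k}" by (rule card_mono) auto
    with n[of k] show ?thesis by simp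
  qed
  then obtain l where "((\<lambda>k. card {j. j < n k \<and> \<sigma> k j = j} / n k) \<longlongrightarrow> l) \<omega>"
    using ultra_limit_exists[OF \<omega>, of "\<lambda>k. card {j. j < n k \<and> \<sigma> k j = j} / n k"] by auto
  from tendsto_of_real[OF this, where 'a = complex] obtain z where z: "((\<lambda>k. ntrace (p k)) \<longlongrightarrow> z) \<omega>"
    unfolding s(2) ntrace_perm_matrix[OF s(1)] by blast
  have all: "((\<lambda>k. ntrace (q k)) \<longlongrightarrow> z) \<omega>" if "q \<in> X" for q
  proof -
    have pq: "(p, q) \<in> ultra_rel \<omega> n" using quotient_eq_iff[OF equiv_ultra_rel X' X' p that] by simp
    then have "q \<in> perm_seqs n" by (auto simp: ultra_rel_def)
    then obtain \<tau> where t: "\<And>k. \<tau> k permutes {..<n k}" "q = (\<lambda>k. perm_matrix (n k) (\<tau> k))"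
      by (auto simp: perm_seqs_iff)
    let ?h = "\<lambda>k. card {j. j < n k \<and> \<sigma> k j \<noteq> \<tau> k j} / n k"
    have h: "(?h \<longlongrightarrow> 0) \<omega>" using pq s t by (simp add: ultra_rel_iff)
    have "cmod (ntrace (q k) - ntrace (p k)) \<le> ?h k" for k
    proof -
      have 1: "card {j. j < n k \<and> \<sigma> k j = j} \<le> card ({j. j < n k \<and> \<tau> k j = j} \<union> {j. j < n k \<and> \<sigma> k j \<noteq> \<tau> k j})"
        by (rule card_mono) auto
      have 2: "card {j. j < n k \<and> \<tau> k j = j} \<le> card ({j. j < n k \<and> \<sigma> k j = j} \<union> {j. j < n k \<and> \<sigma> k j \<noteq> \<tau> k j})"
        by (rule card_mono) auto
      have "\<bar>real (card {j. j < n k \<and> \<tau> k j = j}) - card {j. j < n k \<and> \<sigma> k j = j}\<bar> \<le> card {j. j < n k \<and> \<sigma> k j \<noteq> \<tau> k j}"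
        using order.trans[OF 1 card_Un_le] order.trans[OF 2 card_Un_le] by linarith
      then have "\<bar>(real (card {j. j < n k \<and> \<tau> k j = j}) - card {j. j < n k \<and> \<sigma> k j = j}) / n k\<bar> \<le> ?h k"
        by (simp add: divide_right_mono)
      also have "(real (card {j. j < n k \<and> \<tau> k j = j}) - card {j. j < n k \<and> \<sigma> k j = j}) / n k =
         card {j. j < n k \<and> \<tau> k j = j} / n k - card {j. j < n k \<and> \<sigma> k j = j} / n k"
        by (simp add: diff_divide_distrib)
      finally show ?thesis
        unfolding s(2) t(2) ntrace_perm_matrix[OF s(1)] ntrace_perm_matrix[OF t(1)]
        by (simp only: of_real_diff[symmetric] norm_of_real)
    qed
    then have "((\<lambda>k. ntrace (q k) - ntrace (p k)) \<longlongrightarrow> 0) \<omega>"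
      by (intro tendsto_norm_zero_cancel[OF tendsto_0_le[of _ ?h]]) (use h in auto)
    from tendsto_add[OF this z] show ?thesis by simp
  qed
  have "ultra_trace \<omega> X = z"
    unfolding ultra_trace_def using all p by (intro the_equality) (auto intro: tendsto_unique[OF bot])
  with z show ?thesis by simp
qed


context
  fixes G1 :: "('a, 'm) monoid_scheme" and G2 :: "('b, 'n) monoid_scheme"
    and H :: "('c, 'l) monoid_scheme" and f1 :: "'c \<Rightarrow> 'a" and f2 :: "'c \<Rightarrow> 'b"
  assumes G: "group G1" "group G2" and f: "f1 \<in> hom H G1" "f2 \<in> hom H G2"
begin

interpretation G1: group G1 by (fact G)
interpretation G2: group G2 by (fact G)

lemma amalg_eq_words:
  "amalg_eq G1 G2 H f1 f2 v w \<Longrightarrow> v \<in> amalg_words G1 G2 \<and> w \<in> amalg_words G1 G2"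
  by (induction rule: amalg_eq.induct) (use f in \<open>auto simp: amalg_words_def hom_def\<close>)

lemma equiv_amalg_rel: "equiv (amalg_words G1 G2) (amalg_rel G1 G2 H f1 f2)"
  by (rule equivI)
     (auto simp: amalg_rel_def intro!: refl_onI symI transI dest: amalg_eq_words
           intro: amalg_eq.refl amalg_eq.sym amalg_eq.trans)

lemma amalg_inv:
  assumes "w \<in> amalg_words G1 G2"
  shows "\<exists>v\<in>amalg_words G1 G2. amalg_eq G1 G2 H f1 f2 (v @ w) []"
  using assms
proof (induction w)
  case Nil
  have "[] \<in> amalg_words G1 G2" by (simp add: amalg_words_def)
  then show ?case by (auto intro!: bexI[of _ "[]"] amalg_eq.refl)
next
  case (Cons x w)
  then have x: "x \<in> carrier G1 <+> carrier G2" and w: "w \<in> amalg_words G1 G2" by (auto simp: amalg_words_def)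
  from Cons.IH[OF w] obtain v where v: "v \<in> amalg_words G1 G2" "amalg_eq G1 G2 H f1 f2 (v @ w) []" by blast
  obtain y where y: "y \<in> carrier G1 <+> carrier G2" "amalg_eq G1 G2 H f1 f2 [y, x] []"
    using x
  proof (elim PlusE)
    fix a assume "a \<in> carrier G1" "x = Inl a"
    then show ?thesis using amalg_eq.mult1[of "inv\<^bsub>G1\<^esub> a" G1 a G2 H f1 f2] that[of "Inl (inv\<^bsub>G1\<^esub> a)"]
      by (auto intro: amalg_eq.trans amalg_eq.one1)
  next
    fix a assume "a \<in> carrier G2" "x = Inr a"
    then show ?thesis using amalg_eq.mult2[of "inv\<^bsub>G2\<^esub> a" G2 a G1 H f1 f2] that[of "Inr (inv\<^bsub>G2\<^esub> a)"]
      by (auto intro: amalg_eq.trans amalg_eq.one2)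
  qed
  have "amalg_eq G1 G2 H f1 f2 (v @ ([y, x] @ w)) (v @ ([] @ w))"
    using v w y by (intro amalg_eq.cong amalg_eq.refl)
  then have "amalg_eq G1 G2 H f1 f2 ((v @ [y]) @ x # w) []" using v(2) by (auto intro: amalg_eq.trans)
  moreover have "v @ [y] \<in> amalg_words G1 G2" using v y by (auto simp: amalg_words_def)
  ultimately show ?case by blast
qed

lemma group_amalgamated_product: "group (amalgamated_product G1 G2 H f1 f2)"
  unfolding amalgamated_product_def
proof (rule quotient_group[OF equiv_amalg_rel])
  show "\<exists>b\<in>amalg_words G1 G2. (b @ a, []) \<in> amalg_rel G1 G2 H f1 f2" if "a \<in> amalg_words G1 G2" for a
    using amalg_inv[OF that] by (simp add: amalg_rel_def)
qed (auto simp: amalg_rel_def amalg_words_def intro: amalg_eq.cong)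

definition amalg_in1 :: "'a \<Rightarrow> ('a + 'b) list set" where
  "amalg_in1 x = amalg_rel G1 G2 H f1 f2 `` {[Inl x]}"

definition amalg_in2 :: "'b \<Rightarrow> ('a + 'b) list set" where
  "amalg_in2 y = amalg_rel G1 G2 H f1 f2 `` {[Inr y]}"

lemma amalg_mult:
  assumes "u \<in> amalg_words G1 G2" "v \<in> amalg_words G1 G2"
  shows "(amalg_rel G1 G2 H f1 f2 `` {u}) \<otimes>\<^bsub>amalgamated_product G1 G2 H f1 f2\<^esub> (amalg_rel G1 G2 H f1 f2 `` {v}) =
         amalg_rel G1 G2 H f1 f2 `` {u @ v}"
  unfolding amalgamated_product_def monoid.simps
  by (rule quotient_mult[OF equiv_amalg_rel]) (use assms in \<open>auto simp: amalg_rel_def intro: amalg_eq.cong\<close>)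

lemma amalg_class_eq:
  "amalg_eq G1 G2 H f1 f2 u v \<Longrightarrow> amalg_rel G1 G2 H f1 f2 `` {u} = amalg_rel G1 G2 H f1 f2 `` {v}"
  by (rule equiv_class_eq[OF equiv_amalg_rel]) (simp add: amalg_rel_def)

lemma amalg_in1_hom: "amalg_in1 \<in> hom G1 (amalgamated_product G1 G2 H f1 f2)"
proof (rule homI)
  fix x assume "x \<in> carrier G1"
  then show "amalg_in1 x \<in> carrier (amalgamated_product G1 G2 H f1 f2)"
    by (auto simp: amalgamated_product_def amalg_in1_def amalg_words_def intro!: quotientI)
next
  fix x y assume "x \<in> carrier G1" "y \<in> carrier G1"
  then show "amalg_in1 (x \<otimes>\<^bsub>G1\<^esub> y) = amalg_in1 x \<otimes>\<^bsub>amalgamated_product G1 G2 H f1 f2\<^esub> amalg_in1 y"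
    unfolding amalg_in1_def
    by (subst amalg_mult) (auto simp: amalg_words_def intro!: amalg_class_eq[symmetric] amalg_eq.mult1)
qed

lemma amalg_in2_hom: "amalg_in2 \<in> hom G2 (amalgamated_product G1 G2 H f1 f2)"
proof (rule homI)
  fix x assume "x \<in> carrier G2"
  then show "amalg_in2 x \<in> carrier (amalgamated_product G1 G2 H f1 f2)"
    by (auto simp: amalgamated_product_def amalg_in2_def amalg_words_def intro!: quotientI)
next
  fix x y assume "x \<in> carrier G2" "y \<in> carrier G2"
  then show "amalg_in2 (x \<otimes>\<^bsub>G2\<^esub> y) = amalg_in2 x \<otimes>\<^bsub>amalgamated_product G1 G2 H f1 f2\<^esub> amalg_in2 y"
    unfolding amalg_in2_def
    by (subst amalg_mult) (auto simp: amalg_words_def intro!: amalg_class_eq[symmetric] amalg_eq.mult2)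
qed

lemma amalg_in_eq: "h \<in> carrier H \<Longrightarrow> amalg_in1 (f1 h) = amalg_in2 (f2 h)"
  unfolding amalg_in1_def amalg_in2_def by (intro amalg_class_eq amalg_eq.amalg)

lemma amalgamated_product_universal:
  fixes K :: "('k, 'r) monoid_scheme"
  assumes K: "group K" and g1: "g1 \<in> hom G1 K" and g2: "g2 \<in> hom G2 K"
    and eq: "\<And>h. h \<in> carrier H \<Longrightarrow> g1 (f1 h) = g2 (f2 h)"
  shows "\<exists>\<phi> \<in> hom (amalgamated_product G1 G2 H f1 f2) K.
           (\<forall>x\<in>carrier G1. \<phi> (amalg_in1 x) = g1 x) \<and> (\<forall>y\<in>carrier G2. \<phi> (amalg_in2 y) = g2 y) \<and>
           (\<forall>\<psi> \<in> hom (amalgamated_product G1 G2 H f1 f2) K.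
              (\<forall>x\<in>carrier G1. \<psi> (amalg_in1 x) = g1 x) \<longrightarrow> (\<forall>y\<in>carrier G2. \<psi> (amalg_in2 y) = g2 y) \<longrightarrow>
              (\<forall>X\<in>carrier (amalgamated_product G1 G2 H f1 f2). \<psi> X = \<phi> X))"
proof -
  interpret K: group K by (fact K)
  let ?P = "amalgamated_product G1 G2 H f1 f2" and ?R = "amalg_rel G1 G2 H f1 f2"
  define ev where "ev = (\<lambda>w. foldr (\<lambda>x k. case_sum g1 g2 x \<otimes>\<^bsub>K\<^esub> k) w \<one>\<^bsub>K\<^esub>)"
  have l: "case_sum g1 g2 x \<in> carrier K" if "x \<in> carrier G1 <+> carrier G2" for x
    using that g1 g2 by (auto simp: hom_def)
  have ev_cl: "ev w \<in> carrier K" if "w \<in> amalg_words G1 G2" for w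
    using that by (induction w) (auto simp: ev_def amalg_words_def intro!: l)
  have ev_app: "ev (v @ w) = ev v \<otimes>\<^bsub>K\<^esub> ev w" if "v \<in> amalg_words G1 G2" "w \<in> amalg_words G1 G2" for v w
    using that(1)
  proof (induction v)
    case Nil then show ?case using ev_cl[OF that(2)] by (simp add: ev_def)
  next
    case (Cons x v)
    then have x: "x \<in> carrier G1 <+> carrier G2" "v \<in> amalg_words G1 G2" by (auto simp: amalg_words_def)
    have "ev ((x # v) @ w) = case_sum g1 g2 x \<otimes>\<^bsub>K\<^esub> ev (v @ w)" by (simp add: ev_def)
    also have "\<dots> = case_sum g1 g2 x \<otimes>\<^bsub>K\<^esub> ev v \<otimes>\<^bsub>K\<^esub> ev w"
      using Cons.IH[OF x(2)] l[OF x(1)] ev_cl[OF x(2)] ev_cl[OF that(2)] by (simp add: K.m_assoc)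
    finally show ?case by (simp add: ev_def)
  qed
  have ev_eq: "ev v = ev w" if "amalg_eq G1 G2 H f1 f2 v w" for v w
    using that
  proof (induction rule: amalg_eq.induct)
    case (cong u u' v v')
    then show ?case using amalg_eq_words[OF cong(1)] amalg_eq_words[OF cong(2)] by (simp add: ev_app)
  next
    case one1
    then show ?case using hom_one[OF g1 G(1) K] by (simp add: ev_def)
  next
    case one2
    then show ?case using hom_one[OF g2 G(2) K] by (simp add: ev_def)
  next
    case (mult1 x y)
    then show ?case using hom_in_carrier[OF g1 mult1(1)] hom_in_carrier[OF g1 mult1(2)] hom_mult[OF g1 mult1] mult1 by (auto simp: ev_def K.m_assoc)
  next
    case (mult2 x y)
    then show ?case using hom_in_carrier[OF g2 mult2(1)] hom_in_carrier[OF g2 mult2(2)] hom_mult[OF g2 mult2] mult2 by (auto simp: ev_def K.m_assoc)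
  next
    case (amalg h)
    then show ?case using eq by (simp add: ev_def)
  qed auto
  define \<phi> where "\<phi> = (\<lambda>X. ev (SOME w. w \<in> X))"
  have \<phi>: "\<phi> (?R `` {w}) = ev w" if "w \<in> amalg_words G1 G2" for w
  proof -
    have "w \<in> ?R `` {w}" using that by (auto simp: amalg_rel_def intro: amalg_eq.refl)
    then have "(SOME v. v \<in> ?R `` {w}) \<in> ?R `` {w}" by (rule someI)
    then show ?thesis using ev_eq by (auto simp: \<phi>_def amalg_rel_def)
  qed
  have car: "\<exists>w\<in>amalg_words G1 G2. X = ?R `` {w}" if "X \<in> carrier ?P" for X
    using that by (auto simp: amalgamated_product_def elim!: quotientE)
  have hom: "\<phi> \<in> hom ?P K"
  proof (rule homI)
    fix X assume "X \<in> carrier ?P"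
    then show "\<phi> X \<in> carrier K" using car[of X] \<phi> ev_cl by auto
  next
    fix X Y assume "X \<in> carrier ?P" "Y \<in> carrier ?P"
    then obtain u v where "u \<in> amalg_words G1 G2" "v \<in> amalg_words G1 G2" "X = ?R `` {u}" "Y = ?R `` {v}"
      using car by blast
    moreover from this have "u @ v \<in> amalg_words G1 G2" by (simp add: amalg_words_def)
    ultimately show "\<phi> (X \<otimes>\<^bsub>?P\<^esub> Y) = \<phi> X \<otimes>\<^bsub>K\<^esub> \<phi> Y" by (simp add: amalg_mult \<phi> ev_app)
  qed
  show ?thesis
  proof (intro bexI[OF _ hom] conjI ballI impI)
    fix x assume "x \<in> carrier G1"
    then have "[Inl x] \<in> amalg_words G1 G2" "g1 x \<in> carrier K"
      using hom_in_carrier[OF g1] by (auto simp: amalg_words_def)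
    then show "\<phi> (amalg_in1 x) = g1 x"
      unfolding amalg_in1_def by (subst \<phi>) (auto simp: ev_def)
  next
    fix x assume "x \<in> carrier G2"
    then have "[Inr x] \<in> amalg_words G1 G2" "g2 x \<in> carrier K"
      using hom_in_carrier[OF g2] by (auto simp: amalg_words_def)
    then show "\<phi> (amalg_in2 x) = g2 x"
      unfolding amalg_in2_def by (subst \<phi>) (auto simp: ev_def)
  next
    fix \<psi> X
    assume \<psi>: "\<psi> \<in> hom ?P K" "\<forall>x\<in>carrier G1. \<psi> (amalg_in1 x) = g1 x" "\<forall>y\<in>carrier G2. \<psi> (amalg_in2 y) = g2 y"
      and X: "X \<in> carrier ?P"
    have "\<psi> (?R `` {w}) = ev w" if "w \<in> amalg_words G1 G2" for w
      using that
    proof (induction w)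
      case Nil
      have "?R `` {[]} = \<one>\<^bsub>?P\<^esub>" by (simp add: amalgamated_product_def)
      then show ?case using hom_one[OF \<psi>(1) group_amalgamated_product K] by (simp add: ev_def)
    next
      case (Cons x w)
      then have x: "x \<in> carrier G1 <+> carrier G2" and w: "w \<in> amalg_words G1 G2" "[x] \<in> amalg_words G1 G2"
        by (auto simp: amalg_words_def)
      have c: "?R `` {v} \<in> carrier ?P" if "v \<in> amalg_words G1 G2" for v
        using that by (auto simp: amalgamated_product_def intro: quotientI)
      have "\<psi> (?R `` {[x]}) = case_sum g1 g2 x"
        using x \<psi> by (auto simp: amalg_in1_def amalg_in2_def)
      moreover have "?R `` {x # w} = ?R `` {[x]} \<otimes>\<^bsub>?P\<^esub> ?R `` {w}" using amalg_mult[OF w(2,1)] by simp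
      ultimately show ?case using hom_mult[OF \<psi>(1) c[OF w(2)] c[OF w(1)]] Cons.IH[OF w(1)] by (simp add: ev_def)
    qed
    then show "\<psi> X = \<phi> X" using car[OF X] \<phi> by auto
  qed
qed

end

end

theory Submission
  imports Defs
begin

text \<open>
  Bring sofic approximations of \<open>G1\<close> and \<open>G2\<close> to finite sets of the same cardinality. Both carry
  approximately free actions of \<open>H\<close>, and amenability makes these two approximately conjugate: a
  Folner set \<open>T\<close> is copied at once around a random point of either set, where most of it is still
  unoccupied, and repeating this with smaller and smaller Folner sets exhausts almost everything. The
  result is a bijection matching the two actions of \<open>H\<close> together with a decomposition into tiles that is
  almost \<open>H\<close>-invariant, while elements outside \<open>H\<close> leave the tile of almost every point.

  Now attach to the tiles finitely many involutions of a finite set \<open>Y\<close> in which no short reduced word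
  has a fixed point, and twist the action of \<open>G2\<close> on the product with \<open>Y\<close> by the involution of the
  current tile. The actions still agree on \<open>H\<close>, and a reduced word of the amalgamated product moves
  the coordinate in \<open>Y\<close> by a nonempty reduced word in the involutions, so it fixes almost nothing.
\<close>

subsection \<open>Hall's theorem for infinite families of finite sets\<close>

text \<open>Two obstacles shape the argument. A tile can be placed with little loss only if the part
  already occupied is nearly invariant under its Folner set, so every Folner set has to be fixed
  before those whose tiles are laid ahead of it: the sets are chosen in the order opposite to their
  use. Moreover, matching the two actions of \<open>H\<close> controls nothing that happens outside
  \<open>H\<close>: a word with letters from both groups could return to its starting point by
  accident. Therefore the coordinate in \<open>Y\<close> records the tiles that the point visits. A
  letter from \<open>G2\<close> contributes the involution of the tile that it leaves and of the
  tile that it enters; these differ, and the letter from \<open>G1\<close> in between moves to a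
  different tile again, so nothing cancels. An element of \<open>H\<close> mostly stays inside the
  tile, where the two involutions do cancel; this reconciles the twist with the amalgamation.
  Finally, amenability is given by a mean, and Folner sets come from it through Hall's theorem: a
  group without them would double itself by finitely many translations.\<close>

lemma rado_step:
  assumes fin: "\<And>i. i \<in> I \<Longrightarrow> finite (R `` {i})"
    and hall: "\<And>F. finite F \<Longrightarrow> F \<subseteq> I \<Longrightarrow> card F \<le> card (R `` F)"
    and i: "i \<in> I" and y: "(i, y1) \<in> R" "(i, y2) \<in> R" "y1 \<noteq> y2"
  shows "\<exists>y\<in>{y1, y2}. \<forall>F. finite F \<longrightarrow> F \<subseteq> I \<longrightarrow> card F \<le> card ((R - {(i, y)}) `` F)"
proof (rule ccontr)
  assume "\<not> ?thesis"
  then obtain F1 F2 where F: "finite F1" "F1 \<subseteq> I" "card ((R - {(i, y1)}) `` F1) < card F1"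
      "finite F2" "F2 \<subseteq> I" "card ((R - {(i, y2)}) `` F2) < card F2"
    by (auto simp: not_le)
  have i12: "i \<in> F1" "i \<in> F2"
  proof -
    have "(R - {(i, y)}) `` F = R `` F" if "i \<notin> F" for y F using that by auto
    then show "i \<in> F1" "i \<in> F2" using F hall by (metis not_le)+
  qed
  define D1 where "D1 = (R - {(i, y1)}) `` F1"
  define D2 where "D2 = (R - {(i, y2)}) `` F2"
  have finR: "finite (R `` F)" if "finite F" "F \<subseteq> I" for F
  proof -
    have "R `` F = (\<Union>j\<in>F. R `` {j})" by auto
    then show ?thesis using that fin by (auto simp: subset_iff)
  qed
  have finD: "finite D1" "finite D2"
    unfolding D1_def D2_def using F finR by (auto intro: finite_subset[rotated] Image_mono)
  \<comment> \<open>\<open>F1\<close> loses only \<open>y1\<close>, which \<open>i\<close> still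
    contributes to \<open>D2\<close>, and symmetrically; so \<open>D1 \<union> D2\<close> contains
    all neighbours of \<open>F1 \<union> F2\<close>. Adding this to the bound for
    \<open>F1 \<inter> F2\<close> without \<open>i\<close> gives
    \<open>card D1 + card D2 \<ge> card F1 + card F2 - 1\<close>, but the two violations make it at
    most \<open>card F1 + card F2 - 2\<close>.\<close>
  have "card (F1 \<union> F2) \<le> card (D1 \<union> D2)"
  proof (rule order.trans[OF hall card_mono])
    show "R `` (F1 \<union> F2) \<subseteq> D1 \<union> D2" unfolding D1_def D2_def using i12 y by auto
  qed (use F finD in auto)
  moreover have "card (F1 \<inter> F2 - {i}) \<le> card (D1 \<inter> D2)"
  proof (rule order.trans[OF hall card_mono])
    show "R `` (F1 \<inter> F2 - {i}) \<subseteq> D1 \<inter> D2" unfolding D1_def D2_def by auto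
  qed (use F finD in auto)
  moreover have "card (F1 \<inter> F2 - {i}) + 1 = card (F1 \<inter> F2)"
    using i12 F card_Suc_Diff1[of "F1 \<inter> F2" i] by simp
  moreover have "card F1 + card F2 = card (F1 \<union> F2) + card (F1 \<inter> F2)"
    using F by (intro card_Un_Int) auto
  moreover have "card D1 + card D2 = card (D1 \<union> D2) + card (D1 \<inter> D2)"
    using finD by (rule card_Un_Int)
  ultimately show False using F(3,6) unfolding D1_def[symmetric] D2_def[symmetric] by linarith
qed

text \<open>Rado's argument: delete a maximal set \<open>Q\<close> of edges without violating Hall's
  condition. Zorn's lemma applies because a finite \<open>F\<close> meets only finitely many edges,
  so what it loses to the union of a chain is already lost to a single member. By
  \<open>rado_step\<close> maximality leaves exactly one edge at every index, and the condition for
  two-element \<open>F\<close> makes the resulting choice injective.\<close>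

lemma hall_marriage:
  fixes A :: "'i \<Rightarrow> 'b set"
  assumes fin: "\<And>i. i \<in> I \<Longrightarrow> finite (A i)"
    and hall: "\<And>F. finite F \<Longrightarrow> F \<subseteq> I \<Longrightarrow> card F \<le> card (\<Union>i\<in>F. A i)"
  shows "\<exists>f. inj_on f I \<and> (\<forall>i\<in>I. f i \<in> A i)"
proof -
  define R where "R = Sigma I A"
  define \<Q> where "\<Q> = {Q. \<forall>F. finite F \<longrightarrow> F \<subseteq> I \<longrightarrow> card F \<le> card ((R - Q) `` F)}"
  have "\<Union>\<C> \<in> \<Q>" if \<C>: "\<C> \<noteq> {}" "subset.chain \<Q> \<C>" for \<C>
    unfolding \<Q>_def
  proof (intro CollectI allI impI)
    fix F assume F: "finite F" "F \<subseteq> I"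
    define P where "P = Sigma F A \<inter> \<Union>\<C>"
    have "finite P" unfolding P_def using F fin by (auto simp: subset_iff)
    moreover have "P \<subseteq> \<Union>\<C>" by (simp add: P_def)
    ultimately obtain Q where Q: "Q \<in> \<C>" "P \<subseteq> Q"
      using finite_subset_Union_chain[OF _ _ \<C>] by blast
    have "(R - \<Union>\<C>) `` F = (R - Q) `` F" using Q F unfolding P_def R_def by auto
    moreover have "Q \<in> \<Q>" using Q \<C> by (auto simp: subset.chain_def)
    ultimately show "card F \<le> card ((R - \<Union>\<C>) `` F)" using F by (simp add: \<Q>_def)
  qed
  moreover have "{} \<in> \<Q>"
  proof -
    have "R `` F = (\<Union>i\<in>F. A i)" if "F \<subseteq> I" for F using that unfolding R_def by auto
    then show ?thesis using hall by (simp add: \<Q>_def)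
  qed
  ultimately obtain Q where Q: "Q \<in> \<Q>" "\<And>Q'. Q' \<in> \<Q> \<Longrightarrow> Q \<subseteq> Q' \<Longrightarrow> Q' = Q"
    using subset_Zorn_nonempty[of \<Q>] by (metis empty_iff)
  have hallQ: "card F \<le> card ((R - Q) `` F)" if "finite F" "F \<subseteq> I" for F
    using Q that by (auto simp: \<Q>_def)
  have finQ: "finite ((R - Q) `` {i})" if "i \<in> I" for i
    using fin[OF that] by (rule finite_subset[rotated]) (auto simp: R_def)
  have ne: "\<exists>y. (i, y) \<in> R - Q" if "i \<in> I" for i
    using hallQ[of "{i}"] that by (cases "(R - Q) `` {i} = {}") auto
  have uniq: "y1 = y2" if i: "i \<in> I" and y: "(i, y1) \<in> R - Q" "(i, y2) \<in> R - Q" for i y1 y2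
  proof (rule ccontr)
    assume "y1 \<noteq> y2"
    from rado_step[OF finQ hallQ i y this] obtain y where
      yy: "y \<in> {y1, y2}" "\<forall>F. finite F \<longrightarrow> F \<subseteq> I \<longrightarrow> card F \<le> card ((R - Q - {(i, y)}) `` F)"
      by blast
    have "R - Q - {(i, y)} = R - insert (i, y) Q" by auto
    then have "insert (i, y) Q \<in> \<Q>" using yy by (simp add: \<Q>_def)
    from Q(2)[OF this] show False using y yy by auto
  qed
  define f where "f i = (SOME y. (i, y) \<in> R - Q)" for i
  have f: "(i, f i) \<in> R - Q" if "i \<in> I" for i
    unfolding f_def using ne[OF that] by (rule someI_ex)
  have "inj_on f I"
  proof (rule inj_onI, rule ccontr)
    fix i j assume ij: "i \<in> I" "j \<in> I" "f i = f j" "i \<noteq> j"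
    have "(R - Q) `` {i, j} \<subseteq> {f i}" using uniq f ij by auto
    then have "card ((R - Q) `` {i, j}) \<le> 1" using card_mono[of "{f i}"] by simp
    with hallQ[of "{i, j}"] ij show False by simp
  qed
  moreover have "f i \<in> A i" if "i \<in> I" for i using f[OF that] by (simp add: R_def)
  ultimately show ?thesis by blast
qed

subsection \<open>Folner sets\<close>

text \<open>\<open>f\<close> is a left translation on each of the finitely many pieces where the
  chosen displacement \<open>\<kappa>\<close> is constant, and the images of the pieces stay
  disjoint; so finite additivity is enough.\<close>

lemma (in group) mean_of_bounded_displacement:
  fixes \<mu> :: "'a set \<Rightarrow> real"
  assumes add: "\<And>A B. A \<subseteq> carrier G \<Longrightarrow> B \<subseteq> carrier G \<Longrightarrow> A \<inter> B = {} \<Longrightarrow> \<mu> (A \<union> B) = \<mu> A + \<mu> B"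
    and inv: "\<And>g A. g \<in> carrier G \<Longrightarrow> A \<subseteq> carrier G \<Longrightarrow> \<mu> (g <#\<^bsub>G\<^esub> A) = \<mu> A"
    and K: "finite K" "K \<subseteq> carrier G"
    and f: "inj_on f (carrier G)" "\<And>x. x \<in> carrier G \<Longrightarrow> f x \<in> (\<lambda>k. k \<otimes> x) ` K"
  shows "\<mu> (f ` carrier G) = \<mu> (carrier G)"
proof -
  have "\<forall>x\<in>carrier G. \<exists>k. k \<in> K \<and> f x = k \<otimes> x" using f(2) by blast
  from bchoice[OF this] obtain \<kappa> where \<kappa>: "\<And>x. x \<in> carrier G \<Longrightarrow> \<kappa> x \<in> K \<and> f x = \<kappa> x \<otimes> x"
    by blast
  define P where "P k = {x \<in> carrier G. \<kappa> x = k}" for k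
  have P: "P k \<subseteq> carrier G" for k by (auto simp: P_def)
  have fcl: "f ` carrier G \<subseteq> carrier G" using \<kappa> K by auto
  have "\<mu> {} = 0" using add[of "{}" "{}"] by simp
  have fP: "f ` P k = k <#\<^bsub>G\<^esub> P k" if "k \<in> K" for k
    using \<kappa> unfolding l_coset_def by (force simp: P_def)
  have "\<mu> (\<Union>k\<in>L. f ` P k) = \<mu> (\<Union>k\<in>L. P k)" if "finite L" "L \<subseteq> K" for L
    using that
  proof (induction L)
    case empty
    then show ?case by simp
  next
    case (insert k L)
    have "f ` P k \<inter> (\<Union>k\<in>L. f ` P k) = {}"
      using insert.hyps inj_onD[OF f(1)] unfolding P_def by fastforce
    moreover have "f ` P k \<subseteq> carrier G" for k using fcl P by blast
    ultimately have "\<mu> (f ` P k \<union> (\<Union>k\<in>L. f ` P k)) = \<mu> (f ` P k) + \<mu> (\<Union>k\<in>L. f ` P k)"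
      by (intro add UN_least) auto
    moreover have "\<mu> (P k \<union> (\<Union>k\<in>L. P k)) = \<mu> (P k) + \<mu> (\<Union>k\<in>L. P k)"
      by (intro add) (use insert.hyps P in \<open>auto simp: P_def\<close>)
    moreover have "\<mu> (f ` P k) = \<mu> (P k)" using inv[OF _ P, of k k] insert.prems K fP by auto
    ultimately show ?case using insert by simp
  qed
  from this[OF K(1) subset_refl] have "\<mu> (\<Union>k\<in>K. f ` P k) = \<mu> (\<Union>k\<in>K. P k)" .
  moreover have "(\<Union>k\<in>K. P k) = carrier G" using \<kappa> by (auto simp: P_def)
  ultimately show ?thesis by (metis image_UN)
qed

text \<open>Doubling would allow two injections of bounded displacement with disjoint ranges, each of full measure.\<close>

lemma (in group) amenable_no_doubling:
  assumes am: "amenable_group G" and K: "finite K" "K \<subseteq> carrier G"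
  shows "\<exists>F. finite F \<and> F \<subseteq> carrier G \<and> card (K <#> F) < 2 * card F"
proof (rule ccontr)
  assume no: "\<not> ?thesis"
  obtain \<mu> :: "'a set \<Rightarrow> real" where \<mu>: "(\<forall>A. A \<subseteq> carrier G \<longrightarrow> 0 \<le> \<mu> A) \<and> \<mu> (carrier G) = 1 \<and>
      (\<forall>A B. A \<subseteq> carrier G \<longrightarrow> B \<subseteq> carrier G \<longrightarrow> A \<inter> B = {} \<longrightarrow> \<mu> (A \<union> B) = \<mu> A + \<mu> B) \<and>
      (\<forall>g A. g \<in> carrier G \<longrightarrow> A \<subseteq> carrier G \<longrightarrow> \<mu> (g <#\<^bsub>G\<^esub> A) = \<mu> A)"
    using am unfolding amenable_group_def by (elim conjE exE) (rule that, intro conjI)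
  have total: "\<mu> (carrier G) = 1" and nonneg: "\<And>A. A \<subseteq> carrier G \<Longrightarrow> 0 \<le> \<mu> A"
    and add: "\<And>A B. A \<subseteq> carrier G \<Longrightarrow> B \<subseteq> carrier G \<Longrightarrow> A \<inter> B = {} \<Longrightarrow> \<mu> (A \<union> B) = \<mu> A + \<mu> B"
    and inv: "\<And>g A. g \<in> carrier G \<Longrightarrow> A \<subseteq> carrier G \<Longrightarrow> \<mu> (g <#\<^bsub>G\<^esub> A) = \<mu> A"
    using \<mu> by simp_all
  \<comment> \<open>The boolean makes every element choose twice; the assumed doubling then yields
    Hall's condition for this family.\<close>
  define A where "A = (\<lambda>(x, b :: bool). (\<lambda>k. k \<otimes> x) ` K)"
  have "\<exists>f. inj_on f (carrier G \<times> UNIV) \<and> (\<forall>i\<in>carrier G \<times> UNIV. f i \<in> A i)"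
  proof (rule hall_marriage)
    fix J :: "('a \<times> bool) set" assume J: "finite J" "J \<subseteq> carrier G \<times> UNIV"
    have "card J \<le> card (fst ` J \<times> (UNIV :: bool set))"
      by (rule card_mono) (use J in \<open>auto intro: rev_image_eqI\<close>)
    also have "\<dots> = 2 * card (fst ` J)" by (simp add: card_cartesian_product)
    also have "\<dots> \<le> card (K <#> fst ` J)"
    proof -
      have "finite (fst ` J)" "fst ` J \<subseteq> carrier G" using J by auto
      then show ?thesis using no not_less by blast
    qed
    also have "K <#> fst ` J = (\<Union>i\<in>J. A i)" unfolding set_mult_def A_def by force
    finally show "card J \<le> card (\<Union>i\<in>J. A i)" .
  qed (use K in \<open>auto simp: A_def\<close>)
  then obtain f where f: "inj_on f (carrier G \<times> UNIV)" "\<And>i. i \<in> carrier G \<times> UNIV \<Longrightarrow> f i \<in> A i" by blast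
  have "\<mu> ((\<lambda>x. f (x, b)) ` carrier G) = 1" for b
    unfolding total[symmetric]
    by (rule mean_of_bounded_displacement[OF add inv K])
       (use f in \<open>auto simp: A_def inj_on_def\<close>)
  moreover have cl: "(\<lambda>x. f (x, b)) ` carrier G \<subseteq> carrier G" for b
  proof clarify
    fix x assume "x \<in> carrier G"
    then have "f (x, b) \<in> A (x, b)" using f(2) by simp
    then show "f (x, b) \<in> carrier G" using K \<open>x \<in> carrier G\<close> by (auto simp: A_def)
  qed
  moreover have "(\<lambda>x. f (x, True)) ` carrier G \<inter> (\<lambda>x. f (x, False)) ` carrier G = {}"
    using f(1) by (auto simp: inj_on_def)
  ultimately have "\<mu> ((\<lambda>x. f (x, True)) ` carrier G \<union> (\<lambda>x. f (x, False)) ` carrier G) = 2" (is "\<mu> ?U = 2")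
    by (subst add) auto
  moreover have "\<mu> (?U \<union> (carrier G - ?U)) = \<mu> ?U + \<mu> (carrier G - ?U)"
    by (rule add) (use cl in auto)
  moreover have "?U \<union> (carrier G - ?U) = carrier G" using cl by auto
  ultimately show False using total nonneg[of "carrier G - ?U"] by simp
qed

text \<open>If each of the \<open>N\<close> steps from \<open>S m\<close> to
  \<open>S (Suc m)\<close> enlarged the set by more than the factor \<open>1 + \<delta>\<close>,
  then \<open>B N\<close> would at least double \<open>F\<close>, against the choice of
  \<open>F\<close>. A step with less growth gives the Folner set: since
  \<open>\<one> \<in> K'\<close>, the sets increase, and whatever some \<open>k \<in> K\<close>
  moves out of \<open>S m\<close> lies in \<open>S (Suc m) - S m\<close>.\<close>

lemma (in group) amenable_folner:
  fixes \<delta> :: real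
  assumes am: "amenable_group G" and K: "finite K" "K \<subseteq> carrier G" and \<delta>: "0 < \<delta>"
  shows "\<exists>T. finite T \<and> T \<noteq> {} \<and> T \<subseteq> carrier G \<and>
             (\<forall>k\<in>K. card {t \<in> T. k \<otimes> t \<notin> T} \<le> \<delta> * card T)"
proof -
  define K' where "K' = insert \<one> K"
  have K': "finite K'" "K' \<subseteq> carrier G" using K by (auto simp: K'_def)
  define B where "B m = ((\<lambda>S. K' <#> S) ^^ m) {\<one>}" for m
  have fin_mult: "finite (S <#> S')" if "finite S" "finite S'" for S S'
    using that by (auto simp: set_mult_def)
  have B: "finite (B m) \<and> B m \<subseteq> carrier G" for m
    by (induction m) (use K' in \<open>auto simp: B_def fin_mult dest!: set_mult_closed[OF K'(2), THEN subsetD, rotated]\<close>)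
  obtain N where N: "2 < (1 + \<delta>) ^ N" using real_arch_pow[of "1 + \<delta>" 2] \<delta> by auto
  obtain F where F: "finite F" "F \<subseteq> carrier G" "card (B N <#> F) < 2 * card F"
    using amenable_no_doubling[OF am] B[of N] by blast
  define S where "S m = B m <#> F" for m
  have S0: "S 0 = F" using F by (auto simp: S_def B_def set_mult_def subset_iff)
  have SS: "S (Suc m) = K' <#> S m" for m
    unfolding S_def using set_mult_assoc[OF K'(2) conjunct2[OF B] F(2)] by (simp add: B_def)
  have S: "finite (S m)" "S m \<subseteq> carrier G" for m
    using B[of m] F by (auto simp: S_def fin_mult dest: set_mult_closed[THEN subsetD, rotated 2])
  have "\<exists>m<N. card (S (Suc m)) \<le> (1 + \<delta>) * card (S m)"
  proof (rule ccontr)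
    assume no: "\<not> ?thesis"
    have "(1 + \<delta>) ^ m * card (S 0) \<le> card (S m)" if "m \<le> N" for m
      using that
    proof (induction m)
      case (Suc m)
      then have "(1 + \<delta>) * ((1 + \<delta>) ^ m * card (S 0)) \<le> (1 + \<delta>) * card (S m)"
        using \<delta> by (intro mult_left_mono) auto
      also have "\<dots> \<le> card (S (Suc m))" using no Suc.prems by (meson Suc_le_lessD less_imp_le not_le)
      finally show ?case by (simp add: mult.assoc)
    qed simp
    from this[of N] have "(1 + \<delta>) ^ N * card F \<le> card (S N)" by (simp add: S0)
    moreover have "2 * real (card F) \<le> (1 + \<delta>) ^ N * card F" using N by (intro mult_right_mono) auto
    ultimately show False using F(3) unfolding S_def by linarith
  qed
  then obtain m where m: "card (S (Suc m)) \<le> (1 + \<delta>) * card (S m)" by blast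
  have sub: "S m \<subseteq> S (Suc m)" using S(2)[of m] by (auto simp: SS set_mult_def K'_def subset_iff intro!: bexI[of _ "\<one>"])
  show ?thesis
  proof (intro exI[of _ "S m"] conjI ballI)
    have "F \<noteq> {}" using F(3) by auto
    then have "B m <#> F \<noteq> {}"
    proof -
      have "B m \<noteq> {}" by (induction m) (auto simp: B_def set_mult_def K'_def)
      then show ?thesis using \<open>F \<noteq> {}\<close> by (auto simp: set_mult_def)
    qed
    then show "S m \<noteq> {}" by (simp add: S_def)
    fix k assume k: "k \<in> K"
    have "card {t \<in> S m. k \<otimes> t \<notin> S m} \<le> card (S (Suc m) - S m)"
    proof (rule card_inj_on_le[where f = "\<lambda>t. k \<otimes> t"])
      show "inj_on (\<lambda>t. k \<otimes> t) {t \<in> S m. k \<otimes> t \<notin> S m}"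
        using k K S(2)[of m] by (auto simp: inj_on_def subset_iff)
      show "(\<lambda>t. k \<otimes> t) ` {t \<in> S m. k \<otimes> t \<notin> S m} \<subseteq> S (Suc m) - S m"
        using k by (auto simp: SS set_mult_def K'_def)
    qed (use S in auto)
    also have "\<dots> = card (S (Suc m)) - card (S m)"
      using S sub by (intro card_Diff_subset) auto
    finally have "real (card {t \<in> S m. k \<otimes> t \<notin> S m}) \<le> real (card (S (Suc m))) - card (S m)"
      using card_mono[OF S(1) sub] by linarith
    then show "card {t \<in> S m. k \<otimes> t \<notin> S m} \<le> \<delta> * card (S m)" using m by (simp add: algebra_simps)
  qed (use S in auto)
qed

subsection \<open>Matching approximately free actions\<close>

text \<open>A condition at a single point, so that the points at which an approximate action
  misbehaves can be counted; the product of \<open>g\<close> and \<open>h\<close> may lie outside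
  the window \<open>E\<close>.\<close>

definition acts_freely_at :: "('g, 'm) monoid_scheme \<Rightarrow> ('g \<Rightarrow> 'x \<Rightarrow> 'x) \<Rightarrow> 'g set \<Rightarrow> 'x \<Rightarrow> bool" where
  "acts_freely_at G \<alpha> E x \<longleftrightarrow>
     (\<forall>g\<in>E. \<forall>h\<in>E. \<alpha> g (\<alpha> h x) = \<alpha> (g \<otimes>\<^bsub>G\<^esub> h) x \<and> (g \<noteq> h \<longrightarrow> \<alpha> g x \<noteq> \<alpha> h x))"

lemma acts_freely_at_mono: "acts_freely_at G \<alpha> E x \<Longrightarrow> E' \<subseteq> E \<Longrightarrow> acts_freely_at G \<alpha> E' x"
  unfolding acts_freely_at_def by blast

lemma acts_freely_at_mult:
  "acts_freely_at G \<alpha> E x \<Longrightarrow> g \<in> E \<Longrightarrow> h \<in> E \<Longrightarrow> \<alpha> (g \<otimes>\<^bsub>G\<^esub> h) x = \<alpha> g (\<alpha> h x)"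
  by (simp add: acts_freely_at_def)

section \<open>Counting boundary points and finding room for a tile\<close>

text \<open>Both numbers are \<open>card P\<close> minus the number of points that stay in
  \<open>P\<close>, because the preimage of \<open>P\<close> under a permutation of \<open>X\<close>
  has the size of \<open>P\<close>. Folner sets control what leaves, whereas the search for free
  room needs what enters.\<close>

lemma card_entering_eq_leaving:
  assumes X: "finite X" "bij_betw f X X" and P: "P \<subseteq> X"
  shows "card {x \<in> X - P. f x \<in> P} = card {x \<in> P. f x \<notin> P}"
proof -
  have fin: "finite P" using X P finite_subset by blast
  have "bij_betw f {x \<in> X. f x \<in> P} P"
    using X(2) P unfolding bij_betw_def by (auto intro: inj_on_subset)
  then have "card {x \<in> X. f x \<in> P} = card P" by (rule bij_betw_same_card)
  moreover have "card {x \<in> X. f x \<in> P} = card {x \<in> X - P. f x \<in> P} + card {x \<in> P. f x \<in> P}"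
    by (subst card_Un_disjoint[symmetric]) (use X fin P in \<open>auto intro!: arg_cong[where f = card]\<close>)
  moreover have "card P = card {x \<in> P. f x \<notin> P} + card {x \<in> P. f x \<in> P}"
    by (subst card_Un_disjoint[symmetric]) (use fin in \<open>auto intro!: arg_cong[where f = card]\<close>)
  ultimately show ?thesis by linarith
qed

text \<open>Double counting of the pairs \<open>(x, t)\<close> with
  \<open>\<alpha> t x \<in> P\<close>. If all points of \<open>W - P\<close> were bad, each would
  contribute more than \<open>\<theta> * card T\<close>, while each \<open>t\<close> accounts for at
  most \<open>b\<close>; so \<open>W - P\<close> would have at most \<open>b / \<theta>\<close>
  elements. \<open>W\<close> will be the set of points at which the action is free.\<close>

lemma exists_mostly_outside:
  fixes b \<theta> :: real
  assumes X: "finite X" "W \<subseteq> X" and T: "finite T" "T \<noteq> {}"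
    and b: "\<And>t. t \<in> T \<Longrightarrow> card {x \<in> X - P. \<alpha> t x \<in> P} \<le> b"
    and \<theta>: "0 < \<theta>" and lt: "b / \<theta> + card (X - W) < card (X - P)"
  shows "\<exists>x\<in>W - P. card {t \<in> T. \<alpha> t x \<in> P} \<le> \<theta> * card T"
proof (rule ccontr)
  assume no: "\<not> ?thesis"
  have "\<theta> * card T * card (W - P) = (\<Sum>x\<in>W - P. \<theta> * card T)" by simp
  also have "\<dots> \<le> (\<Sum>x\<in>W - P. real (card {t \<in> T. \<alpha> t x \<in> P}))"
    using no by (intro sum_mono) (auto simp: not_le less_imp_le)
  also have "\<dots> \<le> (\<Sum>x\<in>X - P. real (card {t \<in> T. \<alpha> t x \<in> P}))"
    using X by (intro sum_mono2) auto
  also have "\<dots> = (\<Sum>x\<in>X - P. \<Sum>t\<in>T. if \<alpha> t x \<in> P then 1 else 0)"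
    using T by (simp add: sum.If_cases Int_def)
  also have "\<dots> = (\<Sum>t\<in>T. \<Sum>x\<in>X - P. if \<alpha> t x \<in> P then 1 else 0)"
    by (rule sum.swap)
  also have "\<dots> = (\<Sum>t\<in>T. real (card {x \<in> X - P. \<alpha> t x \<in> P}))"
    using X by (simp add: sum.If_cases Int_def)
  also have "\<dots> \<le> (\<Sum>t\<in>T. b)" using b by (intro sum_mono) auto
  also have "\<dots> = card T * b" by simp
  finally have "card T * (\<theta> * card (W - P)) \<le> card T * b" by (simp add: mult_ac)
  moreover have "0 < real (card T)" using T by (simp add: card_gt_0_iff)
  ultimately have "\<theta> * card (W - P) \<le> b" by simp
  then have "card (W - P) \<le> b / \<theta>" using \<theta> by (simp add: field_simps)
  moreover have "card (X - P) \<le> card (W - P) + card (X - W)"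
    by (rule order.trans[OF card_mono card_Un_le]) (use X finite_subset in auto)
  ultimately show False using lt by linarith
qed

section \<open>Partial matchings made of tiles\<close>

text \<open>Freeness is asked only at \<open>Xg\<close> and \<open>Yg\<close>, the possible centres
  of tiles: whatever has to be known about another point of a tile is read off at its centre,
  through the window \<open>E\<close>.\<close>

locale approx_pair = group G for G (structure) +
  fixes X :: "'x set" and Y :: "'y set" and \<alpha> :: "'a \<Rightarrow> 'x \<Rightarrow> 'x" and \<beta> :: "'a \<Rightarrow> 'y \<Rightarrow> 'y"
    and E :: "'a set" and Xg :: "'x set" and Yg :: "'y set"
  assumes finite_X: "finite X" and finite_Y: "finite Y" and card_eq: "card X = card Y"
    and bij_\<alpha>: "\<And>g. g \<in> carrier G \<Longrightarrow> bij_betw (\<alpha> g) X X"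
    and bij_\<beta>: "\<And>g. g \<in> carrier G \<Longrightarrow> bij_betw (\<beta> g) Y Y"
    and finite_E: "finite E" and E_carrier: "E \<subseteq> carrier G"
    and Xg: "Xg \<subseteq> X" "\<And>x. x \<in> Xg \<Longrightarrow> acts_freely_at G \<alpha> E x"
    and Yg: "Yg \<subseteq> Y" "\<And>y. y \<in> Yg \<Longrightarrow> acts_freely_at G \<beta> E y"
begin

definition p :: "('x \<times> 'y) \<times> 'a \<Rightarrow> 'x" where "p a = \<alpha> (snd a) (fst (fst a))"
definition q :: "('x \<times> 'y) \<times> 'a \<Rightarrow> 'y" where "q a = \<beta> (snd a) (snd (fst a))"

text \<open>
  An atom \<open>((x, y), s)\<close> of a matching pairs the point \<open>\<alpha> s x\<close> with \<open>\<beta> s y\<close>; the atoms sharing the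
  pair of centres \<open>(x, y)\<close> form a tile, whose shape is the set of the occurring \<open>s\<close>.
\<close>

definition matching :: "(('x \<times> 'y) \<times> 'a) set \<Rightarrow> bool" where
  "matching M \<longleftrightarrow> M \<subseteq> (Xg \<times> Yg) \<times> E \<and> inj_on p M \<and> inj_on q M"

text \<open>Counted on atoms, so that one number serves both sides. An atom also counts as leaving
  when \<open>t\<close> carries its point into another tile; this is what later makes the labels of
  tiles almost invariant.\<close>

definition leaving :: "(('x \<times> 'y) \<times> 'a) set \<Rightarrow> 'a \<Rightarrow> (('x \<times> 'y) \<times> 'a) set" where
  "leaving M t = {a \<in> M. (fst a, t \<otimes> snd a) \<notin> M}"

lemma finite_XYE: "finite ((Xg \<times> Yg) \<times> E)"
  using finite_X finite_Y finite_E Xg(1) Yg(1) by (meson finite_SigmaI finite_subset)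

lemma matching_finite: "matching M \<Longrightarrow> finite M"
  using finite_XYE finite_subset unfolding matching_def by blast

lemma matching_empty: "matching {}"
  by (simp add: matching_def)

lemma p_in: "a \<in> (Xg \<times> Yg) \<times> E \<Longrightarrow> p a \<in> X"
  using bij_betw_apply[OF bij_\<alpha>] E_carrier Xg(1) by (auto simp: p_def subset_iff)

lemma q_in: "a \<in> (Xg \<times> Yg) \<times> E \<Longrightarrow> q a \<in> Y"
  using bij_betw_apply[OF bij_\<beta>] E_carrier Yg(1) by (auto simp: q_def subset_iff)

lemma p_image: "matching M \<Longrightarrow> p ` M \<subseteq> X" and q_image: "matching M \<Longrightarrow> q ` M \<subseteq> Y"
  using p_in q_in unfolding matching_def by blast+

lemma card_p: "matching M \<Longrightarrow> card (p ` M) = card M" and card_q: "matching M \<Longrightarrow> card (q ` M) = card M"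
  by (auto simp: matching_def card_image)

lemma p_shift: "a \<in> (Xg \<times> Yg) \<times> E \<Longrightarrow> t \<in> E \<Longrightarrow> p (fst a, t \<otimes> snd a) = \<alpha> t (p a)"
  using Xg(2) unfolding p_def acts_freely_at_def by auto

lemma q_shift: "a \<in> (Xg \<times> Yg) \<times> E \<Longrightarrow> t \<in> E \<Longrightarrow> q (fst a, t \<otimes> snd a) = \<beta> t (q a)"
  using Yg(2) unfolding q_def acts_freely_at_def by auto

text \<open>By \<open>p_shift\<close> and \<open>q_shift\<close> every point that \<open>t\<close>
  moves out of the matched part comes from an atom in \<open>leaving M t\<close>; on a finite set as
  many points enter as leave.\<close>

lemma card_entering:
  assumes M: "matching M" and t: "t \<in> E"
  shows "card {x \<in> X - p ` M. \<alpha> t x \<in> p ` M} \<le> card (leaving M t)" (is ?A)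
    and "card {y \<in> Y - q ` M. \<beta> t y \<in> q ` M} \<le> card (leaving M t)" (is ?B)
proof -
  have fin: "finite (leaving M t)" using matching_finite[OF M] by (simp add: leaving_def)
  have tG: "t \<in> carrier G" using t E_carrier by blast
  have sub: "M \<subseteq> (Xg \<times> Yg) \<times> E" using M by (simp add: matching_def)
  have "{x \<in> p ` M. \<alpha> t x \<notin> p ` M} \<subseteq> p ` leaving M t"
  proof
    fix x assume "x \<in> {x \<in> p ` M. \<alpha> t x \<notin> p ` M}"
    then obtain a where a: "a \<in> M" "x = p a" "\<alpha> t x \<notin> p ` M" by blast
    then have "p (fst a, t \<otimes> snd a) \<notin> p ` M" using p_shift[of a t] sub t by auto
    then have "a \<in> leaving M t" using a by (auto simp: leaving_def)
    then show "x \<in> p ` leaving M t" using a by blast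
  qed
  from surj_card_le[OF fin this] card_entering_eq_leaving[OF finite_X bij_\<alpha>[OF tG] p_image[OF M]]
  show ?A by simp
  have "{x \<in> q ` M. \<beta> t x \<notin> q ` M} \<subseteq> q ` leaving M t"
  proof
    fix x assume "x \<in> {x \<in> q ` M. \<beta> t x \<notin> q ` M}"
    then obtain a where a: "a \<in> M" "x = q a" "\<beta> t x \<notin> q ` M" by blast
    then have "q (fst a, t \<otimes> snd a) \<notin> q ` M" using q_shift[of a t] sub t by auto
    then have "a \<in> leaving M t" using a by (auto simp: leaving_def)
    then show "x \<in> q ` leaving M t" using a by blast
  qed
  from surj_card_le[OF fin this] card_entering_eq_leaving[OF finite_Y bij_\<beta>[OF tG] q_image[OF M]]
  show ?B by simp
qed

text \<open>Invariance under \<open>t\<close> is known only for the matching \<open>M\<close> at the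
  start of a stage. The atoms added since are charged in full, one entering point each, which is
  affordable as long as a stage adds only a small share of \<open>X\<close>.\<close>

lemma card_entering_extension:
  assumes M: "matching M" and M': "matching M'" and MM: "M \<subseteq> M'" and t: "t \<in> E"
  shows "card {x \<in> X - p ` M'. \<alpha> t x \<in> p ` M'} \<le> card (leaving M t) + (card M' - card M)" (is ?A)
    and "card {y \<in> Y - q ` M'. \<beta> t y \<in> q ` M'} \<le> card (leaving M t) + (card M' - card M)" (is ?B)
proof -
  have tG: "t \<in> carrier G" using t E_carrier by blast
  have fin: "finite M'" by (rule matching_finite[OF M'])
  have d: "card (M' - M) = card M' - card M"
    using MM fin by (intro card_Diff_subset) (auto intro: finite_subset)
  have "{x \<in> X - p ` M'. \<alpha> t x \<in> p ` M'} \<subseteq>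
      {x \<in> X - p ` M. \<alpha> t x \<in> p ` M} \<union> {x \<in> X. \<alpha> t x \<in> p ` (M' - M)}" using MM by auto
  then have "card {x \<in> X - p ` M'. \<alpha> t x \<in> p ` M'} \<le>
      card {x \<in> X - p ` M. \<alpha> t x \<in> p ` M} + card {x \<in> X. \<alpha> t x \<in> p ` (M' - M)}"
    using finite_X by (intro order.trans[OF card_mono card_Un_le]) auto
  moreover have "card {x \<in> X. \<alpha> t x \<in> p ` (M' - M)} \<le> card (p ` (M' - M))"
    by (rule card_inj_on_le[where f = "\<alpha> t"])
       (use bij_\<alpha>[OF tG] fin in \<open>auto simp: bij_betw_def intro: inj_on_subset\<close>)
  moreover have "card (p ` (M' - M)) \<le> card (M' - M)" using fin by (intro card_image_le) auto
  ultimately show ?A using card_entering(1)[OF M t] d by linarith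
  have "{x \<in> Y - q ` M'. \<beta> t x \<in> q ` M'} \<subseteq>
      {x \<in> Y - q ` M. \<beta> t x \<in> q ` M} \<union> {x \<in> Y. \<beta> t x \<in> q ` (M' - M)}" using MM by auto
  then have "card {x \<in> Y - q ` M'. \<beta> t x \<in> q ` M'} \<le>
      card {x \<in> Y - q ` M. \<beta> t x \<in> q ` M} + card {x \<in> Y. \<beta> t x \<in> q ` (M' - M)}"
    using finite_Y by (intro order.trans[OF card_mono card_Un_le]) auto
  moreover have "card {x \<in> Y. \<beta> t x \<in> q ` (M' - M)} \<le> card (q ` (M' - M))"
    by (rule card_inj_on_le[where f = "\<beta> t"])
       (use bij_\<beta>[OF tG] fin in \<open>auto simp: bij_betw_def intro: inj_on_subset\<close>)
  moreover have "card (q ` (M' - M)) \<le> card (M' - M)" using fin by (intro card_image_le) auto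
  ultimately show ?B using card_entering(2)[OF M t] d by linarith
qed

text \<open>Both sides must use the same shape, so an \<open>s\<close> that collides on either side
  is dropped from both. In the last bound a departure from \<open>S\<close> either leaves
  \<open>T\<close> already or lands in the dropped part \<open>T - S\<close>; left multiplication by
  \<open>t\<close> is injective, so the latter happens at most \<open>card (T - S)\<close>
  times.\<close>

lemma matching_add_tile:
  assumes M: "matching M" and T: "T \<subseteq> E" and x: "x \<in> Xg" and y: "y \<in> Yg"
    and S: "S = {s \<in> T. \<alpha> s x \<notin> p ` M \<and> \<beta> s y \<notin> q ` M}"
  shows "matching (M \<union> {(x, y)} \<times> S)"
    and "card (M \<union> {(x, y)} \<times> S) = card M + card S"
    and "t \<in> carrier G \<Longrightarrow>
      card (leaving (M \<union> {(x, y)} \<times> S) t) \<le> card (leaving M t) + card {s \<in> T. t \<otimes> s \<notin> T} + card (T - S)"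
proof -
  have finT: "finite T" "finite S" using T finite_E S by (auto intro: finite_subset)
  have ST: "S \<subseteq> T" using S by blast
  have pS: "p ((x, y), s) \<notin> p ` M" "q ((x, y), s) \<notin> q ` M" if "s \<in> S" for s
    using that S by (auto simp: p_def q_def)
  then have disj: "M \<inter> {(x, y)} \<times> S = {}" by blast
  have inj: "inj_on p ({(x, y)} \<times> S)" "inj_on q ({(x, y)} \<times> S)"
    using Xg(2)[OF x] Yg(2)[OF y] ST T unfolding acts_freely_at_def inj_on_def p_def q_def
    by (auto simp: subset_iff) metis+
  have inj_Un: "inj_on f (A \<union> B)" if "inj_on f A" "inj_on f B" "f ` B \<subseteq> - f ` A" for f and A B :: "(('x \<times> 'y) \<times> 'a) set"
    unfolding inj_on_Un using that by blast
  have "inj_on p (M \<union> {(x, y)} \<times> S)" "inj_on q (M \<union> {(x, y)} \<times> S)"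
    by (rule inj_Un; use M inj pS in \<open>auto simp: matching_def\<close>)+
  moreover have "{(x, y)} \<times> S \<subseteq> (Xg \<times> Yg) \<times> E" using x y ST T by auto
  ultimately show "matching (M \<union> {(x, y)} \<times> S)"
    using M by (simp add: matching_def)
  show "card (M \<union> {(x, y)} \<times> S) = card M + card S"
    using matching_finite[OF M] finT disj by (subst card_Un_disjoint) (auto simp: card_cartesian_product)
  assume t: "t \<in> carrier G"
  have "leaving (M \<union> {(x, y)} \<times> S) t \<subseteq> leaving M t \<union> {(x, y)} \<times> {s \<in> S. t \<otimes> s \<notin> S}"
    by (auto simp: leaving_def)
  then have "card (leaving (M \<union> {(x, y)} \<times> S) t) \<le>
      card (leaving M t) + card ({(x, y)} \<times> {s \<in> S. t \<otimes> s \<notin> S})"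
    using matching_finite[OF M] finT
    by (intro order.trans[OF card_mono card_Un_le]) (auto simp: leaving_def)
  also have "card ({(x, y)} \<times> {s \<in> S. t \<otimes> s \<notin> S}) = card {s \<in> S. t \<otimes> s \<notin> S}"
    by (simp add: card_cartesian_product)
  also have "\<dots> \<le> card {s \<in> T. t \<otimes> s \<notin> T} + card {s \<in> T. t \<otimes> s \<in> T - S}"
    using finT ST by (intro order.trans[OF card_mono card_Un_le]) auto
  also have "card {s \<in> T. t \<otimes> s \<in> T - S} \<le> card (T - S)"
    by (rule card_inj_on_le[where f = "\<lambda>s. t \<otimes> s"])
       (use finT t T E_carrier in \<open>auto simp: inj_on_def subset_iff\<close>)
  finally show "card (leaving (M \<union> {(x, y)} \<times> S) t) \<le>
      card (leaving M t) + card {s \<in> T. t \<otimes> s \<notin> T} + card (T - S)" by simp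
qed

text \<open>One stage, with a single shape \<open>T\<close> and at most \<open>c * card X\<close>
  new atoms. A largest admissible extension \<open>M'\<close> must satisfy the alternative:
  otherwise too much of \<open>X\<close> and \<open>Y\<close> is uncovered for the averaging to
  fail, and one more tile contradicts maximality. The slack \<open>card T\<close> is there because
  the next tile could overshoot the quota.\<close>

lemma matching_extend:
  fixes c \<eta> \<theta> \<rho> :: real
  assumes M: "matching M" and T: "T \<subseteq> E" "T \<noteq> {}" and D: "D \<subseteq> carrier G"
    and TD: "\<And>t. t \<in> D \<Longrightarrow> card {s \<in> T. t \<otimes> s \<notin> T} \<le> \<theta> * card T"
    and \<rho>: "\<And>t. t \<in> T \<Longrightarrow> card (leaving M t) \<le> \<rho> * card X"
    and \<theta>: "0 < \<theta>" "\<theta> \<le> 1/4" and c: "0 \<le> c"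
    and lt: "(\<rho> + c) * card X / \<theta> + card (X - Xg) < \<eta> * card X"
            "(\<rho> + c) * card X / \<theta> + card (Y - Yg) < \<eta> * card X"
  shows "\<exists>M'. matching M' \<and> (card M' \<ge> (1 - \<eta>) * card X \<or> card M' + card T \<ge> card M + c * card X) \<and>
    (\<forall>t\<in>D. card (leaving M' t) \<le> card (leaving M t) + 6 * \<theta> * c * card X)"
proof -
  have finT: "finite T" using T(1) finite_E by (rule finite_subset)
  define \<S> where "\<S> = {M'. matching M' \<and> M \<subseteq> M' \<and> card M' \<le> card M + c * card X \<and>
    (\<forall>t\<in>D. card (leaving M' t) \<le> card (leaving M t) + 6 * \<theta> * (card M' - card M))}"
  have "\<S> \<subseteq> Pow ((Xg \<times> Yg) \<times> E)" by (auto simp: \<S>_def matching_def)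
  then have "finite \<S>" using finite_XYE by (meson finite_Pow_iff finite_subset)
  moreover have "M \<in> \<S>" using M c by (simp add: \<S>_def)
  ultimately have fin: "finite (card ` \<S>)" "card ` \<S> \<noteq> {}" by auto
  from Max_in[OF this] obtain M' where "M' \<in> \<S>" "card M' = Max (card ` \<S>)" by auto
  with Max_ge[OF fin(1)] have "M' \<in> \<S>" and max: "\<And>N. N \<in> \<S> \<Longrightarrow> card N \<le> card M'" by auto
  then have M': "matching M'" "M \<subseteq> M'" "card M' \<le> card M + c * card X"
    "\<And>t. t \<in> D \<Longrightarrow> card (leaving M' t) \<le> card (leaving M t) + 6 * \<theta> * (card M' - card M)"
    by (auto simp: \<S>_def)
  have MM: "card M \<le> card M'" using M'(2) matching_finite[OF M'(1)] by (rule card_mono[rotated])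
  have "card M' \<ge> (1 - \<eta>) * card X \<or> card M' + card T \<ge> card M + c * card X"
  proof (rule ccontr)
    assume no: "\<not> ?thesis"
    have b: "card (leaving M t) + (card M' - card M) \<le> (\<rho> + c) * card X" if "t \<in> T" for t
      using \<rho>[OF that] M'(3) MM by (simp add: algebra_simps of_nat_diff)
    have cX: "card (X - p ` M') = card X - card M'" "card (Y - q ` M') = card X - card M'"
      using card_p[OF M'(1)] card_q[OF M'(1)] p_image[OF M'(1)] q_image[OF M'(1)] finite_X finite_Y card_eq
      by (auto simp: card_Diff_subset finite_subset)
    have "card M' \<le> card X" using card_p[OF M'(1)] card_mono[OF finite_X p_image[OF M'(1)]] by simp
    then have big: "\<eta> * card X \<le> card (X - p ` M')" "\<eta> * card X \<le> card (Y - q ` M')"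
      using no unfolding cX by (auto simp: algebra_simps of_nat_diff)
    have "\<exists>x\<in>Xg - p ` M'. card {t \<in> T. \<alpha> t x \<in> p ` M'} \<le> \<theta> * card T"
    proof (rule exists_mostly_outside[OF finite_X Xg(1) finT T(2) _ \<theta>(1)])
      show "card {x \<in> X - p ` M'. \<alpha> t x \<in> p ` M'} \<le> (\<rho> + c) * card X" if "t \<in> T" for t
        using card_entering_extension(1)[OF M M'(1,2), of t] b[OF that] that T(1) by fastforce
    qed (use lt big in linarith)
    then obtain x where x: "x \<in> Xg" "card {t \<in> T. \<alpha> t x \<in> p ` M'} \<le> \<theta> * card T" by blast
    have "\<exists>y\<in>Yg - q ` M'. card {t \<in> T. \<beta> t y \<in> q ` M'} \<le> \<theta> * card T"
    proof (rule exists_mostly_outside[OF finite_Y Yg(1) finT T(2) _ \<theta>(1)])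
      show "card {y \<in> Y - q ` M'. \<beta> t y \<in> q ` M'} \<le> (\<rho> + c) * card X" if "t \<in> T" for t
        using card_entering_extension(2)[OF M M'(1,2), of t] b[OF that] that T(1) by fastforce
    qed (use lt big in linarith)
    then obtain y where y: "y \<in> Yg" "card {t \<in> T. \<beta> t y \<in> q ` M'} \<le> \<theta> * card T" by blast
    define S where "S = {s \<in> T. \<alpha> s x \<notin> p ` M' \<and> \<beta> s y \<notin> q ` M'}"
    note tile = matching_add_tile[OF M'(1) T(1) x(1) y(1) S_def]
    let ?N = "M' \<union> {(x, y)} \<times> S"
    have "card (T - S) \<le> card {t \<in> T. \<alpha> t x \<in> p ` M'} + card {t \<in> T. \<beta> t y \<in> q ` M'}"
      using finT by (intro order.trans[OF card_mono card_Un_le]) (auto simp: S_def)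
    then have TS: "card (T - S) \<le> 2 * \<theta> * card T" using x(2) y(2) by linarith
    have ST: "card (T - S) + card S = card T" "card S \<le> card T"
      using finT by (auto simp: S_def card_Diff_subset card_mono)
    have T0: "0 < card T" using finT T(2) by (simp add: card_gt_0_iff)
    \<comment> \<open>Up to \<open>2 * \<theta> * card T\<close> is lost to collisions; with
      \<open>\<theta> \<le> 1/4\<close> at least half of the tile survives.\<close>
    have "2 * \<theta> * card T \<le> 1/2 * card T" using \<theta> by (intro mult_right_mono) auto
    then have S: "card T \<le> 2 * real (card S)" using TS ST by linarith
    have "?N \<in> \<S>"
      unfolding \<S>_def
    proof (intro CollectI conjI ballI)
      show "card ?N \<le> card M + c * card X" using no ST(2) unfolding tile(2) by auto
      fix t assume t: "t \<in> D"
      have "card (leaving ?N t) \<le> card (leaving M' t) + card {s \<in> T. t \<otimes> s \<notin> T} + card (T - S)"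
        using t D tile(3)[of t] by auto
      \<comment> \<open>Origin of the 6: the new tile adds \<open>\<theta> * card T\<close> for the
        boundary of \<open>T\<close> and \<open>2 * \<theta> * card T\<close> for the collisions,
        and \<open>card T \<le> 2 * card S\<close>.\<close>
      then have "card (leaving ?N t) \<le> card (leaving M t) + 6 * \<theta> * (card M' - card M) + 3 * (\<theta> * card T)"
        using M'(4)[OF t] TD[OF t] TS by linarith
      also have "\<theta> * card T \<le> \<theta> * (2 * card S)" using \<theta> S by (intro mult_left_mono) auto
      finally show "card (leaving ?N t) \<le> card (leaving M t) + 6 * \<theta> * (card ?N - card M)"
        unfolding tile(2) using MM by (simp add: algebra_simps)
    qed (use tile(1) M'(2) in auto)
    from max[OF this] S T0 show False unfolding tile(2) by simp
  qed
  moreover have "card (leaving M' t) \<le> card (leaving M t) + 6 * \<theta> * c * card X" if "t \<in> D" for t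
  proof -
    have "6 * \<theta> * (card M' - card M) \<le> 6 * \<theta> * (c * card X)"
      using M'(3) MM \<theta> by (intro mult_left_mono) auto
    then show ?thesis using M'(4)[OF that] by (simp add: mult.assoc)
  qed
  ultimately show ?thesis using M'(1) by blast
qed

end

section \<open>Iterating the stages\<close>

text \<open>\<open>\<rho> j\<close> bounds the boundary after \<open>j\<close> stages, and
  \<open>D\<close> varies in the induction: the Folner set \<open>T\<close> of the last stage is
  chosen for \<open>D\<close>, and the earlier stages are then run for \<open>D \<union> T\<close>,
  so that what they cover is almost invariant under \<open>T\<close> when its turn comes.
  \<open>\<theta> j\<close> makes \<open>(\<rho> j + c) / \<theta> j\<close> equal to
  \<open>\<eta> / 2\<close>; the bad points take another \<open>\<eta> / 4\<close>, which leaves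
  room for the strict inequality in \<open>matching_extend\<close>.\<close>

lemma (in group) matching_of_stage:
  fixes \<eta> c :: real and \<rho> \<theta> :: "nat \<Rightarrow> real"
  assumes am: "amenable_group G" and \<eta>: "0 < \<eta>" and c: "0 < c"
    and \<rho>: "\<rho> 0 = 0" "\<And>j. \<rho> (Suc j) = \<rho> j + 6 * \<theta> j * c" and \<rho>0: "\<And>j. 0 \<le> \<rho> j"
    and \<theta>: "\<And>j. \<theta> j = 2 * (\<rho> j + c) / \<eta>" "\<forall>j<m. \<theta> j \<le> 1/4"
    and j: "j \<le> m" and D: "finite D" "D \<subseteq> carrier G"
  shows "\<exists>E n0. finite E \<and> D \<subseteq> E \<and> E \<subseteq> carrier G \<and>
    (\<forall>(X :: 'x set) (Y :: 'y set) \<alpha> \<beta> Xg Yg. approx_pair G X Y \<alpha> \<beta> E Xg Yg \<longrightarrow>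
       card (X - Xg) \<le> \<eta>/4 * card X \<longrightarrow> card (Y - Yg) \<le> \<eta>/4 * card X \<longrightarrow>
       n0 \<le> card X \<longrightarrow> 0 < card X \<longrightarrow>
       (\<exists>M. approx_pair.matching \<alpha> \<beta> E Xg Yg M \<and>
          (card M \<ge> (1 - \<eta>) * card X \<or> card M \<ge> j * c / 2 * card X) \<and>
          (\<forall>t\<in>D. card (approx_pair.leaving G M t) \<le> \<rho> j * card X)))"
  using j D
proof (induction j arbitrary: D)
  case 0
  show ?case
  proof (intro exI[of _ D] exI[of _ "0 :: nat"] conjI allI impI)
    fix X :: "'x set" and Y :: "'y set" and \<alpha> \<beta> Xg Yg
    assume "approx_pair G X Y \<alpha> \<beta> D Xg Yg"
    then interpret approx_pair G X Y \<alpha> \<beta> D Xg Yg .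
    show "\<exists>M. matching M \<and> (card M \<ge> (1 - \<eta>) * card X \<or> card M \<ge> (0::nat) * c / 2 * card X) \<and>
        (\<forall>t\<in>D. card (leaving M t) \<le> \<rho> 0 * card X)"
      by (rule exI[of _ "{}"]) (simp add: matching_empty leaving_def \<rho>(1))
  qed (use 0 in auto)
next
  case (Suc j)
  have \<theta>j: "0 < \<theta> j" "\<theta> j \<le> 1/4" using \<rho>0[of j] c \<eta> \<theta>(2)[rule_format, of j] Suc.prems(1) by (auto simp: \<theta>(1))
  obtain T where T: "finite T" "T \<noteq> {}" "T \<subseteq> carrier G"
    "\<And>k. k \<in> D \<Longrightarrow> card {t \<in> T. k \<otimes> t \<notin> T} \<le> \<theta> j * card T"
    using amenable_folner[OF am Suc.prems(2,3) \<theta>j(1)] by blast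
  have "j \<le> m" "finite (D \<union> T)" "D \<union> T \<subseteq> carrier G" using Suc.prems T by auto
  from Suc.IH[OF this] obtain E n0 where E: "finite E" "D \<union> T \<subseteq> E" "E \<subseteq> carrier G"
    and IH: "\<forall>(X :: 'x set) (Y :: 'y set) \<alpha> \<beta> Xg Yg. approx_pair G X Y \<alpha> \<beta> E Xg Yg \<longrightarrow>
       card (X - Xg) \<le> \<eta>/4 * card X \<longrightarrow> card (Y - Yg) \<le> \<eta>/4 * card X \<longrightarrow>
       n0 \<le> card X \<longrightarrow> 0 < card X \<longrightarrow>
       (\<exists>M. approx_pair.matching \<alpha> \<beta> E Xg Yg M \<and>
          (card M \<ge> (1 - \<eta>) * card X \<or> card M \<ge> j * c / 2 * card X) \<and>
          (\<forall>t\<in>D\<union>T. card (approx_pair.leaving G M t) \<le> \<rho> j * card X))"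
    by (elim exE conjE) (intro that conjI; assumption)
  show ?case
  \<comment> \<open>For \<open>card X\<close> at least \<open>2 * card T / c\<close> the slack
    \<open>card T\<close> costs at most half of the quota \<open>c\<close>, so a stage gains the
    share \<open>c / 2\<close>.\<close>
  proof (intro exI[of _ E] exI[of _ "max n0 (nat \<lceil>2 * card T / c\<rceil>)"] conjI allI impI)
    fix X :: "'x set" and Y :: "'y set" and \<alpha> \<beta> Xg Yg
    assume ap: "approx_pair G X Y \<alpha> \<beta> E Xg Yg" and
      small: "card (X - Xg) \<le> \<eta>/4 * card X" "card (Y - Yg) \<le> \<eta>/4 * card X" and
      n0: "max n0 (nat \<lceil>2 * card T / c\<rceil>) \<le> card X" and pos: "0 < card X"
    interpret approx_pair G X Y \<alpha> \<beta> E Xg Yg by (rule ap)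
    have "2 * card T / c \<le> card X" using n0 by linarith
    then have cT: "card T \<le> c / 2 * card X" using c by (simp add: field_simps)
    obtain M where M: "matching M" "card M \<ge> (1 - \<eta>) * card X \<or> card M \<ge> j * c / 2 * card X"
        "\<And>t. t \<in> D \<union> T \<Longrightarrow> card (leaving M t) \<le> \<rho> j * card X"
      using IH[rule_format, OF ap small _ pos] n0 by auto
    have ge: "0 \<le> 6 * \<theta> j * c" using \<theta>j c by simp
    show "\<exists>M. matching M \<and>
          (card M \<ge> (1 - \<eta>) * card X \<or> card M \<ge> Suc j * c / 2 * card X) \<and>
          (\<forall>t\<in>D. card (leaving M t) \<le> \<rho> (Suc j) * card X)"
    proof (cases "card M \<ge> (1 - \<eta>) * card X")
      case True
      have "card (leaving M t) \<le> \<rho> (Suc j) * card X" if "t \<in> D" for t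
        using M(3)[of t] that mult_right_mono[OF ge, of "real (card X)"] by (simp add: \<rho>(2) algebra_simps)
      then show ?thesis using M True by blast
    next
      case False
      have "(\<rho> j + c) * card X / \<theta> j = \<eta> / 2 * card X"
        using \<rho>0[of j] c \<eta> by (simp add: \<theta>(1) field_simps)
      moreover have "0 < \<eta> * card X" using \<eta> pos by simp
      ultimately have lt: "(\<rho> j + c) * card X / \<theta> j + card (X - Xg) < \<eta> * card X"
        "(\<rho> j + c) * card X / \<theta> j + card (Y - Yg) < \<eta> * card X" using small by linarith+
      obtain M' where M': "matching M'"
        "card M' \<ge> (1 - \<eta>) * card X \<or> card M' + card T \<ge> card M + c * card X"
        "\<And>t. t \<in> D \<Longrightarrow> card (leaving M' t) \<le> card (leaving M t) + 6 * \<theta> j * c * card X"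
        using matching_extend[OF M(1) _ T(2) Suc.prems(3) T(4) M(3) \<theta>j _ lt] E(2) c
        by (metis Un_iff Un_subset_iff less_imp_le)
      have "card M' \<ge> (1 - \<eta>) * card X \<or> card M' \<ge> Suc j * c / 2 * card X"
        using M'(2) M(2) False cT by (auto simp: field_simps)
      moreover have "card (leaving M' t) \<le> \<rho> (Suc j) * card X" if "t \<in> D" for t
        using M'(3)[OF that] M(3)[of t] that by (simp add: \<rho>(2) algebra_simps)
      ultimately show ?thesis using M'(1) by blast
    qed
  qed (use E in auto)
qed

lemma (in group) almost_perfect_matching:
  fixes \<eta> :: real
  assumes am: "amenable_group G" and \<eta>: "0 < \<eta>" "\<eta> \<le> 1" and D: "finite D" "D \<subseteq> carrier G"
  shows "\<exists>E n0. finite E \<and> D \<subseteq> E \<and> E \<subseteq> carrier G \<and>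
    (\<forall>(X :: 'x set) (Y :: 'y set) \<alpha> \<beta> Xg Yg. approx_pair G X Y \<alpha> \<beta> E Xg Yg \<longrightarrow>
       card (X - Xg) \<le> \<eta>/4 * card X \<longrightarrow> card (Y - Yg) \<le> \<eta>/4 * card X \<longrightarrow>
       n0 \<le> card X \<longrightarrow> 0 < card X \<longrightarrow>
       (\<exists>M. approx_pair.matching \<alpha> \<beta> E Xg Yg M \<and> card M \<ge> (1 - \<eta>) * card X \<and>
          (\<forall>t\<in>D. card (approx_pair.leaving G M t) \<le> \<eta> * card X)))"
proof -
  \<comment> \<open>Each stage adds a share of about \<open>c / 2\<close> and increases \<open>\<rho> + c\<close> by the factor \<open>1 + 12 * c / \<eta>\<close>;
    over the \<open>2 / c\<close> stages this amounts to a factor bounded independently of \<open>c\<close>.\<close>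
  define \<Lambda> where "\<Lambda> = exp (36 / \<eta>)"
  \<comment> \<open>\<open>\<rho> j + c\<close> is at most \<open>c * \<Lambda>\<close>; with
    \<open>c * \<Lambda> = \<eta> / 8\<close> this gives \<open>\<theta> j \<le> 1/4\<close> and
    \<open>\<rho> m \<le> \<eta>\<close>. The 36 in \<open>\<Lambda>\<close> is 12 times the 3 of
    \<open>m \<le> 3 / c\<close>.\<close>
  define c where "c = \<eta> / (8 * \<Lambda>)"
  define m where "m = nat \<lceil>2 / c\<rceil>"
  define \<rho> where "\<rho> j = c * (1 + 12 * c / \<eta>) ^ j - c" for j
  define \<theta> where "\<theta> j = 2 * (\<rho> j + c) / \<eta>" for j
  have \<Lambda>: "1 \<le> \<Lambda>" using \<eta> by (simp add: \<Lambda>_def)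
  have c: "0 < c" using \<eta> \<Lambda> by (simp add: c_def)
  have c1: "c \<le> 1" using \<eta> \<Lambda> by (simp add: c_def divide_le_eq)
  have c\<Lambda>: "c * \<Lambda> = \<eta> / 8" using \<Lambda> by (simp add: c_def)
  have q: "1 \<le> 1 + 12 * c / \<eta>" using c \<eta> by simp
  have m: "2 / c \<le> m" "m \<le> 3 / c"
  proof -
    show "2 / c \<le> m" unfolding m_def by linarith
    have "0 \<le> 2 / c" using c by simp
    then have "m \<le> 2 / c + 1" unfolding m_def by linarith
    moreover have "1 \<le> 1 / c" using c c1 by simp
    ultimately show "m \<le> 3 / c" by (simp add: add_divide_distrib[symmetric] field_simps)
  qed
  have pow: "(1 + 12 * c / \<eta>) ^ j \<le> \<Lambda>" if "j \<le> m" for j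
  proof -
    have "(1 + 12 * c / \<eta>) ^ j \<le> exp (12 * c / \<eta>) ^ j"
      using c \<eta> by (intro power_mono exp_ge_add_one_self) auto
    also have "\<dots> = exp (j * (12 * c / \<eta>))" by (rule exp_of_nat_mult[symmetric])
    also have "j * (12 * c / \<eta>) \<le> (3 / c) * (12 * c / \<eta>)"
      using that m(2) c \<eta> by (intro mult_right_mono) auto
    also have "\<dots> = 36 / \<eta>" using c by simp
    finally show ?thesis by (simp add: \<Lambda>_def)
  qed
  have \<theta>4: "\<forall>j<m. \<theta> j \<le> 1 / 4"
  proof (intro allI impI)
    fix j assume that: "j < m"
    have "c * (1 + 12 * c / \<eta>) ^ j \<le> \<eta> / 8"
      unfolding c\<Lambda>[symmetric] using pow[of j] that c by (intro mult_left_mono) auto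
    then show "\<theta> j \<le> 1 / 4" using \<eta> by (simp add: \<theta>_def \<rho>_def field_simps)
  qed
  have \<rho>S: "\<rho> (Suc j) = \<rho> j + 6 * \<theta> j * c" for j
    using \<eta> by (simp add: \<theta>_def \<rho>_def field_simps)
  have \<rho>0: "0 \<le> \<rho> j" for j
    using mult_left_mono[OF one_le_power[OF q, of j], of c] c by (simp add: \<rho>_def)
  have \<rho>m: "\<rho> m \<le> \<eta>"
    using mult_left_mono[OF pow[of m], of c] c c\<Lambda> \<eta> by (simp add: \<rho>_def)
  have \<rho>00: "\<rho> 0 = 0" by (simp add: \<rho>_def)
  obtain E n0 where E: "finite E \<and> D \<subseteq> E \<and> E \<subseteq> carrier G" and
    M: "\<forall>(X :: 'x set) (Y :: 'y set) \<alpha> \<beta> Xg Yg. approx_pair G X Y \<alpha> \<beta> E Xg Yg \<longrightarrow>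
       card (X - Xg) \<le> \<eta>/4 * card X \<longrightarrow> card (Y - Yg) \<le> \<eta>/4 * card X \<longrightarrow>
       n0 \<le> card X \<longrightarrow> 0 < card X \<longrightarrow>
       (\<exists>M. approx_pair.matching \<alpha> \<beta> E Xg Yg M \<and>
          (card M \<ge> (1 - \<eta>) * card X \<or> card M \<ge> m * c / 2 * card X) \<and>
          (\<forall>t\<in>D. card (approx_pair.leaving G M t) \<le> \<rho> m * card X))"
    using matching_of_stage[where 'x = 'x and 'y = 'y and m = m and j = m and \<rho> = \<rho> and \<theta> = \<theta>, OF am \<eta>(1) c \<rho>00 \<rho>S \<rho>0 \<theta>_def \<theta>4 order_refl D]
    by (elim exE conjE) (intro that conjI; assumption)
  show ?thesis
  proof (intro exI[of _ E] exI[of _ n0] conjI allI impI)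
    fix X :: "'x set" and Y :: "'y set" and \<alpha> \<beta> Xg Yg
    assume ap: "approx_pair G X Y \<alpha> \<beta> E Xg Yg" and
      prems: "card (X - Xg) \<le> \<eta>/4 * card X" "card (Y - Yg) \<le> \<eta>/4 * card X" "n0 \<le> card X" "0 < card X"
    interpret approx_pair G X Y \<alpha> \<beta> E Xg Yg by (rule ap)
    obtain M where M: "matching M" "card M \<ge> (1 - \<eta>) * card X \<or> card M \<ge> m * c / 2 * card X"
        "\<And>t. t \<in> D \<Longrightarrow> card (leaving M t) \<le> \<rho> m * card X"
      using M[rule_format, OF ap prems] by blast
    \<comment> \<open>After \<open>m\<close> stages the second alternative would cover all of
      \<open>X\<close>, hence it implies the first.\<close>
    have "1 \<le> m * c / 2" using m(1) c by (simp add: field_simps)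
    from mult_right_mono[OF this, of "real (card X)"] have "card X \<le> m * c / 2 * card X" by simp
    moreover have "0 \<le> \<eta> * card X" using \<eta> by simp
    ultimately
    have "card M \<ge> (1 - \<eta>) * card X"
      using M(2) unfolding left_diff_distrib by linarith
    moreover have "card (leaving M t) \<le> \<eta> * card X" if "t \<in> D" for t
      using M(3)[OF that] mult_right_mono[OF \<rho>m, of "real (card X)"] by linarith
    ultimately show "\<exists>M. matching M \<and> card M \<ge> (1 - \<eta>) * card X \<and>
          (\<forall>t\<in>D. card (leaving M t) \<le> \<eta> * card X)" using M(1) by blast
  qed (use E in auto)
qed

section \<open>From matchings to almost conjugacies\<close>

text \<open>\<open>u\<close> sends \<open>p a\<close> to \<open>q a\<close> and is arbitrary on the
  unmatched points, which are equally many on both sides. The label of a point is the pair of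
  centres of its tile; all unmatched points share \<open>None\<close>, hence the last clause starts
  from a matched \<open>x\<close>, and equality of labels then forces \<open>x'\<close> to be
  matched.\<close>

lemma (in approx_pair) conjugacy_of_matching:
  assumes M: "matching M" and D: "D \<subseteq> E"
  shows "\<exists>u (lab :: 'x \<Rightarrow> ('x \<times> 'y) option). bij_betw u X Y \<and>
    (\<forall>t\<in>D. card {x \<in> X. u (\<alpha> t x) \<noteq> \<beta> t (u x) \<or> lab (\<alpha> t x) \<noteq> lab x} \<le> (card X - card M) + card (leaving M t)) \<and>
    (\<forall>x\<in>p ` M. \<forall>x'\<in>X. lab x = lab x' \<longrightarrow>
       (\<exists>x0\<in>Xg. \<exists>y0\<in>Yg. \<exists>s\<in>E. \<exists>s'\<in>E. x = \<alpha> s x0 \<and> x' = \<alpha> s' x0 \<and> u x = \<beta> s y0 \<and> u x' = \<beta> s' y0))"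
proof -
  have sub: "M \<subseteq> (Xg \<times> Yg) \<times> E" and inj: "inj_on p M" "inj_on q M" using M by (auto simp: matching_def)
  have "card (X - p ` M) = card (Y - q ` M)"
    using card_p[OF M] card_q[OF M] p_image[OF M] q_image[OF M] finite_X finite_Y card_eq
    by (auto simp: card_Diff_subset finite_subset)
  then obtain v where v: "bij_betw v (X - p ` M) (Y - q ` M)"
    using finite_X finite_Y by (metis finite_Diff finite_same_card_bij)
  define r where "r = inv_into M p"
  have r: "r (p a) = a" if "a \<in> M" for a using that inj(1) by (simp add: r_def)
  have r': "r x \<in> M" "p (r x) = x" if "x \<in> p ` M" for x
    using that unfolding r_def by (auto intro: inv_into_into f_inv_into_f)
  define u where "u x = (if x \<in> p ` M then q (r x) else v x)" for x
  define lab where "lab x = (if x \<in> p ` M then Some (fst (r x)) else None)" for x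
  have uM: "u (p a) = q a" "lab (p a) = Some (fst a)" if "a \<in> M" for a
    using that r by (auto simp: u_def lab_def)
  have "bij_betw u (p ` M) (q ` M)"
    unfolding bij_betw_def using inj uM by (auto simp: inj_on_def image_image)
  moreover have "bij_betw u (X - p ` M) (Y - q ` M)"
    using v by (subst bij_betw_cong[where g = v]) (auto simp: u_def)
  ultimately have "bij_betw u (p ` M \<union> (X - p ` M)) (q ` M \<union> (Y - q ` M))"
    by (rule bij_betw_combine) auto
  moreover have "p ` M \<union> (X - p ` M) = X" "q ` M \<union> (Y - q ` M) = Y"
    using p_image[OF M] q_image[OF M] by auto
  ultimately have u: "bij_betw u X Y" by simp
  have "card {x \<in> X. u (\<alpha> t x) \<noteq> \<beta> t (u x) \<or> lab (\<alpha> t x) \<noteq> lab x} \<le> (card X - card M) + card (leaving M t)"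
    if t: "t \<in> D" for t
  proof -
    have "{x \<in> X. u (\<alpha> t x) \<noteq> \<beta> t (u x) \<or> lab (\<alpha> t x) \<noteq> lab x} \<subseteq> (X - p ` M) \<union> p ` leaving M t"
    proof (rule subsetI, rule ccontr)
      fix x assume x: "x \<in> {x \<in> X. u (\<alpha> t x) \<noteq> \<beta> t (u x) \<or> lab (\<alpha> t x) \<noteq> lab x}"
        and "x \<notin> (X - p ` M) \<union> p ` leaving M t"
      then obtain a where a: "a \<in> M" "x = p a" "a \<notin> leaving M t" by blast
      then have b: "(fst a, t \<otimes> snd a) \<in> M" by (auto simp: leaving_def)
      have "a \<in> (Xg \<times> Yg) \<times> E" "t \<in> E" using a(1) sub t D by blast+
      from p_shift[OF this] q_shift[OF this]
      have "\<alpha> t x = p (fst a, t \<otimes> snd a)" "\<beta> t (q a) = q (fst a, t \<otimes> snd a)"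
        using a(2) by simp_all
      then show False using x uM[OF a(1)] uM[OF b] a by simp
    qed
    then have "card {x \<in> X. u (\<alpha> t x) \<noteq> \<beta> t (u x) \<or> lab (\<alpha> t x) \<noteq> lab x} \<le>
        card (X - p ` M) + card (p ` leaving M t)"
      using finite_X matching_finite[OF M]
      by (intro order.trans[OF card_mono card_Un_le]) (auto simp: leaving_def)
    also have "card (p ` leaving M t) \<le> card (leaving M t)"
      using matching_finite[OF M] by (intro card_image_le) (auto simp: leaving_def)
    also have "card (X - p ` M) = card X - card M"
      using card_p[OF M] p_image[OF M] finite_X by (simp add: card_Diff_subset finite_subset)
    finally show ?thesis by simp
  qed
  moreover have "\<exists>x0\<in>Xg. \<exists>y0\<in>Yg. \<exists>s\<in>E. \<exists>s'\<in>E. x = \<alpha> s x0 \<and> x' = \<alpha> s' x0 \<and> u x = \<beta> s y0 \<and> u x' = \<beta> s' y0"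
    if x: "x \<in> p ` M" "x' \<in> X" "lab x = lab x'" for x x'
  proof -
    have "x' \<in> p ` M" using x by (auto simp: lab_def split: if_splits)
    then obtain a a' where a: "a \<in> M" "x = p a" "a' \<in> M" "x' = p a'" using x by blast
    then have f: "fst a = fst a'" using x(3) uM by auto
    obtain x0 y0 s s' where "a = ((x0, y0), s)" "a' = ((x0, y0), s')"
      using f by (metis prod.collapse)
    then show ?thesis using a uM sub
      by (intro bexI[of _ x0] bexI[of _ y0] bexI[of _ s] bexI[of _ s']) (auto simp: p_def q_def)
  qed
  ultimately show ?thesis using u by blast
qed

text \<open>\<open>R\<close> consists of the unmatched points; the factor 2 adds them to the atoms
  that \<open>t\<close> moves out of their tile. The last clause locates two points of a tile in
  \<open>X\<close> and in \<open>Y\<close> at once, so that freeness on either side can be played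
  against equal labels.\<close>

lemma (in group) almost_conjugacy:
  fixes \<eta> :: real
  assumes am: "amenable_group G" and \<eta>: "0 < \<eta>" "\<eta> \<le> 1" and D: "finite D" "D \<subseteq> carrier G"
  shows "\<exists>E n0. finite E \<and> D \<subseteq> E \<and> E \<subseteq> carrier G \<and>
    (\<forall>(X :: 'x set) (Y :: 'y set) \<alpha> \<beta> Xg Yg. approx_pair G X Y \<alpha> \<beta> E Xg Yg \<longrightarrow>
       card (X - Xg) \<le> \<eta>/4 * card X \<longrightarrow> card (Y - Yg) \<le> \<eta>/4 * card X \<longrightarrow>
       n0 \<le> card X \<longrightarrow> 0 < card X \<longrightarrow>
       (\<exists>u (lab :: 'x \<Rightarrow> ('x \<times> 'y) option) R. bij_betw u X Y \<and> R \<subseteq> X \<and> card R \<le> \<eta> * card X \<and>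
          (\<forall>t\<in>D. card {x \<in> X. u (\<alpha> t x) \<noteq> \<beta> t (u x) \<or> lab (\<alpha> t x) \<noteq> lab x} \<le> 2 * \<eta> * card X) \<and>
          (\<forall>x\<in>X - R. \<forall>x'\<in>X. lab x = lab x' \<longrightarrow>
            (\<exists>x0\<in>Xg. \<exists>y0\<in>Yg. \<exists>s\<in>E. \<exists>s'\<in>E.
               x = \<alpha> s x0 \<and> x' = \<alpha> s' x0 \<and> u x = \<beta> s y0 \<and> u x' = \<beta> s' y0))))"
proof -
  obtain E n0 where E: "finite E \<and> D \<subseteq> E \<and> E \<subseteq> carrier G" and
    M: "\<forall>(X :: 'x set) (Y :: 'y set) \<alpha> \<beta> Xg Yg. approx_pair G X Y \<alpha> \<beta> E Xg Yg \<longrightarrow>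
       card (X - Xg) \<le> \<eta>/4 * card X \<longrightarrow> card (Y - Yg) \<le> \<eta>/4 * card X \<longrightarrow>
       n0 \<le> card X \<longrightarrow> 0 < card X \<longrightarrow>
       (\<exists>M. approx_pair.matching \<alpha> \<beta> E Xg Yg M \<and> card M \<ge> (1 - \<eta>) * card X \<and>
          (\<forall>t\<in>D. card (approx_pair.leaving G M t) \<le> \<eta> * card X))"
    using almost_perfect_matching[where 'x = 'x and 'y = 'y, OF am \<eta> D]
    by (elim exE conjE) (intro that conjI; assumption)
  show ?thesis
  proof (intro exI[of _ E] exI[of _ n0] conjI allI impI)
    fix X :: "'x set" and Y :: "'y set" and \<alpha> \<beta> Xg Yg
    assume ap: "approx_pair G X Y \<alpha> \<beta> E Xg Yg" and
      prems: "card (X - Xg) \<le> \<eta>/4 * card X" "card (Y - Yg) \<le> \<eta>/4 * card X" "n0 \<le> card X" "0 < card X"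
    interpret approx_pair G X Y \<alpha> \<beta> E Xg Yg by (rule ap)
    obtain M where M: "matching M" "card M \<ge> (1 - \<eta>) * card X"
        "\<And>t. t \<in> D \<Longrightarrow> card (leaving M t) \<le> \<eta> * card X"
      using M[rule_format, OF ap prems] by blast
    have le: "card M \<le> card X" using card_p[OF M(1)] card_mono[OF finite_X p_image[OF M(1)]] by simp
    have few: "card X - card M \<le> \<eta> * card X" using M(2) le by (simp add: of_nat_diff algebra_simps)
    obtain u and lab :: "'x \<Rightarrow> ('x \<times> 'y) option" where u: "bij_betw u X Y"
      "\<forall>t\<in>D. card {x \<in> X. u (\<alpha> t x) \<noteq> \<beta> t (u x) \<or> lab (\<alpha> t x) \<noteq> lab x} \<le> (card X - card M) + card (leaving M t)"
      "\<forall>x\<in>p ` M. \<forall>x'\<in>X. lab x = lab x' \<longrightarrow>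
       (\<exists>x0\<in>Xg. \<exists>y0\<in>Yg. \<exists>s\<in>E. \<exists>s'\<in>E. x = \<alpha> s x0 \<and> x' = \<alpha> s' x0 \<and> u x = \<beta> s y0 \<and> u x' = \<beta> s' y0)"
      using conjugacy_of_matching[OF M(1) conjunct1[OF conjunct2[OF E]]]
      by (elim exE conjE) (intro that; assumption)
    have "card (X - p ` M) = card X - card M"
      using card_p[OF M(1)] p_image[OF M(1)] finite_X by (simp add: card_Diff_subset finite_subset)
    then have R: "card (X - p ` M) \<le> \<eta> * card X" using few by simp
    have 2: "card {x \<in> X. u (\<alpha> t x) \<noteq> \<beta> t (u x) \<or> lab (\<alpha> t x) \<noteq> lab x} \<le> 2 * \<eta> * card X" if "t \<in> D" for t
      using u(2)[rule_format, OF that] M(3)[OF that] few by linarith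
    show "\<exists>u (lab :: 'x \<Rightarrow> ('x \<times> 'y) option) R. bij_betw u X Y \<and> R \<subseteq> X \<and> card R \<le> \<eta> * card X \<and>
          (\<forall>t\<in>D. card {x \<in> X. u (\<alpha> t x) \<noteq> \<beta> t (u x) \<or> lab (\<alpha> t x) \<noteq> lab x} \<le> 2 * \<eta> * card X) \<and>
          (\<forall>x\<in>X - R. \<forall>x'\<in>X. lab x = lab x' \<longrightarrow>
            (\<exists>x0\<in>Xg. \<exists>y0\<in>Yg. \<exists>s\<in>E. \<exists>s'\<in>E.
               x = \<alpha> s x0 \<and> x' = \<alpha> s' x0 \<and> u x = \<beta> s y0 \<and> u x' = \<beta> s' y0))"
    proof (intro exI[of _ u] exI[of _ lab] exI[of _ "X - p ` M"] conjI ballI impI)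
      fix x x' assume "x \<in> X - (X - p ` M)" "x' \<in> X" "lab x = lab x'"
      then show "\<exists>x0\<in>Xg. \<exists>y0\<in>Yg. \<exists>s\<in>E. \<exists>s'\<in>E.
               x = \<alpha> s x0 \<and> x' = \<alpha> s' x0 \<and> u x = \<beta> s y0 \<and> u x' = \<beta> s' y0" by (intro u(3)[rule_format]) auto
    qed (use u(1) R 2 in auto)
  qed (use E in auto)
qed

subsection \<open>Words in free involutions\<close>

text \<open>
  The involution \<open>\<tau> c\<close> acts on the words of length at most \<open>L\<close> without equal neighbours by adding or
  removing the first letter \<open>c\<close>. Letting the permutations of these words act on themselves by
  left multiplication turns nontrivial words into fixed-point-free ones.
\<close>

lemma free_involutions:
  assumes C: "finite (C :: 'c set)"
  shows "\<exists>(Y :: ('c list \<Rightarrow> 'c list) set) \<pi>. finite Y \<and> Y \<noteq> {} \<and>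
    (\<forall>c\<in>C. \<forall>y\<in>Y. \<pi> c y \<in> Y \<and> \<pi> c (\<pi> c y) = y) \<and>
    (\<forall>cs y. set cs \<subseteq> C \<longrightarrow> distinct_adj cs \<longrightarrow> cs \<noteq> [] \<longrightarrow> length cs \<le> L \<longrightarrow> y \<in> Y \<longrightarrow> foldr \<pi> cs y \<noteq> y)"
proof -
  define B where "B = {w :: 'c list. set w \<subseteq> C \<and> length w \<le> L \<and> distinct_adj w}"
  \<comment> \<open>A word of full length \<open>L\<close> that does not start with \<open>c\<close>
    can be neither shortened nor extended inside \<open>B\<close>; fixing it keeps
    \<open>\<tau> c\<close> an involution.\<close>
  define \<tau> where "\<tau> c w = (if c \<notin> C \<or> w \<notin> B then w else if w \<noteq> [] \<and> hd w = c then tl w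
      else if length w < L then c # w else w)" for c w
  have finB: "finite B" unfolding B_def by (rule finite_subset[OF _ finite_lists_length_le[OF C, of L]]) auto
  have \<tau>B: "\<tau> c w \<in> B" if "w \<in> B" for c w
    using that by (cases w) (auto simp: \<tau>_def B_def distinct_adj_Cons)
  have \<tau>\<tau>: "\<tau> c (\<tau> c w) = w" for c w
    using \<tau>B[of w c] by (cases w) (auto simp: \<tau>_def B_def distinct_adj_Cons)
  have "bij (\<tau> c)" for c by (rule involuntory_imp_bij) (rule \<tau>\<tau>)
  then have perm: "\<tau> c permutes B" for c
    unfolding permutes_def by (auto simp: \<tau>_def bij_iff)
  define Y where "Y = {g. g permutes B}"
  define \<pi> where "\<pi> c g = \<tau> c \<circ> g" for c and g :: "'c list \<Rightarrow> 'c list"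
  \<comment> \<open>If \<open>g v\<close> is the empty word, each letter of a reduced
    \<open>cs\<close> is prepended without cancellation, and the bound \<open>L\<close> is never in
    the way; so the value at \<open>v\<close> spells \<open>cs\<close>, whereas \<open>g\<close>
    itself gives the empty word.\<close>
  have nil: "foldr \<pi> cs g v = cs"
    if "set cs \<subseteq> C" "distinct_adj cs" "length cs \<le> L" "g v = []" for cs g v
    using that
  proof (induction cs)
    case (Cons c cs)
    have IH: "foldr \<pi> cs g v = cs"
      by (rule Cons.IH) (use Cons.prems in \<open>auto simp: distinct_adj_Cons\<close>)
    have "foldr \<pi> (c # cs) g v = \<tau> c cs" by (simp add: \<pi>_def IH)
    moreover have "cs \<in> B" "c \<in> C" "length cs < L" "\<not> (cs \<noteq> [] \<and> hd cs = c)"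
      using Cons.prems by (auto simp: B_def distinct_adj_Cons)
    ultimately show ?case by (simp add: \<tau>_def)
  qed simp
  show ?thesis
  proof (intro exI[of _ Y] exI[of _ \<pi>] conjI ballI allI impI)
    show "finite Y" unfolding Y_def by (rule finite_permutations[OF finB])
    show "Y \<noteq> {}" by (auto simp: Y_def intro: permutes_id)
    show "\<pi> c y \<in> Y" if "y \<in> Y" for c y
      using that perm by (auto simp: Y_def \<pi>_def intro: permutes_compose)
    show "\<pi> c (\<pi> c y) = y" for c y by (rule ext) (simp add: \<pi>_def \<tau>\<tau>)
    fix cs y assume cs: "set cs \<subseteq> C" "distinct_adj cs" "cs \<noteq> []" "length cs \<le> L" and "y \<in> Y"
    then have "y (inv_into UNIV y []) = []" by (simp add: Y_def permutes_inverses)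
    with nil[of cs y "inv_into UNIV y []", OF cs(1,2,4) this] cs(3) show "foldr \<pi> cs y \<noteq> y" by metis
  qed
qed

section \<open>Words acting on a skew product\<close>

lemma foldr_mem:
  assumes "\<And>l x. l \<in> set w \<Longrightarrow> x \<in> X \<Longrightarrow> \<rho> l x \<in> X" "x \<in> X"
  shows "foldr \<rho> w x \<in> X"
  using assms by (induction w) auto

lemma bij_betw_foldr:
  assumes "\<And>l. l \<in> set w \<Longrightarrow> bij_betw (\<rho> l) X X"
  shows "bij_betw (foldr \<rho> w) X X"
  using assms
proof (induction w)
  case (Cons l w)
  then have "bij_betw (foldr \<rho> w) X X" "bij_betw (\<rho> l) X X" by simp_all
  from bij_betw_trans[OF this] show ?case by (simp add: comp_def)
qed (auto simp: bij_betw_def)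

text \<open>Words act from the right end. Tested are exactly the points to which a letter is
  applied, since it is there that the letter must change the label: the start is included, the final
  value is not.\<close>

primrec avoids :: "('l \<Rightarrow> 'x \<Rightarrow> 'x) \<Rightarrow> 'x set \<Rightarrow> 'l list \<Rightarrow> 'x \<Rightarrow> bool" where
  "avoids \<rho> R [] x \<longleftrightarrow> True"
| "avoids \<rho> R (l # w) x \<longleftrightarrow> avoids \<rho> R w x \<and> foldr \<rho> w x \<notin> R"

lemma card_not_avoids:
  assumes X: "finite X" and R: "R \<subseteq> X" and \<rho>: "\<And>l. l \<in> set w \<Longrightarrow> bij_betw (\<rho> l) X X"
  shows "card {x \<in> X. \<not> avoids \<rho> R w x} \<le> length w * card R"
  using \<rho>
proof (induction w)
  case (Cons l w)
  have bij: "bij_betw (foldr \<rho> w) X X" by (rule bij_betw_foldr) (use Cons.prems in auto)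
  have "{x \<in> X. \<not> avoids \<rho> R (l # w) x} \<subseteq> {x \<in> X. \<not> avoids \<rho> R w x} \<union> {x \<in> X. foldr \<rho> w x \<in> R}"
    by auto
  then have "card {x \<in> X. \<not> avoids \<rho> R (l # w) x} \<le>
      card {x \<in> X. \<not> avoids \<rho> R w x} + card {x \<in> X. foldr \<rho> w x \<in> R}"
    using X by (intro order.trans[OF card_mono card_Un_le]) auto
  also have "card {x \<in> X. foldr \<rho> w x \<in> R} \<le> card R"
    by (rule card_inj_on_le[where f = "foldr \<rho> w"])
       (use bij R X in \<open>auto simp: bij_betw_def intro: inj_on_subset finite_subset\<close>)
  finally show ?case using Cons by simp
qed simp

text \<open>Each letter \<open>Inr b\<close> puts two labels in front of \<open>cs\<close>: the one
  it leaves and, before it, the one it enters; letters \<open>Inl a\<close> put none. The clauses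
  about \<open>hd cs\<close> are the induction invariant: after an \<open>Inr\<close> the first
  entry is the current label, and an \<open>Inl\<close> changes the current label, so that the next
  pair can be added without equal neighbours.\<close>

lemma alternating_foldr_skew:
  fixes \<rho> :: "'a + 'b \<Rightarrow> 'x \<Rightarrow> 'x" and lab :: "'x \<Rightarrow> 'c" and act :: "'a + 'b \<Rightarrow> 'x \<times> 'y \<Rightarrow> 'x \<times> 'y"
  assumes \<pi>: "\<And>c y. c \<in> lab ` X \<Longrightarrow> y \<in> Y \<Longrightarrow> \<pi> c y \<in> Y"
    and \<rho>: "\<And>l x. l \<in> set w \<Longrightarrow> x \<in> X \<Longrightarrow> \<rho> l x \<in> X"
    and lab: "\<And>l x. l \<in> set w \<Longrightarrow> x \<in> X - R \<Longrightarrow> lab (\<rho> l x) \<noteq> lab x"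
    and actl: "\<And>a x y. x \<in> X \<Longrightarrow> y \<in> Y \<Longrightarrow> act (Inl a) (x, y) = (\<rho> (Inl a) x, y)"
    and actr: "\<And>b x y. Inr b \<in> set w \<Longrightarrow> x \<in> X \<Longrightarrow> y \<in> Y \<Longrightarrow>
      act (Inr b) (x, y) = (\<rho> (Inr b) x, \<pi> (lab (\<rho> (Inr b) x)) (\<pi> (lab x) y))"
    and alt: "distinct_adj (map isl w)" and x: "x \<in> X" and av: "avoids \<rho> R w x"
  shows "\<exists>cs. set cs \<subseteq> lab ` X \<and> distinct_adj cs \<and> length cs \<le> 2 * length w \<and>
    (\<forall>y\<in>Y. foldr act w (x, y) = (foldr \<rho> w x, foldr \<pi> cs y)) \<and>
    (w = [] \<longrightarrow> cs = []) \<and>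
    (w \<noteq> [] \<and> isl (hd w) \<longrightarrow> cs = [] \<or> hd cs \<noteq> lab (foldr \<rho> w x)) \<and>
    (w \<noteq> [] \<and> \<not> isl (hd w) \<longrightarrow> cs \<noteq> [] \<and> hd cs = lab (foldr \<rho> w x)) \<and>
    ((\<exists>l\<in>set w. \<not> isl l) \<longrightarrow> cs \<noteq> [])"
  using \<rho> lab actr alt av
proof (induction w)
  case Nil
  show ?case by (rule exI[of _ "[]"]) auto
next
  case (Cons l w)
  let ?x = "foldr \<rho> w x"
  have "\<exists>cs. set cs \<subseteq> lab ` X \<and> distinct_adj cs \<and> length cs \<le> 2 * length w \<and>
    (\<forall>y\<in>Y. foldr act w (x, y) = (foldr \<rho> w x, foldr \<pi> cs y)) \<and>
    (w = [] \<longrightarrow> cs = []) \<and>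
    (w \<noteq> [] \<and> isl (hd w) \<longrightarrow> cs = [] \<or> hd cs \<noteq> lab (foldr \<rho> w x)) \<and>
    (w \<noteq> [] \<and> \<not> isl (hd w) \<longrightarrow> cs \<noteq> [] \<and> hd cs = lab (foldr \<rho> w x)) \<and>
    ((\<exists>l\<in>set w. \<not> isl l) \<longrightarrow> cs \<noteq> [])"
    by (rule Cons.IH) (use Cons.prems in \<open>auto simp: distinct_adj_Cons\<close>)
  then obtain cs where cs: "set cs \<subseteq> lab ` X" "distinct_adj cs" "length cs \<le> 2 * length w"
    "\<And>y. y \<in> Y \<Longrightarrow> foldr act w (x, y) = (foldr \<rho> w x, foldr \<pi> cs y)" "w = [] \<Longrightarrow> cs = []"
    "w \<noteq> [] \<Longrightarrow> isl (hd w) \<Longrightarrow> cs = [] \<or> hd cs \<noteq> lab ?x"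
    "w \<noteq> [] \<Longrightarrow> \<not> isl (hd w) \<Longrightarrow> cs \<noteq> [] \<and> hd cs = lab ?x"
    "(\<exists>l\<in>set w. \<not> isl l) \<Longrightarrow> cs \<noteq> []" by metis
  have xX: "?x \<in> X" using Cons.prems(1) x by (intro foldr_mem) auto
  have lx: "\<rho> l ?x \<in> X" using Cons.prems(1)[of l] xX by simp
  have yY: "foldr \<pi> cs y \<in> Y" if "y \<in> Y" for y
    by (rule foldr_mem) (use \<pi> cs(1) that in auto)
  have ne: "lab (\<rho> l ?x) \<noteq> lab ?x" using Cons.prems(2)[of l ?x] Cons.prems(5) xX by simp
  have head: "w \<noteq> [] \<Longrightarrow> isl (hd w) \<noteq> isl l" using Cons.prems(4) by (cases w) auto
  show ?case
  proof (cases l)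
    case (Inl a)
    have "foldr act (l # w) (x, y) = (foldr \<rho> (l # w) x, foldr \<pi> cs y)" if "y \<in> Y" for y
      using cs(4)[OF that] actl[OF xX yY[OF that]] Inl by simp
    moreover have "cs = [] \<or> hd cs \<noteq> lab (foldr \<rho> (l # w) x)"
      using cs(5,7) head ne Inl by (cases "w = []") auto
    ultimately show ?thesis using cs Inl by (intro exI[of _ cs]) auto
  next
    case (Inr b)
    let ?cs = "lab (\<rho> l ?x) # lab ?x # cs"
    have "foldr act (l # w) (x, y) = (foldr \<rho> (l # w) x, foldr \<pi> ?cs y)" if "y \<in> Y" for y
      using cs(4)[OF that] Cons.prems(3)[of b, OF _ xX yY[OF that]] Inr by simp
    moreover have "cs = [] \<or> hd cs \<noteq> lab ?x"
      using cs(5,6) head Inr by (cases "w = []") auto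
    then have "distinct_adj ?cs" using cs(2) ne by (cases cs) auto
    ultimately show ?thesis using cs(1,3) Inr xX lx by (intro exI[of _ ?cs]) auto
  qed
qed

text \<open>An alternating word of length at least 2 contains a letter \<open>Inr\<close>, so the
  word \<open>cs\<close> of \<open>alternating_foldr_skew\<close> is nonempty and moves every
  \<open>y\<close>. Hence a fixed point must run into \<open>R\<close>, and as the letters permute
  \<open>X\<close>, each position of the word accounts for at most \<open>card R\<close> first
  coordinates.\<close>

lemma card_fixed_skew:
  fixes \<rho> :: "'a + 'b \<Rightarrow> 'x \<Rightarrow> 'x" and lab :: "'x \<Rightarrow> 'c" and act :: "'a + 'b \<Rightarrow> 'x \<times> 'y \<Rightarrow> 'x \<times> 'y"
  assumes X: "finite X" and Y: "finite Y" and R: "R \<subseteq> X"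
    and \<pi>: "\<And>c y. c \<in> lab ` X \<Longrightarrow> y \<in> Y \<Longrightarrow> \<pi> c y \<in> Y"
    and free: "\<And>cs y. set cs \<subseteq> lab ` X \<Longrightarrow> distinct_adj cs \<Longrightarrow> cs \<noteq> [] \<Longrightarrow> length cs \<le> 2 * length w \<Longrightarrow>
      y \<in> Y \<Longrightarrow> foldr \<pi> cs y \<noteq> y"
    and \<rho>: "\<And>l. l \<in> set w \<Longrightarrow> bij_betw (\<rho> l) X X"
    and lab: "\<And>l x. l \<in> set w \<Longrightarrow> x \<in> X - R \<Longrightarrow> lab (\<rho> l x) \<noteq> lab x"
    and actl: "\<And>a x y. x \<in> X \<Longrightarrow> y \<in> Y \<Longrightarrow> act (Inl a) (x, y) = (\<rho> (Inl a) x, y)"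
    and actr: "\<And>b x y. Inr b \<in> set w \<Longrightarrow> x \<in> X \<Longrightarrow> y \<in> Y \<Longrightarrow>
      act (Inr b) (x, y) = (\<rho> (Inr b) x, \<pi> (lab (\<rho> (Inr b) x)) (\<pi> (lab x) y))"
    and alt: "distinct_adj (map isl w)" and len: "2 \<le> length w"
  shows "card {v \<in> X \<times> Y. foldr act w v = v} \<le> length w * card R * card Y"
proof -
  obtain l l' w' where w: "w = l # l' # w'" using len by (metis One_nat_def Suc_1 Suc_le_length_iff)
  then have inr: "\<exists>l\<in>set w. \<not> isl l" using alt by auto
  have \<rho>X: "\<rho> l x \<in> X" if "l \<in> set w" "x \<in> X" for l x using bij_betw_apply[OF \<rho>] that by blast
  have "{v \<in> X \<times> Y. foldr act w v = v} \<subseteq> {x \<in> X. \<not> avoids \<rho> R w x} \<times> Y"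
  proof
    fix v assume "v \<in> {v \<in> X \<times> Y. foldr act w v = v}"
    then obtain x y where xy: "v = (x, y)" and v: "x \<in> X" "y \<in> Y" "foldr act w (x, y) = (x, y)"
      by (cases v) auto
    have "\<not> avoids \<rho> R w x"
    proof
      assume "avoids \<rho> R w x"
      from alternating_foldr_skew[where act = act and \<pi> = \<pi>, OF \<pi> \<rho>X lab actl actr alt v(1) this] inr
      obtain cs where cs: "set cs \<subseteq> lab ` X" "distinct_adj cs" "cs \<noteq> []" "length cs \<le> 2 * length w"
        "foldr act w (x, y) = (foldr \<rho> w x, foldr \<pi> cs y)" using v(2) by blast
      then have "foldr \<pi> cs y = y" using v(3) by simp
      then show False using free[OF cs(1-4) v(2)] by simp
    qed
    then show "v \<in> {x \<in> X. \<not> avoids \<rho> R w x} \<times> Y" using v xy by simp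
  qed
  then have "card {v \<in> X \<times> Y. foldr act w v = v} \<le> card ({x \<in> X. \<not> avoids \<rho> R w x} \<times> Y)"
    using X Y by (intro card_mono) auto
  also have "\<dots> \<le> length w * card R * card Y"
    using card_not_avoids[of X R w \<rho>, OF X R \<rho>] by (simp add: card_cartesian_product)
  finally show ?thesis .
qed

subsection \<open>Finite approximations of sofic groups\<close>

text \<open>For finite \<open>E\<close> this splits freeness into finitely many conditions, each of
  which a sofic approximation violates at few points. That \<open>\<alpha> \<one>\<close> fixes
  \<open>x\<close> follows because it is injective and idempotent at \<open>x\<close>; then
  \<open>\<alpha> g x = \<alpha> h x\<close> would make \<open>inv g \<otimes> h\<close> fix
  \<open>x\<close>.\<close>

lemma (in group) acts_freely_at_of_mult:
  assumes \<alpha>: "\<And>g. g \<in> carrier G \<Longrightarrow> bij_betw (\<alpha> g) X X" and x: "x \<in> X" and E: "E \<subseteq> carrier G"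
    and mult: "\<And>g h. g \<in> insert \<one> (E \<union> m_inv G ` E) \<Longrightarrow> h \<in> insert \<one> (E \<union> m_inv G ` E) \<Longrightarrow>
      \<alpha> (g \<otimes> h) x = \<alpha> g (\<alpha> h x)"
    and free: "\<And>g h. g \<in> E \<Longrightarrow> h \<in> E \<Longrightarrow> g \<noteq> h \<Longrightarrow> \<alpha> (inv g \<otimes> h) x \<noteq> x"
  shows "acts_freely_at G \<alpha> E x"
  unfolding acts_freely_at_def
proof (intro ballI conjI impI)
  fix g h assume gh: "g \<in> E" "h \<in> E"
  then show "\<alpha> g (\<alpha> h x) = \<alpha> (g \<otimes> h) x" using mult by simp
  have "\<alpha> \<one> (\<alpha> \<one> x) = \<alpha> \<one> x" using mult[of \<one> \<one>] by simp
  moreover have "\<alpha> \<one> x \<in> X" using \<alpha>[of \<one>] x bij_betw_apply by fastforce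
  ultimately have one: "\<alpha> \<one> x = x" using \<alpha>[of \<one>] x unfolding bij_betw_def inj_on_def by auto
  assume "g \<noteq> h"
  show "\<alpha> g x \<noteq> \<alpha> h x"
  proof
    assume "\<alpha> g x = \<alpha> h x"
    then have "\<alpha> (inv g \<otimes> h) x = \<alpha> (inv g \<otimes> g) x" using mult[of "inv g" h] mult[of "inv g" g] gh by auto
    also have "\<dots> = x" using gh E one by (auto simp: l_inv)
    finally show False using free[OF gh \<open>g \<noteq> h\<close>] by simp
  qed
qed

text \<open>Choice of representatives: the 2-distance of permutation matrices measures how often
  they differ and the trace counts fixed points, so the homomorphism and the trace condition become
  limits of proportions.\<close>

lemma sofic_permutations:
  fixes G :: "('a, 'm) monoid_scheme"
  assumes \<omega>: "free_ultrafilter \<omega>" and G: "sofic_group \<omega> G"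
  shows "\<exists>(n :: nat \<Rightarrow> nat) (s :: 'a \<Rightarrow> nat \<Rightarrow> nat \<Rightarrow> nat). (\<forall>k. 0 < n k) \<and> (\<forall>g\<in>carrier G. \<forall>k. s g k permutes {..<n k}) \<and>
    (\<forall>g\<in>carrier G. \<forall>h\<in>carrier G.
       ((\<lambda>k. card {x. x < n k \<and> s (g \<otimes>\<^bsub>G\<^esub> h) k x \<noteq> s g k (s h k x)} / n k) \<longlongrightarrow> 0) \<omega>) \<and>
    (\<forall>g\<in>carrier G. g \<noteq> \<one>\<^bsub>G\<^esub> \<longrightarrow> ((\<lambda>k. card {x. x < n k \<and> s g k x = x} / n k) \<longlongrightarrow> 0) \<omega>)"
proof -
  obtain n \<Theta> where n: "\<And>k. 0 < n k" and \<Theta>: "\<Theta> \<in> hom G (perm_ultraproduct \<omega> n)"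
    and tr: "\<And>g. g \<in> carrier G \<Longrightarrow> g \<noteq> \<one>\<^bsub>G\<^esub> \<Longrightarrow> ultra_trace \<omega> (\<Theta> g) = 0"
    using G unfolding sofic_group_def by blast
  have group: "group G" using G by (simp add: sofic_group_def)
  let ?R = "ultra_rel \<omega> n"
  have "\<exists>\<sigma>. (\<forall>k. \<sigma> k permutes {..<n k}) \<and> \<Theta> g = ?R `` {\<lambda>k. perm_matrix (n k) (\<sigma> k)}"
    if "g \<in> carrier G" for g
  proof -
    have "\<Theta> g \<in> perm_seqs n // ?R" using hom_in_carrier[OF \<Theta> that] by (simp add: perm_ultraproduct_def)
    then show ?thesis by (elim quotientE) (auto simp: perm_seqs_iff)
  qed
  then obtain s where s: "\<And>g k. g \<in> carrier G \<Longrightarrow> s g k permutes {..<n k}"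
    and \<Theta>s: "\<And>g. g \<in> carrier G \<Longrightarrow> \<Theta> g = ?R `` {\<lambda>k. perm_matrix (n k) (s g k)}"
    by metis
  have seq: "(\<lambda>k. perm_matrix (n k) (s g k)) \<in> perm_seqs n" if "g \<in> carrier G" for g
    using s[OF that] by (auto simp: perm_seqs_def perm_matrices_def)
  show ?thesis
  proof (intro exI[of _ n] exI[of _ s] conjI ballI allI impI n s)
    fix g h assume g: "g \<in> carrier G" and h: "h \<in> carrier G"
    have gh: "g \<otimes>\<^bsub>G\<^esub> h \<in> carrier G" using g h group by (simp add: group.is_monoid monoid.m_closed)
    have mem: "(\<lambda>k. perm_matrix (n k) (s g k \<circ> s h k)) \<in> perm_seqs n"
      using permutes_compose[OF s[OF h] s[OF g]] by (auto simp: perm_seqs_def perm_matrices_def)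
    have "?R `` {\<lambda>k. perm_matrix (n k) (s (g \<otimes>\<^bsub>G\<^esub> h) k)} = \<Theta> g \<otimes>\<^bsub>perm_ultraproduct \<omega> n\<^esub> \<Theta> h"
      using hom_mult[OF \<Theta> g h] \<Theta>s[OF gh] by simp
    also have "\<dots> = ?R `` {\<lambda>k. perm_matrix (n k) (s g k) * perm_matrix (n k) (s h k)}"
      unfolding perm_ultraproduct_def monoid.simps \<Theta>s[OF g] \<Theta>s[OF h]
      by (rule quotient_mult[OF equiv_ultra_rel ultra_rel_mult seq[OF g] seq[OF h]])
    also have "(\<lambda>k. perm_matrix (n k) (s g k) * perm_matrix (n k) (s h k)) =
        (\<lambda>k. perm_matrix (n k) (s g k \<circ> s h k))"
      using perm_matrix_mult[OF s[OF h]] by (rule ext)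
    finally have "((\<lambda>k. perm_matrix (n k) (s (g \<otimes>\<^bsub>G\<^esub> h) k)), (\<lambda>k. perm_matrix (n k) (s g k \<circ> s h k))) \<in> ?R"
      using eq_equiv_class[OF _ equiv_ultra_rel mem] by blast
    then show "((\<lambda>k. card {x. x < n k \<and> s (g \<otimes>\<^bsub>G\<^esub> h) k x \<noteq> s g k (s h k x)} / n k) \<longlongrightarrow> 0) \<omega>"
      using ultra_rel_iff[of "\<lambda>k. s (g \<otimes>\<^bsub>G\<^esub> h) k" n "\<lambda>k. s g k \<circ> s h k" \<omega>] s[OF gh] s[OF g] s[OF h]
      by (simp add: permutes_compose)
  next
    fix g assume g: "g \<in> carrier G" "g \<noteq> \<one>\<^bsub>G\<^esub>"
    have "(\<lambda>k. perm_matrix (n k) (s g k)) \<in> \<Theta> g"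
      unfolding \<Theta>s[OF g(1)] using equiv_class_self[OF equiv_ultra_rel seq[OF g(1)]] .
    from ultra_trace_eq[OF \<omega> n hom_in_carrier[OF \<Theta> g(1)] this]
    have "((\<lambda>k. complex_of_real (card {x. x < n k \<and> s g k x = x} / n k)) \<longlongrightarrow> complex_of_real 0) \<omega>"
      unfolding tr[OF g] ntrace_perm_matrix[OF s[OF g(1)]] of_real_0 .
    then show "((\<lambda>k. card {x. x < n k \<and> s g k x = x} / n k) \<longlongrightarrow> 0) \<omega>"
      unfolding tendsto_of_real_iff .
  qed
qed

text \<open>For finite \<open>E\<close> only finitely many proportions matter; their sum tends to 0
  along \<omega>, so it is below \<epsilon> at some index, and that single index is the
  approximation.\<close>

lemma sofic_approx:
  fixes \<epsilon> :: real and G :: "('a, 'm) monoid_scheme"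
  assumes \<omega>: "free_ultrafilter \<omega>" and G: "sofic_group \<omega> G" and E: "finite E" "E \<subseteq> carrier G" and \<epsilon>: "0 < \<epsilon>"
  shows "\<exists>(n :: nat) (\<sigma> :: 'a \<Rightarrow> nat \<Rightarrow> nat). 0 < n \<and> (\<forall>g\<in>carrier G. \<sigma> g permutes {..<n}) \<and>
    card {x \<in> {..<n}. \<not> acts_freely_at G \<sigma> E x} \<le> \<epsilon> * n"
proof -
  interpret group G using G by (simp add: sofic_group_def)
  obtain n :: "nat \<Rightarrow> nat" and s :: "'a \<Rightarrow> nat \<Rightarrow> nat \<Rightarrow> nat" where ns: "(\<forall>k. 0 < n k) \<and> (\<forall>g\<in>carrier G. \<forall>k. s g k permutes {..<n k}) \<and>
    (\<forall>g\<in>carrier G. \<forall>h\<in>carrier G.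
       ((\<lambda>k. card {x. x < n k \<and> s (g \<otimes>\<^bsub>G\<^esub> h) k x \<noteq> s g k (s h k x)} / n k) \<longlongrightarrow> 0) \<omega>) \<and>
    (\<forall>g\<in>carrier G. g \<noteq> \<one>\<^bsub>G\<^esub> \<longrightarrow> ((\<lambda>k. card {x. x < n k \<and> s g k x = x} / n k) \<longlongrightarrow> 0) \<omega>)"
    using sofic_permutations[OF \<omega> G] by blast
  then have n: "\<And>k. 0 < n k" and s: "\<And>g k. g \<in> carrier G \<Longrightarrow> s g k permutes {..<n k}" by auto
  have mult: "((\<lambda>k. card {x. x < n k \<and> s (g \<otimes>\<^bsub>G\<^esub> h) k x \<noteq> s g k (s h k x)} / n k) \<longlongrightarrow> 0) \<omega>"
    if "g \<in> carrier G" "h \<in> carrier G" for g h using ns that by blast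
  have free: "((\<lambda>k. card {x. x < n k \<and> s g k x = x} / n k) \<longlongrightarrow> 0) \<omega>"
    if "g \<in> carrier G" "g \<noteq> \<one>\<^bsub>G\<^esub>" for g using ns that by blast
  define E' where "E' = insert \<one>\<^bsub>G\<^esub> (E \<union> m_inv G ` E)"
  have E': "finite E'" "E' \<subseteq> carrier G" using E by (auto simp: E'_def)
  define P where "P = E' \<times> E'"
  define Q where "Q = {(g, h) \<in> E \<times> E. g \<noteq> h}"
  define A where "A k = (\<lambda>(g, h). {x. x < n k \<and> s (g \<otimes>\<^bsub>G\<^esub> h) k x \<noteq> s g k (s h k x)})" for k
  define B where "B k = (\<lambda>(g, h). {x. x < n k \<and> s (inv\<^bsub>G\<^esub> g \<otimes>\<^bsub>G\<^esub> h) k x = x})" for k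
  have fin: "finite P" "finite Q" using E E' unfolding P_def Q_def
    by (auto intro: finite_subset[of _ "E \<times> E"])
  have "((\<lambda>k. (\<Sum>i\<in>P. card (A k i) / n k) + (\<Sum>i\<in>Q. card (B k i) / n k)) \<longlongrightarrow> 0 + 0) \<omega>"
  proof (intro tendsto_add tendsto_null_sum)
    fix i assume "i \<in> P"
    then show "((\<lambda>k. card (A k i) / n k) \<longlongrightarrow> 0) \<omega>"
      using mult[of "fst i" "snd i"] E' by (auto simp: P_def A_def subset_iff)
  next
    fix i assume "i \<in> Q"
    then obtain g h where i: "i = (g, h)" "g \<in> carrier G" "h \<in> carrier G" "g \<noteq> h" using E by (auto simp: Q_def)
    then have "inv\<^bsub>G\<^esub> g \<otimes>\<^bsub>G\<^esub> h \<noteq> \<one>\<^bsub>G\<^esub>" using inv_equality by (metis inv_closed inv_inv)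
    then show "((\<lambda>k. card (B k i) / n k) \<longlongrightarrow> 0) \<omega>"
      using free[of "inv\<^bsub>G\<^esub> g \<otimes>\<^bsub>G\<^esub> h"] i by (simp add: B_def)
  qed
  then have "eventually (\<lambda>k. (\<Sum>i\<in>P. card (A k i) / n k) + (\<Sum>i\<in>Q. card (B k i) / n k) < \<epsilon>) \<omega>"
    using order_tendstoD(2) \<epsilon> by fastforce
  moreover have "\<omega> \<noteq> bot" using \<omega> by (simp add: free_ultrafilter_def)
  ultimately obtain k where k: "(\<Sum>i\<in>P. card (A k i) / n k) + (\<Sum>i\<in>Q. card (B k i) / n k) < \<epsilon>"
    using eventually_happens' by blast
  define \<sigma> where "\<sigma> g = s g k" for g
  have bij: "bij_betw (\<sigma> g) {..<n k} {..<n k}" if "g \<in> carrier G" for g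
    using s[OF that] unfolding \<sigma>_def by (rule permutes_imp_bij)
  have "{x \<in> {..<n k}. \<not> acts_freely_at G \<sigma> E x} \<subseteq> (\<Union>i\<in>P. A k i) \<union> (\<Union>i\<in>Q. B k i)"
  proof (rule subsetI, rule ccontr)
    fix x assume x: "x \<in> {x \<in> {..<n k}. \<not> acts_freely_at G \<sigma> E x}"
      and no: "x \<notin> (\<Union>i\<in>P. A k i) \<union> (\<Union>i\<in>Q. B k i)"
    have "acts_freely_at G \<sigma> E x"
    proof (rule acts_freely_at_of_mult[OF bij _ E(2)])
      fix g h assume "g \<in> insert \<one>\<^bsub>G\<^esub> (E \<union> m_inv G ` E)" "h \<in> insert \<one>\<^bsub>G\<^esub> (E \<union> m_inv G ` E)"
      then have "(g, h) \<in> P" unfolding P_def E'_def by blast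
      then show "\<sigma> (g \<otimes>\<^bsub>G\<^esub> h) x = \<sigma> g (\<sigma> h x)" using x no by (auto simp: A_def \<sigma>_def)
    next
      fix g h assume "g \<in> E" "h \<in> E" "g \<noteq> h"
      then have "(g, h) \<in> Q" by (simp add: Q_def)
      then show "\<sigma> (inv\<^bsub>G\<^esub> g \<otimes>\<^bsub>G\<^esub> h) x \<noteq> x" using x no by (auto simp: B_def \<sigma>_def)
    qed (use x in auto)
    then show False using x by simp
  qed
  moreover have "finite ((\<Union>i\<in>P. A k i) \<union> (\<Union>i\<in>Q. B k i))"
    using fin by (auto simp: A_def B_def)
  ultimately have "card {x \<in> {..<n k}. \<not> acts_freely_at G \<sigma> E x} \<le> card ((\<Union>i\<in>P. A k i) \<union> (\<Union>i\<in>Q. B k i))"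
    by (rule card_mono[rotated])
  also have "\<dots> \<le> (\<Sum>i\<in>P. card (A k i)) + (\<Sum>i\<in>Q. card (B k i))"
    by (intro order.trans[OF card_Un_le] add_mono card_UN_le fin)
  finally have "real (card {x \<in> {..<n k}. \<not> acts_freely_at G \<sigma> E x}) \<le> (\<Sum>i\<in>P. card (A k i)) + (\<Sum>i\<in>Q. card (B k i))"
    by linarith
  also have "\<dots> = ((\<Sum>i\<in>P. card (A k i) / n k) + (\<Sum>i\<in>Q. card (B k i) / n k)) * n k"
    using n[of k] by (simp add: sum_divide_distrib[symmetric] field_simps)
  also have "\<dots> \<le> \<epsilon> * n k" using k by (intro mult_right_mono) auto
  finally show ?thesis using n s by (intro exI[of _ "n k"] exI[of _ \<sigma>]) (auto simp: \<sigma>_def)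
qed

section \<open>Freeness under conjugation, under restriction and outside the subgroup\<close>

lemma acts_freely_at_conj:
  fixes \<tau> :: "'g \<Rightarrow> 'v \<Rightarrow> 'v" and \<tau>' :: "'g \<Rightarrow> 'w \<Rightarrow> 'w"
  assumes G: "group G" and F: "F \<subseteq> carrier G" and v: "v \<in> V"
    and V: "\<And>g v. g \<in> carrier G \<Longrightarrow> v \<in> V \<Longrightarrow> \<tau> g v \<in> V" and inj: "inj_on \<Psi> V"
    and conj: "\<And>g v. g \<in> carrier G \<Longrightarrow> v \<in> V \<Longrightarrow> \<tau>' g (\<Psi> v) = \<Psi> (\<tau> g v)"
  shows "acts_freely_at G \<tau>' F (\<Psi> v) \<longleftrightarrow> acts_freely_at G \<tau> F v"
proof -
  interpret group G by (rule G)
  have "\<tau>' g (\<tau>' h (\<Psi> v)) = \<tau>' (g \<otimes>\<^bsub>G\<^esub> h) (\<Psi> v) \<longleftrightarrow> \<tau> g (\<tau> h v) = \<tau> (g \<otimes>\<^bsub>G\<^esub> h) v"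
    "\<tau>' g (\<Psi> v) = \<tau>' h (\<Psi> v) \<longleftrightarrow> \<tau> g v = \<tau> h v" if "g \<in> F" "h \<in> F" for g h
    using that F v V inj_on_eq_iff[OF inj] by (auto simp: conj subset_iff)
  then show ?thesis unfolding acts_freely_at_def by blast
qed

lemma acts_freely_at_not_fixed:
  assumes G: "group G" and \<rho>: "bij_betw (\<rho> \<one>\<^bsub>G\<^esub>) X X" and x: "x \<in> X" "acts_freely_at G \<rho> F x"
    and F: "\<one>\<^bsub>G\<^esub> \<in> F" "g \<in> F" "g \<noteq> \<one>\<^bsub>G\<^esub>"
  shows "\<rho> g x \<noteq> x"
proof -
  interpret group G by (rule G)
  have "\<rho> \<one>\<^bsub>G\<^esub> (\<rho> \<one>\<^bsub>G\<^esub> x) = \<rho> \<one>\<^bsub>G\<^esub> x" "\<rho> g x \<noteq> \<rho> \<one>\<^bsub>G\<^esub> x"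
    using x(2) F by (auto simp: acts_freely_at_def)
  moreover have "\<rho> \<one>\<^bsub>G\<^esub> x \<in> X" using bij_betw_apply[OF \<rho> x(1)] .
  ultimately show ?thesis using \<rho> x(1) by (metis bij_betw_inv_into_left)
qed

lemma acts_freely_at_pullback:
  assumes f: "f \<in> mon H G" and E: "E \<subseteq> carrier H" "f ` E \<subseteq> E1" and x: "acts_freely_at G \<rho> E1 x"
  shows "acts_freely_at H (\<lambda>h. \<rho> (f h)) E x"
  unfolding acts_freely_at_def
proof (intro ballI conjI impI)
  fix g h assume gh: "g \<in> E" "h \<in> E"
  then have fgh: "f g \<in> E1" "f h \<in> E1" "f (g \<otimes>\<^bsub>H\<^esub> h) = f g \<otimes>\<^bsub>G\<^esub> f h"
    using E f hom_mult[of f H G g h] by (auto simp: mon_def)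
  then show "\<rho> (f g) (\<rho> (f h) x) = \<rho> (f (g \<otimes>\<^bsub>H\<^esub> h)) x" using x by (simp add: acts_freely_at_def)
  assume "g \<noteq> h"
  then have "f g \<noteq> f h" using f gh E(1) by (auto simp: mon_def inj_on_def)
  then show "\<rho> (f g) x \<noteq> \<rho> (f h) x" using x fgh by (auto simp: acts_freely_at_def)
qed

text \<open>The reason why elements outside \<open>H\<close> leave their tile:
  \<open>\<rho> (f s) x\<close> and \<open>\<rho> (f s') x\<close> are two points of a tile with
  centre \<open>x\<close>, and freeness at the centre would turn a move by \<open>g\<close> from one
  to the other into the equation \<open>g \<otimes> f s = f s'\<close>, placing \<open>g\<close> in
  the image of \<open>H\<close>.\<close>

lemma acts_freely_at_off_subgroup:
  assumes G: "group G" and H: "group H" and f: "f \<in> mon H G" and x: "acts_freely_at G \<rho> E1 x"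
    and g: "g \<in> carrier G" "g \<notin> f ` carrier H" "g \<in> E1"
    and s: "s \<in> carrier H" "s' \<in> carrier H" "f s \<in> E1" "f s' \<in> E1" "g \<otimes>\<^bsub>G\<^esub> f s \<in> E1"
  shows "\<rho> g (\<rho> (f s) x) \<noteq> \<rho> (f s') x"
proof -
  interpret G: group G by (rule G)
  interpret H: group H by (rule H)
  have hom: "f \<in> hom H G" using f by (simp add: mon_def)
  then interpret f: group_hom H G f by unfold_locales
  have "g \<otimes>\<^bsub>G\<^esub> f s \<noteq> f s'"
  proof
    assume "g \<otimes>\<^bsub>G\<^esub> f s = f s'"
    then have "g = f s' \<otimes>\<^bsub>G\<^esub> inv\<^bsub>G\<^esub> f s" using g(1) s(1) by (metis G.inv_solve_right f.hom_closed s(2))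
    also have "\<dots> = f (s' \<otimes>\<^bsub>H\<^esub> inv\<^bsub>H\<^esub> s)" using s by simp
    finally show False using g(2) s by (metis H.inv_closed H.m_closed image_eqI)
  qed
  then have "\<rho> (g \<otimes>\<^bsub>G\<^esub> f s) x \<noteq> \<rho> (f s') x" using x s by (auto simp: acts_freely_at_def)
  then show ?thesis using x g(3) s(3) by (auto simp: acts_freely_at_def)
qed

subsection \<open>Finite models of the amalgamated product\<close>

lemma card_conj:
  assumes "bij_betw \<Psi> V W" and "\<And>v. v \<in> V \<Longrightarrow> P' (\<Psi> v) \<longleftrightarrow> P v"
  shows "card {w \<in> W. P' w} = card {v \<in> V. P v}"
proof -
  have "bij_betw \<Psi> {v \<in> V. P v} {w \<in> W. P' w}"
    using assms unfolding bij_betw_def by (auto intro: inj_on_subset)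
  then show ?thesis by (rule bij_betw_same_card[symmetric])
qed

text \<open>Freeness on \<open>F1\<close> and \<open>F2\<close> yields the homomorphisms on the two
  factors, agreement on \<open>D\<close> the amalgamation, and the last clause the vanishing trace.
  Words of one letter are left to freeness.\<close>

definition amalg_model ::
  "('a, 'm) monoid_scheme \<Rightarrow> ('b, 'n) monoid_scheme \<Rightarrow> ('c, 'l) monoid_scheme \<Rightarrow> ('c \<Rightarrow> 'a) \<Rightarrow> ('c \<Rightarrow> 'b) \<Rightarrow>
   'a set \<Rightarrow> 'b set \<Rightarrow> 'c set \<Rightarrow> nat \<Rightarrow> real \<Rightarrow> 'v set \<Rightarrow> ('a \<Rightarrow> 'v \<Rightarrow> 'v) \<Rightarrow> ('b \<Rightarrow> 'v \<Rightarrow> 'v) \<Rightarrow> bool" where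
  "amalg_model G1 G2 H f1 f2 F1 F2 D L \<epsilon> V \<tau>1 \<tau>2 \<longleftrightarrow>
     finite V \<and> V \<noteq> {} \<and>
     (\<forall>g\<in>carrier G1. bij_betw (\<tau>1 g) V V) \<and> (\<forall>g\<in>carrier G2. bij_betw (\<tau>2 g) V V) \<and>
     real (card {v \<in> V. \<not> acts_freely_at G1 \<tau>1 F1 v}) \<le> \<epsilon> * real (card V) \<and>
     real (card {v \<in> V. \<not> acts_freely_at G2 \<tau>2 F2 v}) \<le> \<epsilon> * real (card V) \<and>
     (\<forall>h\<in>D. real (card {v \<in> V. \<tau>1 (f1 h) v \<noteq> \<tau>2 (f2 h) v}) \<le> \<epsilon> * real (card V)) \<and>
     (\<forall>w. set w \<subseteq> (F1 - f1 ` carrier H) <+> (F2 - f2 ` carrier H) \<longrightarrow> distinct_adj (map isl w) \<longrightarrow>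
        2 \<le> length w \<longrightarrow> length w \<le> L \<longrightarrow> real (card {v \<in> V. foldr (case_sum \<tau>1 \<tau>2) w v = v}) \<le> \<epsilon> * real (card V))"

lemma amalg_model_bij:
  assumes "amalg_model G1 G2 H f1 f2 F1 F2 D L \<epsilon> V \<tau>1 \<tau>2"
  shows "g \<in> carrier G1 \<Longrightarrow> bij_betw (\<tau>1 g) V V" and "h \<in> carrier G2 \<Longrightarrow> bij_betw (\<tau>2 h) V V"
  using assms by (simp_all add: amalg_model_def)

lemma amalg_model_fixed:
  fixes \<epsilon> :: real
  assumes "amalg_model G1 G2 H f1 f2 F1 F2 D L \<epsilon> V \<tau>1 \<tau>2"
    and "set w \<subseteq> (F1 - f1 ` carrier H) <+> (F2 - f2 ` carrier H)" "distinct_adj (map isl w)"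
      "2 \<le> length w" "length w \<le> L"
  shows "card {v \<in> V. foldr (case_sum \<tau>1 \<tau>2) w v = v} \<le> \<epsilon> * card V"
  using assms by (simp add: amalg_model_def)

lemma bij_betw_finite_conj:
  assumes V: "finite V" and \<tau>: "\<And>v. v \<in> V \<Longrightarrow> \<tau> v \<in> V" and \<Psi>: "inj_on \<Psi> V" "\<Psi> ` V \<subseteq> W"
    and conj: "\<And>v. v \<in> V \<Longrightarrow> \<Psi> (\<tau> v) = \<kappa> (\<Psi> v)" and \<kappa>: "inj_on \<kappa> W"
  shows "bij_betw \<tau> V V"
proof -
  have "inj_on \<tau> V"
  proof (rule inj_onI)
    fix v w assume "v \<in> V" "w \<in> V" "\<tau> v = \<tau> w"
    then have "\<kappa> (\<Psi> v) = \<kappa> (\<Psi> w)" using conj by metis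
    then show "v = w" using \<Psi> \<kappa> \<open>v \<in> V\<close> \<open>w \<in> V\<close> by (metis image_subset_iff inj_on_eq_iff)
  qed
  moreover from this have "\<tau> ` V = V" using V \<tau> by (intro endo_inj_surj) auto
  ultimately show ?thesis by (simp add: bij_betw_def)
qed

lemma acts_freely_at_fst:
  "acts_freely_at G (\<lambda>g (x, y). (\<rho> g x, y)) F (x, y) \<longleftrightarrow> acts_freely_at G \<rho> F x"
  by (simp add: acts_freely_at_def)

lemma card_Times_fst: "card {v \<in> X \<times> Y. P (fst v)} = card {x \<in> X. P x} * card Y"
proof -
  have "{v \<in> X \<times> Y. P (fst v)} = {x \<in> X. P x} \<times> Y" by auto
  then show ?thesis by (simp add: card_cartesian_product)
qed

lemma card_Times_fst_le:
  fixes \<epsilon> :: real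
  assumes "card {x \<in> X. P x} \<le> \<epsilon> * card X" and "finite Y"
    and "\<And>x y. x \<in> X \<Longrightarrow> y \<in> Y \<Longrightarrow> Q (x, y) \<Longrightarrow> P x" and "finite X"
  shows "card {v \<in> X \<times> Y. Q v} \<le> \<epsilon> * card (X \<times> Y)"
proof -
  have "card {v \<in> X \<times> Y. Q v} \<le> card {v \<in> X \<times> Y. P (fst v)}"
    using assms by (intro card_mono) auto
  then have "real (card {v \<in> X \<times> Y. Q v}) \<le> card {x \<in> X. P x} * real (card Y)"
    unfolding card_Times_fst by (metis of_nat_le_iff of_nat_mult)
  also have "\<dots> \<le> \<epsilon> * card X * card Y" using assms(1) by (intro mult_right_mono) auto
  finally show ?thesis by (simp add: card_cartesian_product)
qed

text \<open>\<open>\<tau>2\<close> is the untwisted action \<open>\<kappa>\<close> on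
  \<open>Z \<times> Y\<close> conjugated by \<open>\<Psi>\<close>, so it inherits bijectivity and
  freeness from \<open>\<rho>2\<close>; the inverse of \<open>\<pi> (lab x)\<close> is
  \<open>\<pi> (lab x)\<close> itself. At points where an element of \<open>D\<close> keeps the
  label, both factors of the twist coincide and cancel, so agreement of the base actions carries
  over to the product.\<close>

lemma amalg_model_skew:
  fixes \<epsilon> :: real and u :: "'x \<Rightarrow> 'z" and lab :: "'x \<Rightarrow> 'k"
  assumes G: "group G1" "group G2" and F: "F1 \<subseteq> carrier G1" "F2 \<subseteq> carrier G2"
    and f: "f1 ` D \<subseteq> carrier G1" "f2 ` D \<subseteq> carrier G2"
    and X: "finite X" "X \<noteq> {}" and u: "bij_betw u X Z"
    and \<rho>1: "\<And>g. g \<in> carrier G1 \<Longrightarrow> bij_betw (\<rho>1 g) X X"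
    and \<rho>2: "\<And>g. g \<in> carrier G2 \<Longrightarrow> bij_betw (\<rho>2 g) Z Z"
    and free1: "card {x \<in> X. \<not> acts_freely_at G1 \<rho>1 F1 x} \<le> \<epsilon> * card X"
    and free2: "card {z \<in> Z. \<not> acts_freely_at G2 \<rho>2 F2 z} \<le> \<epsilon> * card Z"
    and D: "\<And>h. h \<in> D \<Longrightarrow>
      card {x \<in> X. u (\<rho>1 (f1 h) x) \<noteq> \<rho>2 (f2 h) (u x) \<or> lab (\<rho>1 (f1 h) x) \<noteq> lab x} \<le> \<epsilon> * card X"
    and R: "R \<subseteq> X" "L * card R \<le> \<epsilon> * card X"
    and lab1: "\<And>g x. g \<in> F1 - f1 ` carrier H \<Longrightarrow> x \<in> X - R \<Longrightarrow> lab (\<rho>1 g x) \<noteq> lab x"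
    and lab2: "\<And>g x x'. g \<in> F2 - f2 ` carrier H \<Longrightarrow> x \<in> X - R \<Longrightarrow> x' \<in> X \<Longrightarrow> u x' = \<rho>2 g (u x) \<Longrightarrow> lab x' \<noteq> lab x"
  shows "\<exists>(V :: ('x \<times> ('k list \<Rightarrow> 'k list)) set) \<tau>1 \<tau>2. amalg_model G1 G2 H f1 f2 F1 F2 D L \<epsilon> V \<tau>1 \<tau>2"
proof -
  have "finite (lab ` X)" using X by simp
  \<comment> \<open>A letter of a word contributes at most two involutions, hence the length
    \<open>2 * L\<close>.\<close>
  from free_involutions[OF this, of "2 * L"] obtain Y :: "('k list \<Rightarrow> 'k list) set" and \<pi> where
    Y: "finite Y" "Y \<noteq> {}" and \<pi>: "\<And>c y. c \<in> lab ` X \<Longrightarrow> y \<in> Y \<Longrightarrow> \<pi> c y \<in> Y \<and> \<pi> c (\<pi> c y) = y"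
    and \<pi>free: "\<And>cs y. set cs \<subseteq> lab ` X \<Longrightarrow> distinct_adj cs \<Longrightarrow> cs \<noteq> [] \<Longrightarrow> length cs \<le> 2 * L \<Longrightarrow> y \<in> Y \<Longrightarrow> foldr \<pi> cs y \<noteq> y"
    by (elim exE conjE) metis
  define \<rho>2' where "\<rho>2' g x = inv_into X u (\<rho>2 g (u x))" for g x
  have Z: "finite Z" "card Z = card X" using u X bij_betw_finite bij_betw_same_card by fastforce+
  have uX: "u x \<in> Z" if "x \<in> X" for x using that u by (rule bij_betw_apply[rotated])
  have \<rho>1X: "\<rho>1 g x \<in> X" if "g \<in> carrier G1" "x \<in> X" for g x using bij_betw_apply[OF \<rho>1] that by blast
  have \<rho>2X: "\<rho>2 g x \<in> Z" if "g \<in> carrier G2" "x \<in> Z" for g x using bij_betw_apply[OF \<rho>2] that by blast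
  have u\<rho>2': "u (\<rho>2' g x) = \<rho>2 g (u x)" "\<rho>2' g x \<in> X" if "g \<in> carrier G2" "x \<in> X" for g x
  proof -
    have "\<rho>2 g (u x) \<in> u ` X" using \<rho>2X[OF that(1) uX[OF that(2)]] u by (simp add: bij_betw_def)
    then show "u (\<rho>2' g x) = \<rho>2 g (u x)" "\<rho>2' g x \<in> X"
      unfolding \<rho>2'_def by (rule f_inv_into_f, rule inv_into_into)
  qed
  have u_inj: "inj_on u X" using u by (simp add: bij_betw_def)
  have bij\<rho>2': "bij_betw (\<rho>2' g) X X" if "g \<in> carrier G2" for g
    by (rule bij_betw_finite_conj[where V = X and \<tau> = "\<rho>2' g" and \<Psi> = u and W = Z and \<kappa> = "\<rho>2 g",
          OF X(1) u\<rho>2'(2)[OF that] u_inj _ u\<rho>2'(1)[OF that]])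
       (use u \<rho>2[OF that] in \<open>auto simp: bij_betw_def\<close>)
  define \<Psi> where "\<Psi> = (\<lambda>(x, y). (u x, \<pi> (lab x) y))"
  define \<tau>1 where "\<tau>1 g = (\<lambda>(x, y :: 'k list \<Rightarrow> 'k list). (\<rho>1 g x, y))" for g
  define \<kappa> where "\<kappa> g = (\<lambda>(x, y :: 'k list \<Rightarrow> 'k list). (\<rho>2 g x, y))" for g
  define \<tau>2 where "\<tau>2 g = (\<lambda>(x, y). (\<rho>2' g x, \<pi> (lab (\<rho>2' g x)) (\<pi> (lab x) y)))" for g
  let ?V = "X \<times> Y" and ?W = "Z \<times> Y"
  have finV: "finite ?V" "?V \<noteq> {}" using X Y by auto
  have \<Psi>inj: "inj_on \<Psi> ?V"
  proof (rule inj_onI)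
    fix v w assume vw: "v \<in> ?V" "w \<in> ?V" "\<Psi> v = \<Psi> w"
    then have "fst v = fst w" using u_inj by (auto simp: \<Psi>_def inj_on_eq_iff)
    moreover from this have "snd v = snd w" using vw \<pi> by (auto simp: \<Psi>_def) (metis imageI)
    ultimately show "v = w" by (simp add: prod_eq_iff)
  qed
  have \<Psi>V: "\<Psi> ` ?V \<subseteq> ?W" using uX \<pi> by (auto simp: \<Psi>_def)
  have "card (\<Psi> ` ?V) = card ?W"
    using card_image[OF \<Psi>inj] Z(2) by (simp add: card_cartesian_product)
  then have \<Psi>: "bij_betw \<Psi> ?V ?W"
    unfolding bij_betw_def using \<Psi>inj \<Psi>V Z(1) Y(1) by (simp add: card_subset_eq)
  have \<tau>2V: "\<tau>2 g v \<in> ?V" if "g \<in> carrier G2" "v \<in> ?V" for g v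
    using that u\<rho>2'(2)[OF that(1)] \<pi> by (auto simp: \<tau>2_def)
  have conj: "\<kappa> g (\<Psi> v) = \<Psi> (\<tau>2 g v)" if "g \<in> carrier G2" "v \<in> ?V" for g v
    using that u\<rho>2'[OF that(1)] \<pi> by (auto simp: \<tau>2_def \<Psi>_def \<kappa>_def)
  have \<kappa>: "inj_on (\<kappa> g) ?W" if "g \<in> carrier G2" for g
    using \<rho>2[OF that] by (auto simp: \<kappa>_def bij_betw_def inj_on_def)
  have "amalg_model G1 G2 H f1 f2 F1 F2 D L \<epsilon> ?V \<tau>1 \<tau>2"
    unfolding amalg_model_def
  proof (intro conjI ballI allI impI finV)
    fix g assume "g \<in> carrier G1"
    then show "bij_betw (\<tau>1 g) ?V ?V"
      by (intro bij_betw_finite_conj[OF finV(1), of _ id ?V "\<tau>1 g"])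
         (use \<rho>1X \<rho>1 in \<open>auto simp: \<tau>1_def bij_betw_def inj_on_def\<close>)
  next
    fix g assume g: "g \<in> carrier G2"
    show "bij_betw (\<tau>2 g) ?V ?V"
      by (rule bij_betw_finite_conj[OF finV(1) \<tau>2V[OF g] \<Psi>inj \<Psi>V conj[OF g, symmetric] \<kappa>[OF g]])
  next
    show "card {v \<in> ?V. \<not> acts_freely_at G1 \<tau>1 F1 v} \<le> \<epsilon> * card ?V"
      by (rule card_Times_fst_le[OF free1 Y(1) _ X(1)]) (simp add: \<tau>1_def[abs_def] acts_freely_at_fst)
    have "card {v \<in> ?V. \<not> acts_freely_at G2 \<tau>2 F2 v} = card {v \<in> ?W. \<not> acts_freely_at G2 \<kappa> F2 v}"
      by (rule card_conj[OF \<Psi>, symmetric])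
         (subst acts_freely_at_conj[where V = ?V and \<tau> = \<tau>2 and \<tau>' = \<kappa> and \<Psi> = \<Psi>, OF G(2) F(2) _ \<tau>2V \<Psi>inj conj]; simp)
    also have "\<dots> \<le> \<epsilon> * card ?W"
      by (rule card_Times_fst_le[OF free2 Y(1) _ Z(1)]) (simp add: \<kappa>_def[abs_def] acts_freely_at_fst)
    also have "card ?W = card ?V" using Z(2) by (simp add: card_cartesian_product)
    finally show "card {v \<in> ?V. \<not> acts_freely_at G2 \<tau>2 F2 v} \<le> \<epsilon> * card ?V" .
  next
    fix h assume h: "h \<in> D"
    then have hG: "f1 h \<in> carrier G1" "f2 h \<in> carrier G2" using f by auto
    show "card {v \<in> ?V. \<tau>1 (f1 h) v \<noteq> \<tau>2 (f2 h) v} \<le> \<epsilon> * card ?V"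
    proof (rule card_Times_fst_le[OF D[OF h] Y(1) _ X(1)], rule ccontr)
      fix x y assume x: "x \<in> X" and y: "y \<in> Y" and ne: "\<tau>1 (f1 h) (x, y) \<noteq> \<tau>2 (f2 h) (x, y)"
        and "\<not> (u (\<rho>1 (f1 h) x) \<noteq> \<rho>2 (f2 h) (u x) \<or> lab (\<rho>1 (f1 h) x) \<noteq> lab x)"
      then have eq: "u (\<rho>1 (f1 h) x) = u (\<rho>2' (f2 h) x)" "lab (\<rho>1 (f1 h) x) = lab x"
        using u\<rho>2'(1)[OF hG(2) x] by auto
      have "\<rho>1 (f1 h) x = \<rho>2' (f2 h) x"
        using inj_onD[OF u_inj eq(1) \<rho>1X[OF hG(1) x] u\<rho>2'(2)[OF hG(2) x]] .
      then show False using ne eq(2) \<pi>[of "lab x" y] x y by (auto simp: \<tau>1_def \<tau>2_def)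
    qed
  next
    fix w assume w: "set w \<subseteq> (F1 - f1 ` carrier H) <+> (F2 - f2 ` carrier H)" "distinct_adj (map isl w)"
      "2 \<le> length w" "length w \<le> L"
    have F': "Inl a \<in> set w \<Longrightarrow> a \<in> F1 - f1 ` carrier H" "Inr b \<in> set w \<Longrightarrow> b \<in> F2 - f2 ` carrier H" for a b
      using w(1) by auto
    have "card {v \<in> ?V. foldr (case_sum \<tau>1 \<tau>2) w v = v} \<le> length w * card R * card Y"
    proof (rule card_fixed_skew[where \<rho> = "case_sum \<rho>1 \<rho>2'" and lab = lab and \<pi> = \<pi>, OF X(1) Y(1) R(1) _ _ _ _ _ _ w(2,3)])
      show "foldr \<pi> cs y \<noteq> y" if "set cs \<subseteq> lab ` X" "distinct_adj cs" "cs \<noteq> []" "length cs \<le> 2 * length w" "y \<in> Y" for cs y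
        using \<pi>free[OF that(1-3) _ that(5)] that(4) w(4) by simp
      show "bij_betw (case_sum \<rho>1 \<rho>2' l) X X" if "l \<in> set w" for l
        using that F' F \<rho>1 bij\<rho>2' by (cases l rule: sum.exhaust) (auto simp: subset_iff)
      show "lab (case_sum \<rho>1 \<rho>2' l x) \<noteq> lab x" if "l \<in> set w" "x \<in> X - R" for l x
      proof (cases l)
        case (Inl a)
        then show ?thesis using lab1[of a x] that F'(1)[of a] by simp
      next
        case (Inr b)
        then have b: "b \<in> F2 - f2 ` carrier H" "b \<in> carrier G2" using F'(2) that F(2) by auto
        show ?thesis using lab2[OF b(1) that(2) u\<rho>2'(2)[OF b(2)] u\<rho>2'(1)[OF b(2)]] that(2) Inr by simp
      qed
    qed (simp_all add: \<pi> \<tau>1_def \<tau>2_def)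
    also have "\<dots> \<le> L * card R * card Y" using w(4) by simp
    finally have "real (card {v \<in> ?V. foldr (case_sum \<tau>1 \<tau>2) w v = v}) \<le> real (L * card R * card Y)"
      by (rule of_nat_mono)
    also have "\<dots> = real (L * card R) * card Y" by simp
    also have "\<dots> \<le> \<epsilon> * card X * card Y" using R(2) by (intro mult_right_mono) auto
    finally show "card {v \<in> ?V. foldr (case_sum \<tau>1 \<tau>2) w v = v} \<le> \<epsilon> * card ?V"
      by (simp add: card_cartesian_product)
  qed
  then show ?thesis by blast
qed

text \<open>The transported maps are the identity off \<open>W\<close>, so that they satisfy
  \<open>permutes\<close> once \<open>W\<close> is an initial segment of the naturals.\<close>

lemma amalg_model_transfer:
  assumes G: "group G1" "group G2" and F: "F1 \<subseteq> carrier G1" "F2 \<subseteq> carrier G2"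
    and f: "f1 ` D \<subseteq> carrier G1" "f2 ` D \<subseteq> carrier G2"
    and m: "amalg_model G1 G2 H f1 f2 F1 F2 D L \<epsilon> V \<tau>1 \<tau>2" and \<Psi>: "bij_betw \<Psi> V W"
  shows "amalg_model G1 G2 H f1 f2 F1 F2 D L \<epsilon> W
    (\<lambda>g x. if x \<in> W then \<Psi> (\<tau>1 g (inv_into V \<Psi> x)) else x) (\<lambda>g x. if x \<in> W then \<Psi> (\<tau>2 g (inv_into V \<Psi> x)) else x)"
    (is "amalg_model _ _ _ _ _ _ _ _ _ _ _ ?\<tau>1 ?\<tau>2")
proof -
  have inj: "inj_on \<Psi> V" and W: "\<Psi> ` V = W" using \<Psi> by (auto simp: bij_betw_def)
  have card: "card W = card V" using bij_betw_same_card[OF \<Psi>] by simp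
  have inv: "inv_into V \<Psi> (\<Psi> v) = v" "\<Psi> v \<in> W" if "v \<in> V" for v using inj W that by auto
  have \<tau>V: "\<And>g v. g \<in> carrier G1 \<Longrightarrow> v \<in> V \<Longrightarrow> \<tau>1 g v \<in> V" "\<And>g v. g \<in> carrier G2 \<Longrightarrow> v \<in> V \<Longrightarrow> \<tau>2 g v \<in> V"
    using m bij_betw_apply unfolding amalg_model_def by fast+
  have bij: "bij_betw (\<lambda>x. if x \<in> W then \<Psi> (t (inv_into V \<Psi> x)) else x) W W" if "bij_betw t V V" for t
    using bij_betw_trans[OF bij_betw_trans[OF bij_betw_inv_into[OF \<Psi>] that] \<Psi>]
    by (subst bij_betw_cong[where g = "\<lambda>x. \<Psi> (t (inv_into V \<Psi> x))"]) (auto simp: comp_def)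
  have words: "foldr (case_sum ?\<tau>1 ?\<tau>2) w (\<Psi> v) = \<Psi> (foldr (case_sum \<tau>1 \<tau>2) w v) \<and>
      foldr (case_sum \<tau>1 \<tau>2) w v \<in> V"
    if "set w \<subseteq> F1 <+> F2" "v \<in> V" for w v
    using that
  proof (induction w)
    case (Cons l w)
    then show ?case using F \<tau>V by (cases l) (auto simp: inv subset_iff)
  qed simp
  show ?thesis
    unfolding amalg_model_def card
  proof (intro conjI ballI allI impI)
    show "finite W" "W \<noteq> {}" using m W by (auto simp: amalg_model_def)
    show "bij_betw (?\<tau>1 g) W W" if "g \<in> carrier G1" for g
      using m that by (intro bij) (simp add: amalg_model_def)
    show "bij_betw (?\<tau>2 g) W W" if "g \<in> carrier G2" for g
      using m that by (intro bij) (simp add: amalg_model_def)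
    have "card {x \<in> W. \<not> acts_freely_at G1 ?\<tau>1 F1 x} = card {x \<in> V. \<not> acts_freely_at G1 \<tau>1 F1 x}"
      by (rule card_conj[OF \<Psi>]) (subst acts_freely_at_conj[OF G(1) F(1) _ \<tau>V(1) inj, where \<tau>' = ?\<tau>1]; simp add: inv)
    then show "card {x \<in> W. \<not> acts_freely_at G1 ?\<tau>1 F1 x} \<le> \<epsilon> * card V" using m by (simp add: amalg_model_def)
    have "card {x \<in> W. \<not> acts_freely_at G2 ?\<tau>2 F2 x} = card {x \<in> V. \<not> acts_freely_at G2 \<tau>2 F2 x}"
      by (rule card_conj[OF \<Psi>]) (subst acts_freely_at_conj[OF G(2) F(2) _ \<tau>V(2) inj, where \<tau>' = ?\<tau>2]; simp add: inv)
    then show "card {x \<in> W. \<not> acts_freely_at G2 ?\<tau>2 F2 x} \<le> \<epsilon> * card V" using m by (simp add: amalg_model_def)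
  next
    fix h assume h: "h \<in> D"
    have "card {x \<in> W. ?\<tau>1 (f1 h) x \<noteq> ?\<tau>2 (f2 h) x} = card {x \<in> V. \<tau>1 (f1 h) x \<noteq> \<tau>2 (f2 h) x}"
      by (rule card_conj[OF \<Psi>]) (use h f \<tau>V inj in \<open>auto simp: inv image_subset_iff inj_on_eq_iff\<close>)
    then show "card {x \<in> W. ?\<tau>1 (f1 h) x \<noteq> ?\<tau>2 (f2 h) x} \<le> \<epsilon> * card V" using m h by (simp add: amalg_model_def)
  next
    fix w assume w: "set w \<subseteq> (F1 - f1 ` carrier H) <+> (F2 - f2 ` carrier H)" "distinct_adj (map isl w)"
      "2 \<le> length w" "length w \<le> L"
    have "set w \<subseteq> F1 <+> F2" using w(1) by blast
    from words[OF this] have "card {x \<in> W. foldr (case_sum ?\<tau>1 ?\<tau>2) w x = x} = card {x \<in> V. foldr (case_sum \<tau>1 \<tau>2) w x = x}"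
      by (intro card_conj[OF \<Psi>]) (use inj in \<open>auto simp: inj_on_eq_iff\<close>)
    then show "card {x \<in> W. foldr (case_sum ?\<tau>1 ?\<tau>2) w x = x} \<le> \<epsilon> * card V" using m w by (simp add: amalg_model_def)
  qed
qed

lemma bij_betw_Times_fst:
  assumes "bij_betw s A A"
  shows "bij_betw (\<lambda>(i, j). (s i, j)) (A \<times> B) (A \<times> B)"
proof -
  have "(\<lambda>(i, j). (s i, j)) ` (A \<times> B) = (s ` A) \<times> B" by force
  moreover have "inj_on (\<lambda>(i, j). (s i, j)) (A \<times> B)" using assms by (auto simp: bij_betw_def inj_on_def)
  ultimately show ?thesis using assms by (simp add: bij_betw_def)
qed

lemma amalg_model_exists:
  fixes \<epsilon> :: real
    and G1 :: "('a, 'm) monoid_scheme" and G2 :: "('b, 'n) monoid_scheme" and H :: "('c, 'l) monoid_scheme"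
  assumes \<omega>: "free_ultrafilter \<omega>" and sofic: "sofic_group \<omega> G1" "sofic_group \<omega> G2"
    and am: "amenable_group H" and f: "f1 \<in> mon H G1" "f2 \<in> mon H G2"
    and F1: "finite F1" "F1 \<subseteq> carrier G1" and F2: "finite F2" "F2 \<subseteq> carrier G2"
    and D: "finite D" "D \<subseteq> carrier H" and \<epsilon>: "0 < \<epsilon>"
  shows "\<exists>(n :: nat) \<tau>1 \<tau>2. 0 < n \<and> (\<forall>g\<in>carrier G1. \<tau>1 g permutes {..<n}) \<and> (\<forall>g\<in>carrier G2. \<tau>2 g permutes {..<n}) \<and>
    amalg_model G1 G2 H f1 f2 F1 F2 D L \<epsilon> {..<n} \<tau>1 \<tau>2"
proof -
  interpret G1: group G1 using sofic(1) by (simp add: sofic_group_def)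
  interpret G2: group G2 using sofic(2) by (simp add: sofic_group_def)
  interpret H: group H using am by (simp add: amenable_group_def)
  have G: "group G1" "group G2" by unfold_locales
  have hcl: "f1 h \<in> carrier G1" "f2 h \<in> carrier G2" if "h \<in> carrier H" for h
    using f that by (auto simp: mon_def hom_def)
  \<comment> \<open>The exceptional set, met at up to \<open>L\<close> positions of a word, needs
    \<open>L * \<eta> \<le> \<epsilon>\<close>; the disagreement on \<open>D\<close> needs
    \<open>2 * \<eta> \<le> \<epsilon>\<close>; and \<open>almost_conjugacy\<close> asks for
    \<open>\<eta> \<le> 1\<close>.\<close>
  define \<eta> where "\<eta> = min 1 (\<epsilon> / (2 * (real L + 1)))"
  have \<eta>: "0 < \<eta>" "\<eta> \<le> 1" using \<epsilon> by (auto simp: \<eta>_def)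
  have "\<eta> \<le> \<epsilon> / (2 * (real L + 1))" by (simp add: \<eta>_def)
  then have \<eta>L': "\<eta> * (2 * (real L + 1)) \<le> \<epsilon>" by (simp add: pos_le_divide_eq)
  then have \<eta>L: "L * \<eta> \<le> \<epsilon>" "2 * \<eta> \<le> \<epsilon>"
  proof -
    have "0 \<le> L * \<eta>" using \<eta> by simp
    moreover have "2 * (L * \<eta>) + 2 * \<eta> \<le> \<epsilon>" using \<eta>L' by (simp add: algebra_simps)
    ultimately show "L * \<eta> \<le> \<epsilon>" "2 * \<eta> \<le> \<epsilon>" using \<eta>(1) by linarith+
  qed
  obtain E :: "'c set" and n0 where E: "finite E" "D \<subseteq> E" "E \<subseteq> carrier H" and
    conj: "\<forall>(X :: (nat \<times> nat \<times> nat) set) (Y :: (nat \<times> nat \<times> nat) set) \<alpha> \<beta> Xg Yg. approx_pair H X Y \<alpha> \<beta> E Xg Yg \<longrightarrow>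
       card (X - Xg) \<le> \<eta>/4 * card X \<longrightarrow> card (Y - Yg) \<le> \<eta>/4 * card X \<longrightarrow>
       n0 \<le> card X \<longrightarrow> 0 < card X \<longrightarrow>
       (\<exists>u (lab :: nat \<times> nat \<times> nat \<Rightarrow> ((nat \<times> nat \<times> nat) \<times> (nat \<times> nat \<times> nat)) option) R.
          bij_betw u X Y \<and> R \<subseteq> X \<and> card R \<le> \<eta> * card X \<and>
          (\<forall>t\<in>D. card {x \<in> X. u (\<alpha> t x) \<noteq> \<beta> t (u x) \<or> lab (\<alpha> t x) \<noteq> lab x} \<le> 2 * \<eta> * card X) \<and>
          (\<forall>x\<in>X - R. \<forall>x'\<in>X. lab x = lab x' \<longrightarrow>
            (\<exists>x0\<in>Xg. \<exists>y0\<in>Yg. \<exists>s\<in>E. \<exists>s'\<in>E.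
               x = \<alpha> s x0 \<and> x' = \<alpha> s' x0 \<and> u x = \<beta> s y0 \<and> u x' = \<beta> s' y0)))"
    using H.almost_conjugacy[where 'x = "nat \<times> nat \<times> nat" and 'y = "nat \<times> nat \<times> nat", OF am \<eta> D]
    by (elim exE conjE) (intro that; assumption)
  \<comment> \<open>Besides \<open>F1\<close> the window contains the positions \<open>f1 s\<close>
    inside a tile and their translates by \<open>F1\<close>: these are the elements to which
    \<open>acts_freely_at_off_subgroup\<close> is applied.\<close>
  define E1 where "E1 = F1 \<union> f1 ` E \<union> (\<lambda>(g, h). g \<otimes>\<^bsub>G1\<^esub> f1 h) ` (F1 \<times> E)"
  define E2 where "E2 = F2 \<union> f2 ` E \<union> (\<lambda>(g, h). g \<otimes>\<^bsub>G2\<^esub> f2 h) ` (F2 \<times> E)"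
  have E1: "finite E1" "E1 \<subseteq> carrier G1" using F1 E hcl by (auto simp: E1_def subset_iff)
  have E2: "finite E2" "E2 \<subseteq> carrier G2" using F2 E hcl by (auto simp: E2_def subset_iff)
  \<comment> \<open>\<open>\<eta> / 4\<close> is the share of bad points that
    \<open>almost_conjugacy\<close> tolerates, \<open>\<epsilon>\<close> the one allowed by the
    model.\<close>
  define \<delta> where "\<delta> = min (\<eta> / 4) \<epsilon>"
  have \<delta>: "0 < \<delta>" "\<delta> \<le> \<eta> / 4" "\<delta> \<le> \<epsilon>" using \<eta> \<epsilon> by (auto simp: \<delta>_def)
  obtain n1 :: nat and \<sigma>1 where s1: "0 < n1" "\<And>g. g \<in> carrier G1 \<Longrightarrow> \<sigma>1 g permutes {..<n1}"
    "card {x \<in> {..<n1}. \<not> acts_freely_at G1 \<sigma>1 E1 x} \<le> \<delta> * n1"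
    using sofic_approx[OF \<omega> sofic(1) E1 \<delta>(1)] by blast
  obtain n2 :: nat and \<sigma>2 where s2: "0 < n2" "\<And>g. g \<in> carrier G2 \<Longrightarrow> \<sigma>2 g permutes {..<n2}"
    "card {x \<in> {..<n2}. \<not> acts_freely_at G2 \<sigma>2 E2 x} \<le> \<delta> * n2"
    using sofic_approx[OF \<omega> sofic(2) E2 \<delta>(1)] by blast
  \<comment> \<open>Multiplying with the other set makes the cardinalities equal, and the extra
    factor makes them exceed \<open>n0\<close>; only the first coordinate is acted on.\<close>
  define X where "X = {..<n1} \<times> {..<n2} \<times> {..n0}"
  define Z where "Z = {..<n2} \<times> {..<n1} \<times> {..n0}"
  define \<rho>1 where "\<rho>1 g = (\<lambda>(i, j :: nat \<times> nat). (\<sigma>1 g i, j))" for g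
  define \<rho>2 where "\<rho>2 g = (\<lambda>(i, j :: nat \<times> nat). (\<sigma>2 g i, j))" for g
  have "finite X" "finite Z" by (auto simp: X_def Z_def)
  moreover have "card Z = card X" by (simp add: X_def Z_def card_cartesian_product algebra_simps)
  ultimately have X: "finite X" "finite Z" "card Z = card X" by blast+
  have "1 * (1 * (n0 + 1)) \<le> n1 * (n2 * (n0 + 1))" using s1(1) s2(1) by (intro mult_le_mono) auto
  then have "n0 + 1 \<le> card X" by (simp add: X_def card_cartesian_product)
  then have cX: "n0 \<le> card X" "0 < card X" by linarith+
  have bij1: "bij_betw (\<rho>1 g) X X" if "g \<in> carrier G1" for g
    unfolding \<rho>1_def X_def by (intro bij_betw_Times_fst permutes_imp_bij s1(2) that)
  have bij2: "bij_betw (\<rho>2 g) Z Z" if "g \<in> carrier G2" for g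
    unfolding \<rho>2_def Z_def by (intro bij_betw_Times_fst permutes_imp_bij s2(2) that)
  have bad1: "card {x \<in> X. \<not> acts_freely_at G1 \<rho>1 E1 x} \<le> \<delta> * card X"
    unfolding X_def
    by (rule card_Times_fst_le[where P = "\<lambda>x. \<not> acts_freely_at G1 \<sigma>1 E1 x"])
       (use s1(3) in \<open>simp_all add: \<rho>1_def[abs_def] acts_freely_at_fst\<close>)
  have bad2: "card {x \<in> Z. \<not> acts_freely_at G2 \<rho>2 E2 x} \<le> \<delta> * card Z"
    unfolding Z_def
    by (rule card_Times_fst_le[where P = "\<lambda>x. \<not> acts_freely_at G2 \<sigma>2 E2 x"])
       (use s2(3) in \<open>simp_all add: \<rho>2_def[abs_def] acts_freely_at_fst\<close>)
  define Xg where "Xg = {x \<in> X. acts_freely_at G1 \<rho>1 E1 x}"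
  define Zg where "Zg = {x \<in> Z. acts_freely_at G2 \<rho>2 E2 x}"
  have XXg: "X - Xg = {x \<in> X. \<not> acts_freely_at G1 \<rho>1 E1 x}" "Z - Zg = {x \<in> Z. \<not> acts_freely_at G2 \<rho>2 E2 x}"
    by (auto simp: Xg_def Zg_def)
  have ap: "approx_pair H X Z (\<lambda>h. \<rho>1 (f1 h)) (\<lambda>h. \<rho>2 (f2 h)) E Xg Zg"
  proof unfold_locales
    show "acts_freely_at H (\<lambda>h. \<rho>1 (f1 h)) E x" if "x \<in> Xg" for x
      using that by (intro acts_freely_at_pullback[OF f(1) E(3), of E1]) (auto simp: E1_def Xg_def)
    show "acts_freely_at H (\<lambda>h. \<rho>2 (f2 h)) E x" if "x \<in> Zg" for x
      using that by (intro acts_freely_at_pullback[OF f(2) E(3), of E2]) (auto simp: E2_def Zg_def)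
  qed (use X E bij1 bij2 hcl in \<open>auto simp: Xg_def Zg_def\<close>)
  have \<delta>X: "\<delta> * card X \<le> \<eta> / 4 * card X" "\<delta> * card X \<le> \<epsilon> * card X"
    using \<delta> by (intro mult_right_mono; simp)+
  have "card (X - Xg) \<le> \<eta>/4 * card X" "card (Z - Zg) \<le> \<eta>/4 * card X"
    using bad1 bad2 \<delta>X(1) unfolding XXg X(3) by linarith+
  from conj[rule_format, OF ap this cX]
  obtain u and lab :: "nat \<times> nat \<times> nat \<Rightarrow> ((nat \<times> nat \<times> nat) \<times> (nat \<times> nat \<times> nat)) option" and R where
    u: "bij_betw u X Z" and R: "R \<subseteq> X" "card R \<le> \<eta> * card X"
    and uD: "\<forall>t\<in>D. card {x \<in> X. u (\<rho>1 (f1 t) x) \<noteq> \<rho>2 (f2 t) (u x) \<or> lab (\<rho>1 (f1 t) x) \<noteq> lab x} \<le> 2 * \<eta> * card X"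
    and lab: "\<forall>x\<in>X - R. \<forall>x'\<in>X. lab x = lab x' \<longrightarrow>
            (\<exists>x0\<in>Xg. \<exists>y0\<in>Zg. \<exists>s\<in>E. \<exists>s'\<in>E.
               x = \<rho>1 (f1 s) x0 \<and> x' = \<rho>1 (f1 s') x0 \<and> u x = \<rho>2 (f2 s) y0 \<and> u x' = \<rho>2 (f2 s') y0)"
    by (elim exE conjE) (intro that; assumption)
  have "\<exists>(V :: ((nat \<times> nat \<times> nat) \<times> (((nat \<times> nat \<times> nat) \<times> (nat \<times> nat \<times> nat)) option list \<Rightarrow>
      ((nat \<times> nat \<times> nat) \<times> (nat \<times> nat \<times> nat)) option list)) set) \<tau>1 \<tau>2.
      amalg_model G1 G2 H f1 f2 F1 F2 D L \<epsilon> V \<tau>1 \<tau>2"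
  proof (rule amalg_model_skew[where ?\<rho>1.0 = \<rho>1 and ?\<rho>2.0 = \<rho>2 and u = u and lab = lab and R = R, OF G F1(2) F2(2) _ _ X(1) _ u bij1 bij2])
    show "f1 ` D \<subseteq> carrier G1" "f2 ` D \<subseteq> carrier G2" using D hcl by auto
    show "X \<noteq> {}" using cX by auto
    have "card {x \<in> X. \<not> acts_freely_at G1 \<rho>1 F1 x} \<le> card {x \<in> X. \<not> acts_freely_at G1 \<rho>1 E1 x}"
      using X by (intro card_mono) (auto simp: E1_def dest: acts_freely_at_mono[of _ _ _ _ F1])
    then show "card {x \<in> X. \<not> acts_freely_at G1 \<rho>1 F1 x} \<le> \<epsilon> * card X" using bad1 \<delta>X(2) by linarith
    have "card {x \<in> Z. \<not> acts_freely_at G2 \<rho>2 F2 x} \<le> card {x \<in> Z. \<not> acts_freely_at G2 \<rho>2 E2 x}"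
      using X by (intro card_mono) (auto simp: E2_def dest: acts_freely_at_mono[of _ _ _ _ F2])
    then show "card {x \<in> Z. \<not> acts_freely_at G2 \<rho>2 F2 x} \<le> \<epsilon> * card Z"
      using bad2 \<delta>X(2) unfolding X(3) by linarith
    have "2 * \<eta> * card X \<le> \<epsilon> * card X" using \<eta>L(2) by (intro mult_right_mono) auto
    then show "card {x \<in> X. u (\<rho>1 (f1 h) x) \<noteq> \<rho>2 (f2 h) (u x) \<or> lab (\<rho>1 (f1 h) x) \<noteq> lab x} \<le> \<epsilon> * card X"
      if "h \<in> D" for h using uD[rule_format, OF that] by linarith
    show "R \<subseteq> X" by (rule R)
    have "real (L * card R) \<le> L * (\<eta> * card X)" using R(2) by (simp add: mult_left_mono)
    also have "\<dots> \<le> \<epsilon> * card X" using \<eta>L(1) by (simp add: mult.assoc[symmetric] mult_right_mono)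
    finally show "real (L * card R) \<le> \<epsilon> * card X" .
  next
    fix g x assume g: "g \<in> F1 - f1 ` carrier H" and x: "x \<in> X - R"
    then have gG: "g \<in> carrier G1" using F1 by auto
    show "lab (\<rho>1 g x) \<noteq> lab x"
    proof
      assume "lab (\<rho>1 g x) = lab x"
      moreover have "\<rho>1 g x \<in> X" using bij_betw_apply[OF bij1[OF gG]] x by blast
      ultimately obtain x0 s s' where "x0 \<in> Xg" "s \<in> E" "s' \<in> E" "x = \<rho>1 (f1 s) x0" "\<rho>1 g x = \<rho>1 (f1 s') x0"
        using lab[rule_format, OF x, of "\<rho>1 g x"] by metis
      then show False
        using acts_freely_at_off_subgroup[OF G(1) H.is_group f(1), of \<rho>1 E1 x0 g s s'] g gG E(3)
        by (force simp: Xg_def E1_def)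
    qed
  next
    fix g x x' assume g: "g \<in> F2 - f2 ` carrier H" and x: "x \<in> X - R" "x' \<in> X" "u x' = \<rho>2 g (u x)"
    then have gG: "g \<in> carrier G2" using F2 by auto
    show "lab x' \<noteq> lab x"
    proof
      assume "lab x' = lab x"
      then obtain x0 s s' where "x0 \<in> Zg" "s \<in> E" "s' \<in> E" "u x = \<rho>2 (f2 s) x0" "u x' = \<rho>2 (f2 s') x0"
        using lab[rule_format, OF x(1,2)] by metis
      then show False
        using acts_freely_at_off_subgroup[OF G(2) H.is_group f(2), of \<rho>2 E2 x0 g s s'] g gG E(3) x(3)
        by (force simp: Zg_def E2_def)
    qed
  qed
  then obtain V :: "((nat \<times> nat \<times> nat) \<times> (((nat \<times> nat \<times> nat) \<times> (nat \<times> nat \<times> nat)) option list \<Rightarrow>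
      ((nat \<times> nat \<times> nat) \<times> (nat \<times> nat \<times> nat)) option list)) set" and \<tau>1 \<tau>2
    where m: "amalg_model G1 G2 H f1 f2 F1 F2 D L \<epsilon> V \<tau>1 \<tau>2" by blast
  then have V: "finite V" "V \<noteq> {}" by (auto simp: amalg_model_def)
  obtain \<Psi> where \<Psi>: "bij_betw \<Psi> V {..<card V}"
    using ex_bij_betw_finite_nat[OF V(1)] by (auto simp: lessThan_atLeast0)
  have "f1 ` D \<subseteq> carrier G1" "f2 ` D \<subseteq> carrier G2" using D hcl by auto
  from amalg_model_transfer[OF G F1(2) F2(2) this m \<Psi>]
  have M: "amalg_model G1 G2 H f1 f2 F1 F2 D L \<epsilon> {..<card V}
    (\<lambda>g x. if x \<in> {..<card V} then \<Psi> (\<tau>1 g (inv_into V \<Psi> x)) else x)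
    (\<lambda>g x. if x \<in> {..<card V} then \<Psi> (\<tau>2 g (inv_into V \<Psi> x)) else x)"
    (is "amalg_model _ _ _ _ _ _ _ _ _ _ _ ?t1 ?t2") .
  have "?t1 g permutes {..<card V}" if "g \<in> carrier G1" for g
    by (rule bij_imp_permutes[OF amalg_model_bij(1)[OF M that]]) simp
  moreover have "?t2 g permutes {..<card V}" if "g \<in> carrier G2" for g
    by (rule bij_imp_permutes[OF amalg_model_bij(2)[OF M that]]) simp
  moreover have "0 < card V" using V by (simp add: card_gt_0_iff)
  ultimately show ?thesis using M by (intro exI[of _ "card V"] exI[of _ ?t1] exI[of _ ?t2] conjI ballI)
qed

subsection \<open>Passing to the ultraproduct\<close>

lemma countable_exhaustion:
  assumes "countable S"
  obtains A :: "nat \<Rightarrow> 'a set" where "\<And>j. finite (A j)" "\<And>j. A j \<subseteq> S"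
    "\<And>x. x \<in> S \<Longrightarrow> eventually (\<lambda>j. x \<in> A j) sequentially"
proof (cases "S = {}")
  case True
  then show ?thesis using that[of "\<lambda>_. {}"] by simp
next
  case False
  show ?thesis
  proof (rule that[of "\<lambda>j. from_nat_into S ` {..j}"])
    show "from_nat_into S ` {..j} \<subseteq> S" for j using from_nat_into[OF False] by auto
    fix x assume x: "x \<in> S"
    show "eventually (\<lambda>j. x \<in> from_nat_into S ` {..j}) sequentially"
      unfolding eventually_sequentially
      by (intro exI[of _ "to_nat_on S x"] allI impI rev_image_eqI[of "to_nat_on S x"])
         (use x assms in auto)
  qed simp
qed

text \<open>A free ultrafilter contains all cofinite sets. Hence the models can be controlled by
  statements that hold for all large indices, and these pass to limits along \<omega>.\<close>

lemma free_ultrafilter_le_sequentially: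
  assumes "free_ultrafilter \<omega>"
  shows "\<omega> \<le> sequentially"
proof (rule filter_leI)
  fix P assume "eventually P sequentially"
  then obtain N where N: "\<And>k. N \<le> k \<Longrightarrow> P k" by (auto simp: eventually_sequentially)
  have "eventually (\<lambda>k. \<forall>m\<in>{..<N}. k \<noteq> m) \<omega>"
    using assms by (intro eventually_ball_finite) (auto simp: free_ultrafilter_def)
  then show "eventually P \<omega>" by (rule eventually_mono) (use N in \<open>force simp: not_less[symmetric]\<close>)
qed

lemma tendsto_0_of_eventually_le:
  fixes r :: "nat \<Rightarrow> real"
  assumes \<omega>: "free_ultrafilter \<omega>" and r: "\<And>j. 0 \<le> r j"
    and le: "eventually (\<lambda>j. r j \<le> 1 / (real j + 1)) sequentially"
  shows "(r \<longlongrightarrow> 0) \<omega>"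
proof (rule tendsto_mono[OF free_ultrafilter_le_sequentially[OF \<omega>]])
  have lim: "(\<lambda>j. 1 / (real j + 1)) \<longlonglongrightarrow> 0"
    using LIMSEQ_inverse_real_of_nat by (simp add: inverse_eq_divide add.commute)
  show "r \<longlonglongrightarrow> 0"
    by (rule tendsto_sandwich[OF _ le tendsto_const lim]) (use r in simp)
qed

text \<open>A shortest word representing an element is reduced.\<close>

lemma amalg_reduced_word:
  assumes G: "group G1" "group G2" and f: "f1 \<in> hom H G1" "f2 \<in> hom H G2" and w: "w \<in> amalg_words G1 G2"
  shows "\<exists>w'. amalg_eq G1 G2 H f1 f2 w w' \<and> (length w' \<le> 1 \<or> 2 \<le> length w' \<and> distinct_adj (map isl w') \<and>
    set w' \<subseteq> (carrier G1 - f1 ` carrier H) <+> (carrier G2 - f2 ` carrier H))"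
proof -
  interpret G1: group G1 by (rule G)
  interpret G2: group G2 by (rule G)
  let ?eq = "amalg_eq G1 G2 H f1 f2"
  have "?eq w w" using w by (rule amalg_eq.refl)
  then obtain w' where w': "?eq w w'" and min: "\<And>v. ?eq w v \<Longrightarrow> length w' \<le> length v"
    using ex_has_least_nat[of "?eq w" w length] by blast
  have words: "w' \<in> amalg_words G1 G2" using amalg_eq_words[OF G f w'] by simp
  have hcl: "f1 h \<in> carrier G1" "f2 h \<in> carrier G2" if "h \<in> carrier H" for h
    using f that by (auto simp: hom_def)
  \<comment> \<open>Otherwise the two neighbours merge into one letter, against minimality, if
    necessary after a letter from the image of \<open>H\<close> has been rewritten in the other
    factor.\<close>
  have pair: "isl (w' ! i) \<noteq> isl (w' ! Suc i) \<and> {w' ! i, w' ! Suc i} \<inter> (Inl ` f1 ` carrier H \<union> Inr ` f2 ` carrier H) = {}"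
    if i: "Suc i < length w'" for i
  proof (rule ccontr)
    assume bad: "\<not> ?thesis"
    define a where "a = w' ! i"
    define b where "b = w' ! Suc i"
    have split: "w' = take i w' @ [a, b] @ drop (Suc (Suc i)) w'"
      using i unfolding a_def b_def by (simp add: Cons_nth_drop_Suc)
    have parts: "take i w' \<in> amalg_words G1 G2" "drop (Suc (Suc i)) w' \<in> amalg_words G1 G2"
      using words by (auto simp: amalg_words_def dest: in_set_takeD in_set_dropD)
    have ab: "a \<in> carrier G1 <+> carrier G2" "b \<in> carrier G1 <+> carrier G2"
      using words i unfolding amalg_words_def a_def b_def by (auto simp: in_lists_conv_set)
    have no: "\<not> ?eq [a, b] [c]" for c
    proof
      assume "?eq [a, b] [c]"
      then have "?eq (take i w' @ [a, b] @ drop (Suc (Suc i)) w') (take i w' @ [c] @ drop (Suc (Suc i)) w')"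
        using parts by (intro amalg_eq.cong amalg_eq.refl)
      then have "?eq w (take i w' @ [c] @ drop (Suc (Suc i)) w')"
        using w' split amalg_eq.trans by metis
      from min[OF this] show False using i by simp
    qed
    have cong2: "?eq [x, y] [x', y']" if "?eq [x] [x']" "?eq [y] [y']" for x y x' y'
      using amalg_eq.cong[OF that] by simp
    note ref = amalg_eq.refl[of _ G1 G2 H f1 f2]
    show False
    proof (cases a; cases b)
      fix x y assume "a = Inl x" "b = Inl y"
      then show False using no amalg_eq.mult1[of x G1 y G2 H f1 f2] ab by auto
    next
      fix x y assume "a = Inr x" "b = Inr y"
      then show False using no amalg_eq.mult2[of x G2 y G1 H f1 f2] ab by auto
    next
      fix x y assume xy: "a = Inl x" "b = Inr y"
      then have xy': "x \<in> carrier G1" "y \<in> carrier G2" using ab by auto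
      have "x \<in> f1 ` carrier H \<or> y \<in> f2 ` carrier H"
        using bad xy unfolding a_def b_def by auto
      then show False
      proof
        assume "x \<in> f1 ` carrier H"
        then obtain h where h: "h \<in> carrier H" "x = f1 h" by blast
        have "?eq [a, b] [Inr (f2 h), Inr y]"
          unfolding xy h(2) using h xy' by (intro cong2 amalg_eq.amalg ref) (auto simp: amalg_words_def)
        then show False using no amalg_eq.trans amalg_eq.mult2[OF hcl(2)[OF h(1)] xy'(2)] by blast
      next
        assume "y \<in> f2 ` carrier H"
        then obtain h where h: "h \<in> carrier H" "y = f2 h" by blast
        have "?eq [a, b] [Inl x, Inl (f1 h)]"
          unfolding xy h(2) using h xy' by (intro cong2 amalg_eq.sym[OF amalg_eq.amalg] ref) (auto simp: amalg_words_def)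
        then show False using no amalg_eq.trans amalg_eq.mult1[OF xy'(1) hcl(1)[OF h(1)]] by blast
      qed
    next
      fix y x assume xy: "a = Inr y" "b = Inl x"
      then have xy': "x \<in> carrier G1" "y \<in> carrier G2" using ab by auto
      have "x \<in> f1 ` carrier H \<or> y \<in> f2 ` carrier H"
        using bad xy unfolding a_def b_def by auto
      then show False
      proof
        assume "x \<in> f1 ` carrier H"
        then obtain h where h: "h \<in> carrier H" "x = f1 h" by blast
        have "?eq [a, b] [Inr y, Inr (f2 h)]"
          unfolding xy h(2) using h xy' by (intro cong2 amalg_eq.amalg ref) (auto simp: amalg_words_def)
        then show False using no amalg_eq.trans amalg_eq.mult2[OF xy'(2) hcl(2)[OF h(1)]] by blast
      next
        assume "y \<in> f2 ` carrier H"
        then obtain h where h: "h \<in> carrier H" "y = f2 h" by blast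
        have "?eq [a, b] [Inl (f1 h), Inl x]"
          unfolding xy h(2) using h xy' by (intro cong2 amalg_eq.sym[OF amalg_eq.amalg] ref) (auto simp: amalg_words_def)
        then show False using no amalg_eq.trans amalg_eq.mult1[OF hcl(1)[OF h(1)] xy'(1)] by blast
      qed
    qed
  qed
  have "distinct_adj (map isl w')" using pair by (simp add: distinct_adj_conv_nth)
  moreover have "set w' \<subseteq> (carrier G1 - f1 ` carrier H) <+> (carrier G2 - f2 ` carrier H)" if len: "2 \<le> length w'"
  proof
    fix l assume l: "l \<in> set w'"
    then obtain i where i: "i < length w'" "l = w' ! i" by (metis in_set_conv_nth)
    have "l \<notin> Inl ` f1 ` carrier H \<union> Inr ` f2 ` carrier H"
    proof (cases "Suc i < length w'")
      case True
      then show ?thesis using pair[OF True] i by auto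
    next
      case False
      \<comment> \<open>The last letter has no successor, but it has a predecessor since the word
        has at least two letters; a single letter from the image of \<open>H\<close> cannot be
        excluded.\<close>
      then obtain k where "i = Suc k" using len i by (cases i) auto
      then show ?thesis using pair[of k] i by auto
    qed
    moreover have "l \<in> carrier G1 <+> carrier G2" using words l by (auto simp: amalg_words_def)
    ultimately show "l \<in> (carrier G1 - f1 ` carrier H) <+> (carrier G2 - f2 ` carrier H)" by auto
  qed
  ultimately show ?thesis using w' by (cases "length w' \<le> 1") auto
qed

section \<open>Classes of sequences of permutations\<close>

definition perm_class :: "nat filter \<Rightarrow> (nat \<Rightarrow> nat) \<Rightarrow> (nat \<Rightarrow> nat \<Rightarrow> nat) \<Rightarrow> (nat \<Rightarrow> complex mat) set" where
  "perm_class \<omega> n \<sigma> = ultra_rel \<omega> n `` {\<lambda>k. perm_matrix (n k) (\<sigma> k)}"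

lemma perm_seqs_perm_matrix:
  "(\<And>k. \<sigma> k permutes {..<n k}) \<Longrightarrow> (\<lambda>k. perm_matrix (n k) (\<sigma> k)) \<in> perm_seqs n"
  by (auto simp: perm_seqs_def perm_matrices_def)

lemma perm_class_carrier:
  "(\<And>k. \<sigma> k permutes {..<n k}) \<Longrightarrow> perm_class \<omega> n \<sigma> \<in> carrier (perm_ultraproduct \<omega> n)"
  using perm_seqs_perm_matrix[of \<sigma> n] by (simp add: perm_class_def perm_ultraproduct_def quotientI)

lemma perm_class_eqI:
  assumes "\<And>k. \<sigma> k permutes {..<n k}" "\<And>k. \<tau> k permutes {..<n k}"
    and "((\<lambda>k. card {j. j < n k \<and> \<sigma> k j \<noteq> \<tau> k j} / n k) \<longlongrightarrow> 0) \<omega>"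
  shows "perm_class \<omega> n \<sigma> = perm_class \<omega> n \<tau>"
  unfolding perm_class_def
  by (rule equiv_class_eq[OF equiv_ultra_rel]) (simp add: ultra_rel_iff[OF assms(1,2)] assms(3))

lemma perm_class_mult:
  assumes "\<And>k. \<sigma> k permutes {..<n k}" "\<And>k. \<tau> k permutes {..<n k}"
  shows "perm_class \<omega> n \<sigma> \<otimes>\<^bsub>perm_ultraproduct \<omega> n\<^esub> perm_class \<omega> n \<tau> = perm_class \<omega> n (\<lambda>k. \<sigma> k \<circ> \<tau> k)"
proof -
  have "perm_class \<omega> n \<sigma> \<otimes>\<^bsub>perm_ultraproduct \<omega> n\<^esub> perm_class \<omega> n \<tau> =
      ultra_rel \<omega> n `` {\<lambda>k. perm_matrix (n k) (\<sigma> k) * perm_matrix (n k) (\<tau> k)}"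
    unfolding perm_class_def perm_ultraproduct_def monoid.simps
    by (rule quotient_mult[OF equiv_ultra_rel ultra_rel_mult]) (use assms in \<open>auto intro: perm_seqs_perm_matrix\<close>)
  also have "(\<lambda>k. perm_matrix (n k) (\<sigma> k) * perm_matrix (n k) (\<tau> k)) = (\<lambda>k. perm_matrix (n k) (\<sigma> k \<circ> \<tau> k))"
    using perm_matrix_mult[OF assms(2)] by (rule ext)
  finally show ?thesis by (simp only: perm_class_def)
qed

lemma perm_class_one: "perm_class \<omega> n (\<lambda>k. id) = \<one>\<^bsub>perm_ultraproduct \<omega> n\<^esub>"
  by (simp add: perm_class_def perm_ultraproduct_def perm_matrix_id)

lemma ultra_trace_perm_class:
  assumes \<omega>: "free_ultrafilter \<omega>" and n: "\<And>k. 0 < n k" and \<sigma>: "\<And>k. \<sigma> k permutes {..<n k}"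
    and fix0: "((\<lambda>k. card {j. j < n k \<and> \<sigma> k j = j} / n k) \<longlongrightarrow> 0) \<omega>"
  shows "ultra_trace \<omega> (perm_class \<omega> n \<sigma>) = 0"
proof -
  have "(\<lambda>k. perm_matrix (n k) (\<sigma> k)) \<in> perm_class \<omega> n \<sigma>"
    unfolding perm_class_def by (rule equiv_class_self[OF equiv_ultra_rel perm_seqs_perm_matrix[OF \<sigma>]])
  from ultra_trace_eq[OF \<omega> n perm_class_carrier[OF \<sigma>] this]
  have "((\<lambda>k. complex_of_real (card {j. j < n k \<and> \<sigma> k j = j} / n k)) \<longlongrightarrow> ultra_trace \<omega> (perm_class \<omega> n \<sigma>)) \<omega>"
    unfolding ntrace_perm_matrix[OF \<sigma>] .
  moreover have "((\<lambda>k. complex_of_real (card {j. j < n k \<and> \<sigma> k j = j} / n k)) \<longlongrightarrow> complex_of_real 0) \<omega>"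
    using fix0 by (rule tendsto_of_real)
  moreover have "\<omega> \<noteq> bot" using \<omega> by (simp add: free_ultrafilter_def)
  ultimately show ?thesis using tendsto_unique by force
qed

lemma perm_class_hom:
  assumes G: "group G" and \<sigma>: "\<And>k g. g \<in> carrier G \<Longrightarrow> \<sigma> k g permutes {..<n k}"
    and mult: "\<And>g h. g \<in> carrier G \<Longrightarrow> h \<in> carrier G \<Longrightarrow>
      ((\<lambda>k. card {j. j < n k \<and> \<sigma> k (g \<otimes>\<^bsub>G\<^esub> h) j \<noteq> \<sigma> k g (\<sigma> k h j)} / n k) \<longlongrightarrow> 0) \<omega>"
  shows "(\<lambda>g. perm_class \<omega> n (\<lambda>k. \<sigma> k g)) \<in> hom G (perm_ultraproduct \<omega> n)"
proof (rule homI)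
  interpret group G by (rule G)
  show "perm_class \<omega> n (\<lambda>k. \<sigma> k g) \<in> carrier (perm_ultraproduct \<omega> n)" if "g \<in> carrier G" for g
    by (intro perm_class_carrier \<sigma> that)
  fix g h assume gh: "g \<in> carrier G" "h \<in> carrier G"
  have "perm_class \<omega> n (\<lambda>k. \<sigma> k (g \<otimes>\<^bsub>G\<^esub> h)) = perm_class \<omega> n (\<lambda>k. \<sigma> k g \<circ> \<sigma> k h)"
    by (rule perm_class_eqI) (use mult[OF gh] \<sigma> gh in \<open>auto intro: permutes_compose\<close>)
  then show "perm_class \<omega> n (\<lambda>k. \<sigma> k (g \<otimes>\<^bsub>G\<^esub> h)) =
      perm_class \<omega> n (\<lambda>k. \<sigma> k g) \<otimes>\<^bsub>perm_ultraproduct \<omega> n\<^esub> perm_class \<omega> n (\<lambda>k. \<sigma> k h)"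
    using \<sigma> gh by (simp add: perm_class_mult)
qed

lemma countable_amalgamated_product:
  assumes "countable (carrier G1)" "countable (carrier G2)"
  shows "countable (carrier (amalgamated_product G1 G2 H f1 f2))"
proof -
  have "carrier (amalgamated_product G1 G2 H f1 f2) = (\<lambda>w. amalg_rel G1 G2 H f1 f2 `` {w}) ` amalg_words G1 G2"
    by (auto simp: amalgamated_product_def quotient_def)
  moreover have "countable (amalg_words G1 G2)" using assms by (simp add: amalg_words_def)
  ultimately show ?thesis by simp
qed

theorem corollary2p3:
  fixes \<omega> :: "nat filter"
    and G1 :: "('a, 'm) monoid_scheme"
    and G2 :: "('b, 'n) monoid_scheme"
    and H :: "('c, 'l) monoid_scheme"
    and f1 :: "'c \<Rightarrow> 'a"
    and f2 :: "'c \<Rightarrow> 'b"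
  assumes "free_ultrafilter \<omega>"
    and "sofic_group \<omega> G1"
    and "sofic_group \<omega> G2"
    and "amenable_group H"
    and "f1 \<in> mon H G1"
    and "f2 \<in> mon H G2"
  shows "sofic_group \<omega> (amalgamated_product G1 G2 H f1 f2)"
proof -
  interpret G1: group G1 using assms(2) by (simp add: sofic_group_def)
  interpret G2: group G2 using assms(3) by (simp add: sofic_group_def)
  have G: "group G1" "group G2" by unfold_locales
  have f: "f1 \<in> hom H G1" "f2 \<in> hom H G2" using assms(5,6) by (auto simp: mon_def)
  have cG: "countable (carrier G1)" "countable (carrier G2)" using assms(2,3) by (auto simp: sofic_group_def)
  have "countable (f1 ` carrier H)"
    by (rule countable_subset[OF _ cG(1)]) (use f in \<open>auto simp: hom_def\<close>)
  then have cH: "countable (carrier H)" using assms(5) by (auto simp: mon_def dest: countable_image_inj_on)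
  let ?P = "amalgamated_product G1 G2 H f1 f2"
  let ?cls = "\<lambda>w. amalg_rel G1 G2 H f1 f2 `` {w}"
  obtain A1 where A1: "\<And>j. finite (A1 j)" "\<And>j. A1 j \<subseteq> carrier G1"
    "\<And>x. x \<in> carrier G1 \<Longrightarrow> eventually (\<lambda>j. x \<in> A1 j) sequentially" using countable_exhaustion[OF cG(1)] by blast
  obtain A2 where A2: "\<And>j. finite (A2 j)" "\<And>j. A2 j \<subseteq> carrier G2"
    "\<And>x. x \<in> carrier G2 \<Longrightarrow> eventually (\<lambda>j. x \<in> A2 j) sequentially" using countable_exhaustion[OF cG(2)] by blast
  obtain D where D: "\<And>j. finite (D j)" "\<And>j. D j \<subseteq> carrier H"
    "\<And>x. x \<in> carrier H \<Longrightarrow> eventually (\<lambda>j. x \<in> D j) sequentially" using countable_exhaustion[OF cH] by blast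
  \<comment> \<open>The windows, the word length and the error all depend on \<open>j\<close>, so
    one sequence of models serves every element: each condition concerns finitely many elements,
    which lie in the windows from some \<open>j\<close> on.\<close>
  have "\<forall>j. \<exists>(n :: nat) \<tau>1 \<tau>2. 0 < n \<and> (\<forall>g\<in>carrier G1. \<tau>1 g permutes {..<n}) \<and> (\<forall>g\<in>carrier G2. \<tau>2 g permutes {..<n}) \<and>
    amalg_model G1 G2 H f1 f2 (A1 j) (A2 j) (D j) j (1 / (real j + 1)) {..<n} \<tau>1 \<tau>2"
    by (intro allI amalg_model_exists[OF assms A1(1,2) A2(1,2) D(1,2)]) simp
  then obtain n :: "nat \<Rightarrow> nat" and t1 t2 where n: "\<And>j. 0 < n j"
    and t1: "\<And>j g. g \<in> carrier G1 \<Longrightarrow> t1 j g permutes {..<n j}"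
    and t2: "\<And>j g. g \<in> carrier G2 \<Longrightarrow> t2 j g permutes {..<n j}"
    and model: "\<And>j. amalg_model G1 G2 H f1 f2 (A1 j) (A2 j) (D j) j (1 / (real j + 1)) {..<n j} (t1 j) (t2 j)"
    by metis
  have to0: "((\<lambda>j. card {i. i < n j \<and> Q j i} / n j) \<longlongrightarrow> 0) \<omega>"
    if "eventually (\<lambda>j. card {i \<in> {..<n j}. Q j i} \<le> 1 / (real j + 1) * n j) sequentially" for Q
  proof (rule tendsto_0_of_eventually_le[OF assms(1)])
    show "eventually (\<lambda>j. card {i. i < n j \<and> Q j i} / n j \<le> 1 / (real j + 1)) sequentially"
      using that by (rule eventually_mono) (use n in \<open>simp add: field_simps\<close>)
  qed simp
  have bad: "card {i \<in> {..<n j}. Q i} \<le> 1 / (real j + 1) * n j"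
    if "card {i \<in> {..<n j}. R i} \<le> 1 / (real j + 1) * n j" "\<And>i. i < n j \<Longrightarrow> Q i \<Longrightarrow> R i" for j Q R
  proof -
    have "card {i \<in> {..<n j}. Q i} \<le> card {i \<in> {..<n j}. R i}" using that(2) by (intro card_mono) auto
    then show ?thesis using that(1) by linarith
  qed
  have free1: "card {i \<in> {..<n j}. \<not> acts_freely_at G1 (t1 j) (A1 j) i} \<le> 1 / (real j + 1) * n j"
    and free2: "card {i \<in> {..<n j}. \<not> acts_freely_at G2 (t2 j) (A2 j) i} \<le> 1 / (real j + 1) * n j" for j
    using model[of j] by (simp_all add: amalg_model_def)
  define \<Theta>1 where "\<Theta>1 g = perm_class \<omega> n (\<lambda>k. t1 k g)" for g
  define \<Theta>2 where "\<Theta>2 g = perm_class \<omega> n (\<lambda>k. t2 k g)" for g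
  have \<Theta>1: "\<Theta>1 \<in> hom G1 (perm_ultraproduct \<omega> n)"
    unfolding \<Theta>1_def[abs_def]
  proof (rule perm_class_hom[OF G(1) t1])
    fix g h assume gh: "g \<in> carrier G1" "h \<in> carrier G1"
    show "((\<lambda>k. card {j. j < n k \<and> t1 k (g \<otimes>\<^bsub>G1\<^esub> h) j \<noteq> t1 k g (t1 k h j)} / n k) \<longlongrightarrow> 0) \<omega>"
      by (rule to0, rule eventually_mono[OF eventually_conj[OF A1(3)[OF gh(1)] A1(3)[OF gh(2)]]], rule bad[OF free1])
         (auto dest: acts_freely_at_mult)
  qed
  have \<Theta>2: "\<Theta>2 \<in> hom G2 (perm_ultraproduct \<omega> n)"
    unfolding \<Theta>2_def[abs_def]
  proof (rule perm_class_hom[OF G(2) t2])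
    fix g h assume gh: "g \<in> carrier G2" "h \<in> carrier G2"
    show "((\<lambda>k. card {j. j < n k \<and> t2 k (g \<otimes>\<^bsub>G2\<^esub> h) j \<noteq> t2 k g (t2 k h j)} / n k) \<longlongrightarrow> 0) \<omega>"
      by (rule to0, rule eventually_mono[OF eventually_conj[OF A2(3)[OF gh(1)] A2(3)[OF gh(2)]]], rule bad[OF free2])
         (auto dest: acts_freely_at_mult)
  qed
  have agree: "\<Theta>1 (f1 h) = \<Theta>2 (f2 h)" if h: "h \<in> carrier H" for h
    unfolding \<Theta>1_def \<Theta>2_def
  proof (rule perm_class_eqI)
    show "t1 k (f1 h) permutes {..<n k}" "t2 k (f2 h) permutes {..<n k}" for k
      using t1 t2 hom_in_carrier[OF f(1) h] hom_in_carrier[OF f(2) h] by auto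
    show "((\<lambda>k. card {j. j < n k \<and> t1 k (f1 h) j \<noteq> t2 k (f2 h) j} / n k) \<longlongrightarrow> 0) \<omega>"
      by (rule to0, rule eventually_mono[OF D(3)[OF h]]) (use model in \<open>auto simp: amalg_model_def\<close>)
  qed
  \<comment> \<open>The universal property supplies the homomorphism, so only the trace remains to
    be computed, and for this any word representing the element may be used.\<close>
  obtain \<phi> where \<phi>: "\<phi> \<in> hom ?P (perm_ultraproduct \<omega> n)"
    "\<forall>x\<in>carrier G1. \<phi> (amalg_in1 G1 G2 H f1 f2 x) = \<Theta>1 x"
    "\<forall>y\<in>carrier G2. \<phi> (amalg_in2 G1 G2 H f1 f2 y) = \<Theta>2 y"
    by (rule bexE[OF amalgamated_product_universal[OF G f group_perm_ultraproduct \<Theta>1 \<Theta>2]],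
        rule agree, assumption, elim conjE) (intro that; assumption)
  define W where "W w k = foldr (case_sum (t1 k) (t2 k)) w" for w k
  have W: "W [] = (\<lambda>k. id)" "W (l # w) = (\<lambda>k. case_sum (t1 k) (t2 k) l \<circ> W w k)" for l w
    by (auto simp: W_def)
  have perm_word: "W w k permutes {..<n k}"
    if "w \<in> amalg_words G1 G2" for w k
    using that by (induction w) (auto simp: W amalg_words_def intro!: permutes_compose t1 t2 permutes_id)
  have cls_carrier: "?cls w \<in> carrier ?P" if "w \<in> amalg_words G1 G2" for w
    using that by (simp add: amalgamated_product_def quotientI)
  have \<phi>_word: "\<phi> (?cls w) = perm_class \<omega> n (W w)"
    if "w \<in> amalg_words G1 G2" for w
    using that
  proof (induction w)
    case Nil
    have "?cls [] = \<one>\<^bsub>?P\<^esub>" by (simp add: amalgamated_product_def)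
    then show ?case using hom_one[OF \<phi>(1) group_amalgamated_product[OF G f] group_perm_ultraproduct]
      by (simp only: W(1) perm_class_one)
  next
    case (Cons l w)
    then have l: "l \<in> carrier G1 <+> carrier G2" and w: "w \<in> amalg_words G1 G2" and lw: "[l] \<in> amalg_words G1 G2"
      by (auto simp: amalg_words_def)
    have \<phi>l: "\<phi> (?cls [l]) = perm_class \<omega> n (\<lambda>k. case_sum (t1 k) (t2 k) l)"
      using l \<phi>(2,3) unfolding amalg_in1_def[OF G f] amalg_in2_def[OF G f] by (auto simp: \<Theta>1_def \<Theta>2_def)
    have perm_l: "case_sum (t1 k) (t2 k) l permutes {..<n k}" for k
      using l t1 t2 by auto
    have "?cls (l # w) = ?cls [l] \<otimes>\<^bsub>?P\<^esub> ?cls w"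
      using amalg_mult[OF G f lw w] by simp
    then have "\<phi> (?cls (l # w)) = \<phi> (?cls [l]) \<otimes>\<^bsub>perm_ultraproduct \<omega> n\<^esub> \<phi> (?cls w)"
      using hom_mult[OF \<phi>(1) cls_carrier[OF lw] cls_carrier[OF w]] by (simp only:)
    also have "\<dots> = perm_class \<omega> n (W (l # w))"
      unfolding \<phi>l Cons.IH[OF w] W(2) by (rule perm_class_mult[OF perm_l perm_word[OF w]])
    finally show ?case .
  qed
  have "ultra_trace \<omega> (\<phi> g) = 0" if g: "g \<in> carrier ?P" "g \<noteq> \<one>\<^bsub>?P\<^esub>" for g
  proof -
    obtain w0 where "w0 \<in> amalg_words G1 G2" "g = ?cls w0"
      using g(1) by (auto simp: amalgamated_product_def elim: quotientE)
    with amalg_reduced_word[OF G f] obtain w where w0w: "amalg_eq G1 G2 H f1 f2 w0 w"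
      and red: "length w \<le> 1 \<or> 2 \<le> length w \<and> distinct_adj (map isl w) \<and>
        set w \<subseteq> (carrier G1 - f1 ` carrier H) <+> (carrier G2 - f2 ` carrier H)" by blast
    have w: "w \<in> amalg_words G1 G2" using amalg_eq_words[OF G f w0w] by simp
    have gw: "g = ?cls w" using amalg_class_eq[OF G f w0w] \<open>g = ?cls w0\<close> by simp
    have not1: "\<not> amalg_eq G1 G2 H f1 f2 w []"
      using amalg_class_eq[OF G f, of w "[]"] g(2) by (auto simp: gw amalgamated_product_def)
    have "eventually (\<lambda>j. card {i \<in> {..<n j}. foldr (case_sum (t1 j) (t2 j)) w i = i} \<le> 1 / (real j + 1) * n j) sequentially"
    \<comment> \<open>A single letter may lie in the image of \<open>H\<close>, and the model bounds
      fixed points only of longer words; here freeness of the action of its own group does the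
      work.\<close>
    proof (cases "length w \<le> 1")
      case True
      moreover have "w \<noteq> []" using not1 amalg_eq.refl[OF w] by blast
      ultimately obtain l where l: "w = [l]" by (cases w) auto
      show ?thesis
      proof (cases l)
        case (Inl a)
        have a: "a \<in> carrier G1" "a \<noteq> \<one>\<^bsub>G1\<^esub>" using w not1 amalg_eq.one1[of G1 G2 H f1 f2] by (auto simp: l Inl amalg_words_def)
        show ?thesis
        proof (rule eventually_mono[OF eventually_conj[OF A1(3)[OF a(1)] A1(3)[OF G1.one_closed]]], rule bad[OF free1])
          fix j i assume "a \<in> A1 j \<and> \<one>\<^bsub>G1\<^esub> \<in> A1 j" "i < n j" "foldr (case_sum (t1 j) (t2 j)) w i = i"
          then show "\<not> acts_freely_at G1 (t1 j) (A1 j) i"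
            using acts_freely_at_not_fixed[where \<rho> = "t1 j" and X = "{..<n j}" and x = i and F = "A1 j" and g = a,
                OF G(1) permutes_imp_bij[OF t1[OF G1.one_closed]]] a l Inl
            by auto
        qed
      next
        case (Inr a)
        have a: "a \<in> carrier G2" "a \<noteq> \<one>\<^bsub>G2\<^esub>" using w not1 amalg_eq.one2[of G1 G2 H f1 f2] by (auto simp: l Inr amalg_words_def)
        show ?thesis
        proof (rule eventually_mono[OF eventually_conj[OF A2(3)[OF a(1)] A2(3)[OF G2.one_closed]]], rule bad[OF free2])
          fix j i assume "a \<in> A2 j \<and> \<one>\<^bsub>G2\<^esub> \<in> A2 j" "i < n j" "foldr (case_sum (t1 j) (t2 j)) w i = i"
          then show "\<not> acts_freely_at G2 (t2 j) (A2 j) i"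
            using acts_freely_at_not_fixed[where \<rho> = "t2 j" and X = "{..<n j}" and x = i and F = "A2 j" and g = a,
                OF G(2) permutes_imp_bij[OF t2[OF G2.one_closed]]] a l Inr
            by auto
        qed
      qed
    next
      case False
      with red have len: "2 \<le> length w" and alt: "distinct_adj (map isl w)"
        and letters: "set w \<subseteq> (carrier G1 - f1 ` carrier H) <+> (carrier G2 - f2 ` carrier H)" by auto
      have "eventually (\<lambda>j. \<forall>l\<in>set w. l \<in> (A1 j - f1 ` carrier H) <+> (A2 j - f2 ` carrier H)) sequentially"
      proof (rule eventually_ball_finite)
        show "\<forall>l\<in>set w. eventually (\<lambda>j. l \<in> (A1 j - f1 ` carrier H) <+> (A2 j - f2 ` carrier H)) sequentially"
        proof
          fix l assume "l \<in> set w"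
          with letters have "l \<in> (carrier G1 - f1 ` carrier H) <+> (carrier G2 - f2 ` carrier H)" by blast
          then show "eventually (\<lambda>j. l \<in> (A1 j - f1 ` carrier H) <+> (A2 j - f2 ` carrier H)) sequentially"
          proof (elim PlusE)
            fix a assume a: "l = Inl a" "a \<in> carrier G1 - f1 ` carrier H"
            show ?thesis by (rule eventually_mono[OF A1(3)[of a]]) (use a in auto)
          next
            fix b assume b: "l = Inr b" "b \<in> carrier G2 - f2 ` carrier H"
            show ?thesis by (rule eventually_mono[OF A2(3)[of b]]) (use b in auto)
          qed
        qed
      qed simp
      from eventually_conj[OF this eventually_ge_at_top[of "length w"]] show ?thesis
      proof (rule eventually_mono)
        fix j assume "(\<forall>l\<in>set w. l \<in> (A1 j - f1 ` carrier H) <+> (A2 j - f2 ` carrier H)) \<and> length w \<le> j"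
        then show "card {i \<in> {..<n j}. foldr (case_sum (t1 j) (t2 j)) w i = i} \<le> 1 / (real j + 1) * n j"
          using amalg_model_fixed[OF model[of j] _ alt len] by auto
      qed
    qed
    from to0[OF this] show ?thesis
      unfolding gw \<phi>_word[OF w] by (intro ultra_trace_perm_class[OF assms(1) n perm_word[OF w]]) (simp add: W_def)
  qed
  then show ?thesis
    unfolding sofic_group_def
    using group_amalgamated_product[OF G f] countable_amalgamated_product[OF cG] n \<phi>(1) by blast
qed

end
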